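(* Let $\ell>0$, $0<a\le b<\infty$, and let $\{m_\varepsilon\}_{\varepsilon>0}$, $\{n_\varepsilon\}_{\varepsilon>0}\subset L^\infty([0,\ell])$ be two families of weights with $a\le m_\varepsilon(x),n_\varepsilon(x)\le b$ for all $\varepsilon>0$ and a.e. $x\in[0,\ell]$, such that $m_\varepsilon\stackrel{*}{\rightharpoonup} m_0$ and $n_\varepsilon\stackrel{*}{\rightharpoonup} n_0$ weakly* in $L^\infty([0,\ell])$ as $\varepsilon\to0$. Let $k\ge 0$ be a fixed integer, let $0<t<1$, and for each $\varepsilon>0$ let $(\alpha_{k,\varepsilon},\beta_{k,\varepsilon})\in\mathcal C_{k,\varepsilon}\cap\mathcal K_t$. Then: (i) $\{(\alpha_{k,\varepsilon},\beta_{k,\varepsilon})\}_{\varepsilon>0}$ is bounded in $\mathbb R^2$, and if $(\alpha_{k,0},\beta_{k,0})$ is any accumulation point of this family as $\varepsilon\to 0$, then $(\alpha_{k,0},\beta_{k,0})\in\mathcal C_{k,0}\cap\mathcal K_t\subset\Sigma_0$. (ii) If moreover $(\alpha_{k,\varepsilon},\beta_{k,\varepsilon})\in\mathcal C_{k,\varepsilon}^+\cap\mathcal K_t$ for all $\varepsilon>0$, then $(\alpha_{k,0},\beta_{k,0})\in\mathcal C_{k,0}^+$; and the analogous statement holds with $-$ in place of $+$. (iii) If for each $\varepsilon>0$ the function $u_\varepsilon\in H^1_0([0,\ell])$ is an eigenfunction of $(P_\varepsilon)$ associated to $(\alpha_{k,\varepsilon},\beta_{k,\varepsilon})$, normalized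 by $\|u_\varepsilon\|_{L^2([0,\ell])}=1$, and $(\alpha_{k,0},\beta_{k,0})$ is an accumulation point as in (i), then there exist $u_0\in H^1_0([0,\ell])$ and a sequence $\varepsilon_j\downarrow0$ such that $u_{\varepsilon_j}\rightharpoonup u_0$ weakly in $H_0^1([0,\ell])$ and $u_0$ is an eigenfunction of $(P_0)$ associated to $(\alpha_{k,0},\beta_{k,0})$.
   Context: Write $u^\pm=\max\{0,\pm u\}$. For $\varepsilon\ge0$, problem $(P_\varepsilon)$ is $$-u''=\alpha\,m_\varepsilon(x)u^+-\beta\,n_\varepsilon(x)u^-\ \text{ in }(0,\ell),\qquad u(0)=u(\ell)=0,$$ understood weakly: $u\in H^1_0([0,\ell])$ and $\int_0^\ell u'v'\,dx=\int_0^\ell(\alpha m_\varepsilon u^+-\beta n_\varepsilon u^-)v\,dx$ for all $v\in H^1_0([0,\ell])$. An eigenfunction of $(P_\varepsilon)$ associated to $(\alpha,\beta)$ is a nontrivial weak solution for that pair. The Fučík spectrum is $\Sigma_\varepsilon=\{(\alpha,\beta)\in\mathbb R^2:\ (P_\varepsilon)\text{ has a nontrivial solution}\}$. It decomposes as $\Sigma_\varepsilon=\bigcup_{k\ge0}(\mathcal C_{k,\varepsilon}^+\cup\mathcal C_{k,\varepsilon}^-)$, where, for $k\ge1$, $\mathcal C_{k,\varepsilon}^+$ (resp. $\mathcal C_{k,\varepsilon}^-$) is the set of $(\alpha,\beta)$ for which $(P_\varepsilon)$ has a nontrivial solution with exactly $k$ zeros in the open interval $(0,\ell)$ and with $u'(0)>0$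 (resp. $u'(0)<0$), and for $k=0$, $\mathcal C_{0,\varepsilon}^+=\{\lambda_1^{m_\varepsilon}\}\times\mathbb R$, $\mathcal C_{0,\varepsilon}^-=\mathbb R\times\{\lambda_1^{n_\varepsilon}\}$, where $\lambda_1^r$ is the first eigenvalue of $-u''=\lambda r u$ in $(0,\ell)$, $u(0)=u(\ell)=0$. Put $\mathcal C_{k,\varepsilon}=\mathcal C_{k,\varepsilon}^+\cup\mathcal C_{k,\varepsilon}^-$. For $0<t<1$, $\mathcal K_t=\{(\alpha,\beta)\in\mathbb R_+\times\mathbb R_+:\ t\alpha\le\beta\le t^{-1}\alpha\}$, with $\mathbb R_+=(0,\infty)$. *)

theory Defs
  imports "HOL-Analysis.Analysis"
begin

section \<open>Function spaces on \<open>[0, l]\<close>\<close>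

text \<open>Elements of \<open>L\<^sup>2\<close>, \<open>L\<^sup>\<infinity>\<close> and \<open>H\<^sup>1\<close> are represented by functions \<open>real \<Rightarrow> real\<close>,
  whose values outside \<open>[0, l]\<close> play no role.\<close>

abbreviation Om :: "real \<Rightarrow> real measure" where
  "Om l \<equiv> lebesgue_on {0..l}"

definition L2 :: "real \<Rightarrow> (real \<Rightarrow> real) set" where
  "L2 l = {f \<in> borel_measurable (Om l). integrable (Om l) (\<lambda>x. (f x)\<^sup>2)}"

definition L2_norm :: "real \<Rightarrow> (real \<Rightarrow> real) \<Rightarrow> real" where
  "L2_norm l f = sqrt (\<integral>x. (f x)\<^sup>2 \<partial>(Om l))"

definition Linfty :: "real \<Rightarrow> (real \<Rightarrow> real) set" where
  "Linfty l = {f \<in> borel_measurable (Om l). \<exists>C. AE x in Om l. \<bar>f x\<bar> \<le> C}"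

definition weak_star_Linfty ::
  "real \<Rightarrow> ('a \<Rightarrow> real \<Rightarrow> real) \<Rightarrow> (real \<Rightarrow> real) \<Rightarrow> 'a filter \<Rightarrow> bool" where
  "weak_star_Linfty l f g F \<longleftrightarrow>
     (\<forall>\<phi>. integrable (Om l) \<phi> \<longrightarrow>
        ((\<lambda>i. \<integral>x. f i x * \<phi> x \<partial>(Om l)) \<longlongrightarrow> (\<integral>x. g x * \<phi> x \<partial>(Om l))) F)"

text \<open>\<open>C\<^sub>c\<^sup>\<infinity>(0, l)\<close>, each function being extended by zero to the whole line.\<close>

definition test_functions :: "real \<Rightarrow> (real \<Rightarrow> real) set" where
  "test_functions l = {\<phi>. (\<forall>n x. (deriv ^^ n) \<phi> differentiable (at x)) \<and>
     (\<exists>c d. 0 < c \<and> d < l \<and> (\<forall>x. x \<notin> {c..d} \<longrightarrow> \<phi> x = 0))}"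

definition has_L2_weak_deriv :: "real \<Rightarrow> (real \<Rightarrow> real) \<Rightarrow> (real \<Rightarrow> real) \<Rightarrow> bool" where
  "has_L2_weak_deriv l u g \<longleftrightarrow> g \<in> L2 l \<and>
     (\<forall>\<phi> \<in> test_functions l. (\<integral>x. u x * deriv \<phi> x \<partial>(Om l)) = - (\<integral>x. g x * \<phi> x \<partial>(Om l)))"

definition H1 :: "real \<Rightarrow> (real \<Rightarrow> real) set" where
  "H1 l = {u \<in> L2 l. \<exists>g. has_L2_weak_deriv l u g}"

text \<open>The weak derivative is unique only up to null sets. It is used only under integrals,
  so that the choice does not matter.\<close>

definition weak_deriv :: "real \<Rightarrow> (real \<Rightarrow> real) \<Rightarrow> real \<Rightarrow> real" where
  "weak_deriv l u = (SOME g. has_L2_weak_deriv l u g)"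

definition H1_norm :: "real \<Rightarrow> (real \<Rightarrow> real) \<Rightarrow> real" where
  "H1_norm l u = sqrt ((L2_norm l u)\<^sup>2 + (L2_norm l (weak_deriv l u))\<^sup>2)"

text \<open>\<open>H\<^sup>1\<^sub>0\<close> is the closure of \<open>C\<^sub>c\<^sup>\<infinity>(0, l)\<close> in \<open>H\<^sup>1\<close>. Every class in \<open>H\<^sup>1\<close> has exactly one
  representative that is continuous on \<open>[0, l]\<close>, and this is the one taken here, so that
  zeros and one-sided derivatives of its elements make sense.\<close>

definition H10 :: "real \<Rightarrow> (real \<Rightarrow> real) set" where
  "H10 l = {u \<in> H1 l. continuous_on {0..l} u \<and>
     (\<forall>e>0. \<exists>\<phi> \<in> test_functions l. H1_norm l (\<lambda>x. u x - \<phi> x) < e)}"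

definition H10_dual :: "real \<Rightarrow> ((real \<Rightarrow> real) \<Rightarrow> real) set" where
  "H10_dual l = {T.
     (\<forall>u \<in> H10 l. \<forall>v \<in> H10 l. T (\<lambda>x. u x + v x) = T u + T v) \<and>
     (\<forall>c. \<forall>u \<in> H10 l. T (\<lambda>x. c * u x) = c * T u) \<and>
     (\<exists>K. \<forall>u \<in> H10 l. \<bar>T u\<bar> \<le> K * H1_norm l u)}"

definition weak_conv_H10 :: "real \<Rightarrow> (nat \<Rightarrow> real \<Rightarrow> real) \<Rightarrow> (real \<Rightarrow> real) \<Rightarrow> bool" where
  "weak_conv_H10 l u v \<longleftrightarrow> (\<forall>T \<in> H10_dual l. (\<lambda>j. T (u j)) \<longlonglongrightarrow> T v)"

section \<open>The Fucik problem\<close>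

definition weak_solution ::
  "real \<Rightarrow> (real \<Rightarrow> real) \<Rightarrow> (real \<Rightarrow> real) \<Rightarrow> real \<Rightarrow> real \<Rightarrow> (real \<Rightarrow> real) \<Rightarrow> bool" where
  "weak_solution l m n \<alpha> \<beta> u \<longleftrightarrow> u \<in> H10 l \<and>
     (\<forall>v \<in> H10 l. (\<integral>x. weak_deriv l u x * weak_deriv l v x \<partial>(Om l)) =
        (\<integral>x. (\<alpha> * m x * max 0 (u x) - \<beta> * n x * max 0 (- u x)) * v x \<partial>(Om l)))"

definition eigenfunction ::
  "real \<Rightarrow> (real \<Rightarrow> real) \<Rightarrow> (real \<Rightarrow> real) \<Rightarrow> real \<Rightarrow> real \<Rightarrow> (real \<Rightarrow> real) \<Rightarrow> bool" where
  "eigenfunction l m n \<alpha> \<beta> u \<longleftrightarrow>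
     weak_solution l m n \<alpha> \<beta> u \<and> (\<exists>x \<in> {0..l}. u x \<noteq> 0)"

definition Fucik_spectrum ::
  "real \<Rightarrow> (real \<Rightarrow> real) \<Rightarrow> (real \<Rightarrow> real) \<Rightarrow> (real \<times> real) set" where
  "Fucik_spectrum l m n = {(\<alpha>, \<beta>). \<exists>u. eigenfunction l m n \<alpha> \<beta> u}"

definition is_eigenvalue :: "real \<Rightarrow> (real \<Rightarrow> real) \<Rightarrow> real \<Rightarrow> bool" where
  "is_eigenvalue l r \<mu> \<longleftrightarrow> (\<exists>u \<in> H10 l. (\<exists>x \<in> {0..l}. u x \<noteq> 0) \<and>
     (\<forall>v \<in> H10 l. (\<integral>x. weak_deriv l u x * weak_deriv l v x \<partial>(Om l)) =
        (\<integral>x. \<mu> * r x * u x * v x \<partial>(Om l))))"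

definition first_eigenvalue :: "real \<Rightarrow> (real \<Rightarrow> real) \<Rightarrow> real" where
  "first_eigenvalue l r = (LEAST \<mu>. is_eigenvalue l r \<mu>)"

definition exactly_zeros :: "real \<Rightarrow> nat \<Rightarrow> (real \<Rightarrow> real) \<Rightarrow> bool" where
  "exactly_zeros l k u \<longleftrightarrow>
     finite {x \<in> {0<..<l}. u x = 0} \<and> card {x \<in> {0<..<l}. u x = 0} = k"

definition C_plus ::
  "real \<Rightarrow> nat \<Rightarrow> (real \<Rightarrow> real) \<Rightarrow> (real \<Rightarrow> real) \<Rightarrow> (real \<times> real) set" where
  "C_plus l k m n =
     (if k = 0 then {first_eigenvalue l m} \<times> UNIV
      else {(\<alpha>, \<beta>). \<exists>u d. eigenfunction l m n \<alpha> \<beta> u \<and> exactly_zeros l k u \<and>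
              (u has_real_derivative d) (at 0 within {0..l}) \<and> d > 0})"

definition C_minus ::
  "real \<Rightarrow> nat \<Rightarrow> (real \<Rightarrow> real) \<Rightarrow> (real \<Rightarrow> real) \<Rightarrow> (real \<times> real) set" where
  "C_minus l k m n =
     (if k = 0 then UNIV \<times> {first_eigenvalue l n}
      else {(\<alpha>, \<beta>). \<exists>u d. eigenfunction l m n \<alpha> \<beta> u \<and> exactly_zeros l k u \<and>
              (u has_real_derivative d) (at 0 within {0..l}) \<and> d < 0})"

definition C_curve ::
  "real \<Rightarrow> nat \<Rightarrow> (real \<Rightarrow> real) \<Rightarrow> (real \<Rightarrow> real) \<Rightarrow> (real \<times> real) set" where
  "C_curve l k m n = C_plus l k m n \<union> C_minus l k m n"

definition K_cone :: "real \<Rightarrow> (real \<times> real) set" where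
  "K_cone t = {(\<alpha>, \<beta>). \<alpha> > 0 \<and> \<beta> > 0 \<and> t * \<alpha> \<le> \<beta> \<and> \<beta> \<le> inverse t * \<alpha>}"

text \<open>Accumulation points of a family \<open>p \<epsilon>\<close>, \<open>\<epsilon> > 0\<close>, as \<open>\<epsilon> \<rightarrow> 0\<close>.\<close>

definition accumulation_point :: "(real \<Rightarrow> 'a::metric_space) \<Rightarrow> 'a \<Rightarrow> bool" where
  "accumulation_point p z \<longleftrightarrow> (\<forall>e>0. \<exists>\<^sub>F \<epsilon> in at_right 0. dist (p \<epsilon>) z < e)"

end

theory Submission
  imports Defs "HOL-Complex_Analysis.Great_Picard"
begin

text \<open>A weak solution is the same thing as a pair \<open>(u, w)\<close> with \<open>u' = w\<close>, where \<open>w\<close> is an indefinite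
  integral of \<open>- (\<alpha> m u\<^sup>+ - \<beta> n u\<^sup>-)\<close>. Scaled to \<open>max \<bar>w\<bar> = 1\<close>, such pairs are equicontinuous as long as
  \<open>(\<alpha>, \<beta>)\<close> stays bounded, so by Arzela-Ascoli they subconverge in \<open>C\<^sup>1\<close>, and weak* convergence of the
  weights suffices to pass to the limit in the integral equation. The limit is nontrivial, hence has only
  simple zeros, so the number of zeros and the sign of \<open>u'(0)\<close> survive in the limit. On an interval
  without zeros, testing against a sine bounds \<open>\<alpha>\<close> or \<open>\<beta>\<close> from above, and the cone controls the other one;
  \<open>(0, 0)\<close> is excluded in the limit because it admits no nontrivial solution. For \<open>k = 0\<close> the same
  argument applies to positive eigenfunctions: they exist by shooting, and by Sturm comparison their
  eigenvalue is the least one.\<close>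

section \<open>Primitives of integrable functions\<close>

text \<open>Two definitions shape the development. \<open>H10\<close> is a closure and
  \<open>weak_deriv\<close> an arbitrary choice, so nothing can be computed before weak solutions
  are translated, in both directions, into integral equations; density of test functions, the
  fundamental lemma and the lemma of du Bois-Reymond, all resting on explicit cutoffs, serve this
  purpose. And \<open>first_eigenvalue\<close> is a \<open>LEAST\<close>, which says something only
  once an eigenvalue with a positive eigenfunction is exhibited; after that, \<open>k = 0\<close> is
  the case without interior zeros of a linear problem and shares its closedness proof with
  \<open>k \<ge> 1\<close>.

  The slope rather than u is normalized because \<bar>w\<bar> \<le> 1 bounds u by l, hence w'
  uniformly, while a value of modulus 1 cannot be lost in a uniform limit. Double zeros are excluded
  by the linear bound \<bar>w'\<bar> \<le> C \<bar>u\<bar> alone. Only \<open>C_plus\<close> is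
  studied: replacing u by -u swaps m with n and \<alpha> with \<beta> and turns
  \<open>C_minus\<close> into \<open>C_plus\<close>.\<close>

lemmas HK_integral_add = Henstock_Kurzweil_Integration.integral_add
  and HK_integral_diff = Henstock_Kurzweil_Integration.integral_diff
  and HK_integral_nonneg = Henstock_Kurzweil_Integration.integral_nonneg
  and HK_integral_cong = Henstock_Kurzweil_Integration.integral_cong
  and HK_integral_combine = Henstock_Kurzweil_Integration.integral_combine
  and HK_integral_eq_0_iff = Equivalence_Lebesgue_Henstock_Integration.integral_eq_0_iff

text \<open>In effect F is absolutely continuous on [0, l] and f is a chosen version of its
  derivative. The integral form avoids differentiability almost everywhere, and absolute
  integrability makes gauge and Lebesgue integrals of f agree.\<close>

definition primitive_on :: "real \<Rightarrow> (real \<Rightarrow> real) \<Rightarrow> (real \<Rightarrow> real) \<Rightarrow> bool" where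
  "primitive_on l F f \<longleftrightarrow> f absolutely_integrable_on {0..l} \<and>
     (\<forall>x\<in>{0..l}. integral {0..x} f = F x - F 0)"

lemma primitive_onI:
  assumes "f absolutely_integrable_on {0..l}" "\<And>x. x \<in> {0..l} \<Longrightarrow> F x = F 0 + integral {0..x} f"
  shows "primitive_on l F f"
  unfolding primitive_on_def
proof (intro conjI ballI assms(1))
  fix x assume "x \<in> {0..l}"
  from assms(2)[OF this] show "integral {0..x} f = F x - F 0" by linarith
qed

lemma abs_int_imp_int:
  fixes f :: "'a::euclidean_space \<Rightarrow> 'b::euclidean_space"
  shows "f absolutely_integrable_on S \<Longrightarrow> f integrable_on S"
  by (simp add: absolutely_integrable_on_def)

lemma abs_int_sub:
  fixes f :: "real \<Rightarrow> real"
  assumes "f absolutely_integrable_on {0..l}" "0 \<le> x" "y \<le> l"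
  shows "f absolutely_integrable_on {x..y}"
  using absolutely_integrable_on_subinterval[OF assms(1)] assms by auto

lemma int_sub:
  fixes f :: "real \<Rightarrow> real"
  assumes "f absolutely_integrable_on {0..l}" "0 \<le> x" "y \<le> l"
  shows "f integrable_on {x..y}"
  using abs_int_imp_int[OF abs_int_sub[OF assms]] .

lemma bounded_image_Icc:
  fixes f :: "real \<Rightarrow> real"
  shows "continuous_on {a..b} f \<Longrightarrow> bounded (f ` {a..b})"
  using compact_continuous_image compact_imp_bounded by blast

lemma continuous_bounded_on_Icc:
  fixes f :: "real \<Rightarrow> real"
  assumes "continuous_on {a..b} f"
  obtains M where "M \<ge> 0" "\<And>x. x \<in> {a..b} \<Longrightarrow> \<bar>f x\<bar> \<le> M"
proof -
  obtain M where "\<forall>x\<in>{a..b}. \<bar>f x\<bar> \<le> M" using bounded_image_Icc[OF assms] by (auto simp: bounded_iff)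
  then show ?thesis using that[of "max 0 M"] by force
qed

lemma deriv_within_Icc_unique:
  fixes x :: real
  assumes "l > 0" "x \<in> {0..l}" "(f has_real_derivative c) (at x within {0..l})" "(f has_real_derivative d) (at x within {0..l})"
  shows "c = d"
  using vector_derivative_unique_within_closed_interval[of 0 l x] assms
  by (metis box_real(2) has_real_derivative_iff_has_vector_derivative)

lemma abs_int_mult_cont:
  fixes f :: "real \<Rightarrow> real"
  assumes "f absolutely_integrable_on {a..b}" "continuous_on {a..b} F"
  shows "(\<lambda>x. F x * f x) absolutely_integrable_on {a..b}"
proof (rule absolutely_integrable_bounded_measurable_product_real)
  show "F \<in> borel_measurable (lebesgue_on {a..b})"
    by (simp add: assms(2) continuous_imp_measurable_on_sets_lebesgue)
qed (use assms bounded_image_Icc in auto)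

lemma primitive_abs_int: "primitive_on l F f \<Longrightarrow> f absolutely_integrable_on {0..l}"
  by (simp add: primitive_on_def)

lemma primitive_diff_eq:
  assumes "primitive_on l F f" "0 \<le> x" "x \<le> y" "y \<le> l"
  shows "F y - F x = integral {x..y} f"
proof -
  have "f integrable_on {0..y}"
    using assms by (auto simp: primitive_on_def intro: int_sub)
  then have "integral {0..x} f + integral {x..y} f = integral {0..y} f"
    using assms by (intro HK_integral_combine) auto
  moreover have "F y = F 0 + integral {0..y} f" "F x = F 0 + integral {0..x} f"
    using assms by (auto simp: primitive_on_def)
  ultimately show ?thesis by simp
qed

lemma primitive_continuous:
  assumes "primitive_on l F f"
  shows "continuous_on {0..l} F"
proof -
  have "continuous_on {0..l} (\<lambda>x. F 0 + integral {0..x} f)"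
    using assms abs_int_imp_int unfolding primitive_on_def
    by (intro continuous_intros indefinite_integral_continuous_1) blast
  then show ?thesis
    by (rule continuous_on_eq) (use assms in \<open>auto simp: primitive_on_def\<close>)
qed

lemma primitive_abs_diff_le:
  assumes "primitive_on l F f" "0 \<le> x" "x \<le> y" "y \<le> l" "\<And>s. s \<in> {x..y} \<Longrightarrow> \<bar>f s\<bar> \<le> M"
  shows "\<bar>F y - F x\<bar> \<le> M * (y - x)"
proof -
  have "norm (integral {x..y} f) \<le> integral {x..y} (\<lambda>_. M)"
    using assms by (intro integral_norm_bound_integral int_sub[where l=l]) (auto simp: primitive_on_def)
  then show ?thesis
    using primitive_diff_eq[OF assms(1-4)] assms by (simp add: mult.commute)
qed

lemma primitive_lipschitz:
  assumes "primitive_on l F f" "x \<in> {0..l}" "y \<in> {0..l}"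
    "\<And>s. s \<in> {0..l} \<Longrightarrow> min x y \<le> s \<Longrightarrow> s \<le> max x y \<Longrightarrow> \<bar>f s\<bar> \<le> M"
  shows "\<bar>F y - F x\<bar> \<le> M * \<bar>y - x\<bar>"
proof (cases "x \<le> y")
  case True
  then show ?thesis using primitive_abs_diff_le[OF assms(1), of x y M] assms(2-4) by auto
next
  case False
  then show ?thesis using primitive_abs_diff_le[OF assms(1), of y x M] assms(2-4)
    by (auto simp: abs_minus_commute)
qed

lemma primitive_add:
  assumes "primitive_on l F f" "primitive_on l G g"
  shows "primitive_on l (\<lambda>x. F x + G x) (\<lambda>x. f x + g x)"
proof (rule primitive_onI)
  show "(\<lambda>x. f x + g x) absolutely_integrable_on {0..l}"
    using assms by (simp add: primitive_on_def)
  fix x assume x: "x \<in> {0..l}"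
  have "f integrable_on {0..x}" "g integrable_on {0..x}"
    using assms x by (auto simp: primitive_on_def intro: int_sub)
  then show "F x + G x = F 0 + G 0 + integral {0..x} (\<lambda>x. f x + g x)"
    using assms x by (simp add: primitive_on_def HK_integral_add)
qed

lemma primitive_cmult:
  assumes "primitive_on l F f"
  shows "primitive_on l (\<lambda>x. c * F x) (\<lambda>x. c * f x)"
  using assms by (auto simp: primitive_on_def right_diff_distrib)

lemma primitive_diff:
  assumes "primitive_on l F f" "primitive_on l G g"
  shows "primitive_on l (\<lambda>x. F x - G x) (\<lambda>x. f x - g x)"
  using primitive_add[OF assms(1) primitive_cmult[OF assms(2), of "-1"]] by simp

lemma primitive_cong:
  assumes "primitive_on l F f" "\<And>x. x \<in> {0..l} \<Longrightarrow> F x = G x" "\<And>x. x \<in> {0..l} \<Longrightarrow> f x = g x"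
  shows "primitive_on l G g"
proof (cases "0 \<le> l")
  case True
  have "g absolutely_integrable_on {0..l}"
    using assms by (auto simp: primitive_on_def elim!: set_integrable_cong[THEN iffD1, rotated -1])
  moreover have "integral {0..x} f = integral {0..x} g" if "x \<in> {0..l}" for x
    using that assms by (intro HK_integral_cong) auto
  ultimately show ?thesis
    using assms True unfolding primitive_on_def by (metis atLeastAtMost_iff order_refl)
qed (simp add: primitive_on_def)

lemma primitive_C1:
  assumes "\<And>x. x \<in> {0..l} \<Longrightarrow> (F has_real_derivative f x) (at x within {0..l})" "continuous_on {0..l} f"
  shows "primitive_on l F f"
proof (rule primitive_onI)
  show "f absolutely_integrable_on {0..l}"
    using assms(2) by (rule absolutely_integrable_continuous_real)
  fix x assume x: "x \<in> {0..l}"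
  have "(f has_integral (F x - F 0)) {0..x}"
  proof (rule fundamental_theorem_of_calculus)
    fix y assume "y \<in> {0..x}"
    then have "(F has_real_derivative f y) (at y within {0..x})"
      using x assms(1)[of y] by (auto intro: DERIV_subset)
    then show "(F has_vector_derivative f y) (at y within {0..x})"
      by (simp add: has_real_derivative_iff_has_vector_derivative)
  qed (use x in auto)
  then show "F x = F 0 + integral {0..x} f" by (simp add: integral_unique)
qed

lemma primitive_deriv:
  assumes "primitive_on l F f" "continuous_on {0..l} f" "x \<in> {0..l}"
  shows "(F has_real_derivative f x) (at x within {0..l})"
proof -
  have "((\<lambda>x. integral {0..x} f) has_real_derivative f x) (at x within {0..l})"
    using integral_has_real_derivative assms by blast
  then have "((\<lambda>x. F 0 + integral {0..x} f) has_real_derivative f x) (at x within {0..l})"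
    by (auto intro!: derivative_eq_intros)
  then show ?thesis
    by (rule has_field_derivative_transform_within[where d=1]) (use assms in \<open>auto simp: primitive_on_def\<close>)
qed

text \<open>The defect \<open>F G - \<integral> (F g + f G)\<close> has increments of size \<open>o(\<bar>y - x\<bar>)\<close>, hence is constant;
  no Fubini argument is needed because one of the two derivatives is bounded.\<close>

lemma primitive_mult:
  assumes F: "primitive_on l F f" and G: "primitive_on l G g"
    and M: "\<And>s. s \<in> {0..l} \<Longrightarrow> \<bar>f s\<bar> \<le> M"
  shows "primitive_on l (\<lambda>x. F x * G x) (\<lambda>x. F x * g x + f x * G x)"
proof -
  define k where "k = (\<lambda>x. F x * g x + f x * G x)"
  have fi: "f absolutely_integrable_on {0..l}" and gi: "g absolutely_integrable_on {0..l}"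
    using F G by (auto simp: primitive_on_def)
  have cF: "continuous_on {0..l} F" and cG: "continuous_on {0..l} G"
    using F G primitive_continuous by auto
  have "(\<lambda>x. F x * g x) absolutely_integrable_on {0..l}" "(\<lambda>x. f x * G x) absolutely_integrable_on {0..l}"
    using abs_int_mult_cont[OF gi cF] abs_int_mult_cont[OF fi cG] by (auto simp: mult.commute)
  then have ki: "k absolutely_integrable_on {0..l}"
    unfolding k_def by (rule set_integral_add)
  \<comment> \<open>N dominates the increments of G and is continuous, so the bound on the
    increments of P below is o(\<bar>y - x\<bar>).\<close>
  define N where "N = (\<lambda>x. integral {0..x} (\<lambda>s. \<bar>g s\<bar>))"
  have agi: "(\<lambda>s. \<bar>g s\<bar>) absolutely_integrable_on {0..l}"
    using gi absolutely_integrable_abs by (simp add: set_integrable_abs)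
  have N: "primitive_on l N (\<lambda>s. \<bar>g s\<bar>)"
    unfolding primitive_on_def N_def using agi by auto
  define P where "P = (\<lambda>x. F x * G x - integral {0..x} k)"
  have P: "\<bar>P y - P x\<bar> \<le> 2 * M * \<bar>N y - N x\<bar> * \<bar>y - x\<bar>" if xy: "0 \<le> x" "x \<le> y" "y \<le> l" for x y
  proof -
    have M0: "0 \<le> M" using M[of x] xy by auto
    have gI: "g integrable_on {x..y}" and fI: "f integrable_on {x..y}" and kI: "k integrable_on {x..y}"
      and agI: "(\<lambda>s. \<bar>g s\<bar>) integrable_on {x..y}"
      using int_sub[OF gi] int_sub[OF fi] int_sub[OF ki] int_sub[OF agi] xy by auto
    have Nd: "N y - N x = integral {x..y} (\<lambda>s. \<bar>g s\<bar>)"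
      using primitive_diff_eq[OF N] xy by auto
    have Nd0: "N y - N x \<ge> 0"
      unfolding Nd by (rule HK_integral_nonneg) (use agI in auto)
    have "integral {0..x} k + integral {x..y} k = integral {0..y} k"
      using xy int_sub[OF ki] by (intro HK_integral_combine) auto
    \<comment> \<open>The increment of the product is split with F frozen at y and G frozen at
      x.\<close>
    then have "P y - P x = F y * (G y - G x) + (F y - F x) * G x - integral {x..y} k"
      by (simp add: P_def algebra_simps)
    also have "\<dots> = integral {x..y} (\<lambda>s. F y * g s + f s * G x - k s)"
    proof -
      have "((\<lambda>s. F y * g s + f s * G x - k s) has_integral
          F y * integral {x..y} g + integral {x..y} f * G x - integral {x..y} k) {x..y}"
        using gI fI kI by (intro has_integral_diff has_integral_add has_integral_mult_right
            has_integral_mult_left integrable_integral)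
      then show ?thesis
        using primitive_diff_eq[OF F xy] primitive_diff_eq[OF G xy] by (simp add: integral_unique)
    qed
    finally have Pd: "P y - P x = integral {x..y} (\<lambda>s. F y * g s + f s * G x - k s)" .
    have "norm (integral {x..y} (\<lambda>s. F y * g s + f s * G x - k s))
        \<le> integral {x..y} (\<lambda>s. M * (y - x) * \<bar>g s\<bar> + M * (N y - N x))"
    proof (rule integral_norm_bound_integral)
      show "(\<lambda>s. F y * g s + f s * G x - k s) integrable_on {x..y}"
        using gI fI kI by (intro integrable_add integrable_diff integrable_on_mult_right integrable_on_mult_left)
      show "(\<lambda>s. M * (y - x) * \<bar>g s\<bar> + M * (N y - N x)) integrable_on {x..y}"
        using agI by (intro integrable_add integrable_on_mult_right integrable_const_ivl)
      fix s assume s: "s \<in> {x..y}"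
      have 1: "\<bar>F y - F s\<bar> \<le> M * (y - x)"
        using primitive_abs_diff_le[OF F, of s y M] M s xy M0 
        by (smt (verit, ccfv_SIG) atLeastAtMost_iff mult_left_mono)
      have "\<bar>G s - G x\<bar> \<le> integral {x..s} (\<lambda>s. \<bar>g s\<bar>)"
      proof -
        have "norm (integral {x..s} g) \<le> integral {x..s} (\<lambda>s. \<bar>g s\<bar>)"
          using gi agi s xy by (intro integral_norm_bound_integral int_sub[where l=l]) auto
        then show ?thesis using primitive_diff_eq[OF G, of x s] s xy by auto
      qed
      also have "\<dots> = N s - N x"
        using primitive_diff_eq[OF N, of x s] s xy by auto
      also have "\<dots> \<le> N y - N x"
        using primitive_diff_eq[OF N, of s y] s xy
          HK_integral_nonneg[OF int_sub[OF agi, of s y]] by auto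
      finally have 2: "\<bar>G x - G s\<bar> \<le> N y - N x" by simp
      \<comment> \<open>Both terms pair an integrable factor with a small increment: that of F is at
        most M (y - x), that of G at most N y - N x.\<close>
      have "F y * g s + f s * G x - k s = (F y - F s) * g s + f s * (G x - G s)"
        by (simp add: k_def algebra_simps)
      also have "\<bar>\<dots>\<bar> \<le> \<bar>F y - F s\<bar> * \<bar>g s\<bar> + \<bar>f s\<bar> * \<bar>G x - G s\<bar>"
        by (metis abs_mult abs_triangle_ineq)
      also have "\<dots> \<le> M * (y - x) * \<bar>g s\<bar> + M * (N y - N x)"
        using 1 2 M[of s] s xy M0 by (intro add_mono mult_mono) auto
      finally show "norm (F y * g s + f s * G x - k s) \<le> M * (y - x) * \<bar>g s\<bar> + M * (N y - N x)" by simp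
    qed
    also have "\<dots> = M * (y - x) * (N y - N x) + M * (N y - N x) * (y - x)"
      using agI xy by (subst HK_integral_add)
        (auto simp: Nd intro: integrable_on_mult_right)
    finally show ?thesis using Pd Nd0 xy by (simp add: algebra_simps)
  qed
  have P': "\<bar>P y - P x\<bar> \<le> 2 * M * \<bar>N y - N x\<bar> * \<bar>y - x\<bar>" if "x \<in> {0..l}" "y \<in> {0..l}" for x y
    using P[of x y] P[of y x] that by (cases "x \<le> y") (auto simp: abs_minus_commute)
  have "(P has_real_derivative 0) (at x within {0..l})" if x: "x \<in> {0..l}" for x
    unfolding has_field_derivative_iff
  proof (rule Lim_null_comparison)
    have "continuous_on {0..l} N" using N by (rule primitive_continuous)
    then have "(N \<longlongrightarrow> N x) (at x within {0..l})" using x by (simp add: continuous_on)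
    then have "((\<lambda>y. N y - N x) \<longlongrightarrow> 0) (at x within {0..l})" using LIM_zero by blast
    then have "((\<lambda>y. \<bar>N y - N x\<bar>) \<longlongrightarrow> 0) (at x within {0..l})" using tendsto_rabs_zero by blast
    then show "((\<lambda>y. 2 * M * \<bar>N y - N x\<bar>) \<longlongrightarrow> 0) (at x within {0..l})" 
      by (rule tendsto_mult_right_zero)
    show "\<forall>\<^sub>F y in at x within {0..l}. norm ((P y - P x) / (y - x)) \<le> 2 * M * \<bar>N y - N x\<bar>"
      unfolding eventually_at_filter
      using P'[OF x] by (auto simp: abs_divide pos_divide_le_eq)
  qed
  then obtain c where c: "\<And>x. x \<in> {0..l} \<Longrightarrow> P x = c"
    using has_field_derivative_zero_constant[of "{0..l}" P] by auto
  show ?thesis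
    unfolding k_def[symmetric]
  proof (rule primitive_onI[OF ki])
    fix x assume x: "x \<in> {0..l}"
    have "P x = P 0" using c x by auto
    then show "F x * G x = F 0 * G 0 + integral {0..x} k"
      by (simp add: P_def)
  qed
qed

section \<open>Smooth functions and test functions\<close>

definition smooth :: "(real \<Rightarrow> real) \<Rightarrow> bool" where
  "smooth f \<longleftrightarrow> (\<forall>n x. (deriv ^^ n) f differentiable (at x))"

text \<open>Smoothness is proved below by exhibiting a set of differentiable functions closed under
  \<open>deriv\<close>, so no formula for higher derivatives is ever needed.\<close>

lemma smooth_coinduct:
  assumes "f \<in> S" and S: "\<And>f x. f \<in> S \<Longrightarrow> f differentiable (at x)" "\<And>f. f \<in> S \<Longrightarrow> deriv f \<in> S"
  shows "smooth f"
proof -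
  have "(deriv ^^ n) f \<in> S" for n
    by (induction n) (use assms in auto)
  then show ?thesis using S(1) by (auto simp: smooth_def)
qed

lemma smooth_differentiable: "smooth f \<Longrightarrow> f differentiable (at x)"
  unfolding smooth_def by (metis funpow_0)

lemma smooth_DERIV: "smooth f \<Longrightarrow> (f has_real_derivative deriv f x) (at x)"
  using DERIV_deriv_iff_real_differentiable smooth_differentiable by blast

lemma smooth_deriv: "smooth f \<Longrightarrow> smooth (deriv f)"
  unfolding smooth_def by (metis funpow_simps_right(2) o_apply)

lemma smooth_continuous_on: "smooth f \<Longrightarrow> continuous_on S f"
  by (meson DERIV_continuous_on smooth_DERIV has_field_derivative_at_within)

lemma smooth_antideriv:
  assumes "\<And>x. (F has_real_derivative f x) (at x)" "smooth f"
  shows "smooth F"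
proof -
  have "deriv F = f" using assms(1) DERIV_imp_deriv by blast
  then have "(deriv ^^ n) F differentiable (at x)" for n x
    using assms by (cases n) (auto simp: smooth_def funpow_Suc_right real_differentiable_def simp del: funpow.simps(2))
  then show ?thesis by (simp add: smooth_def)
qed

text \<open>By the Leibniz rule the derivative of a product is a sum of products, so the set used
  for coinduction has to be closed under both operations.\<close>

inductive_set smooth_alg :: "(real \<Rightarrow> real) set" where
  base: "smooth f \<Longrightarrow> f \<in> smooth_alg"
| add: "f \<in> smooth_alg \<Longrightarrow> g \<in> smooth_alg \<Longrightarrow> (\<lambda>x. f x + g x) \<in> smooth_alg"
| mult: "f \<in> smooth_alg \<Longrightarrow> g \<in> smooth_alg \<Longrightarrow> (\<lambda>x. f x * g x) \<in> smooth_alg"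

lemma smooth_alg_deriv:
  assumes "f \<in> smooth_alg"
  shows "\<exists>f'\<in>smooth_alg. \<forall>x. (f has_real_derivative f' x) (at x)"
  using assms
proof induction
  case (base f)
  then show ?case using smooth_DERIV smooth_deriv smooth_alg.base by blast
next
  case (add f g)
  then obtain f' g' where "f' \<in> smooth_alg" "g' \<in> smooth_alg"
    "\<forall>x. (f has_real_derivative f' x) (at x)" "\<forall>x. (g has_real_derivative g' x) (at x)" by blast
  then show ?case
    by (intro bexI[of _ "\<lambda>x. f' x + g' x"]) (auto intro!: derivative_eq_intros smooth_alg.add)
next
  case (mult f g)
  then obtain f' g' where "f' \<in> smooth_alg" "g' \<in> smooth_alg"
    "\<forall>x. (f has_real_derivative f' x) (at x)" "\<forall>x. (g has_real_derivative g' x) (at x)" by blast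
  with mult.hyps show ?case
    by (intro bexI[of _ "\<lambda>x. f' x * g x + g' x * f x"])
       (auto intro!: DERIV_mult smooth_alg.add smooth_alg.mult)
qed

lemma smooth_alg_smooth:
  assumes "f \<in> smooth_alg"
  shows "smooth f"
proof (rule smooth_coinduct[OF assms])
  fix f x assume "f \<in> smooth_alg"
  from smooth_alg_deriv[OF this] obtain f' where f': "f' \<in> smooth_alg" "\<And>x. (f has_real_derivative f' x) (at x)"
    by blast
  then show "f differentiable (at x)" by (auto simp: real_differentiable_def)
  have "deriv f = f'" using f'(2) DERIV_imp_deriv by blast
  then show "deriv f \<in> smooth_alg" using f' by simp
qed

lemma smooth_add: "smooth f \<Longrightarrow> smooth g \<Longrightarrow> smooth (\<lambda>x. f x + g x)"
  by (rule smooth_alg_smooth[OF smooth_alg.add[OF smooth_alg.base smooth_alg.base]])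

lemma smooth_mult: "smooth f \<Longrightarrow> smooth g \<Longrightarrow> smooth (\<lambda>x. f x * g x)"
  by (rule smooth_alg_smooth[OF smooth_alg.mult[OF smooth_alg.base smooth_alg.base]])

lemma smooth_const: "smooth (\<lambda>x. c)"
  by (rule smooth_coinduct[of _ "{f. \<exists>c. f = (\<lambda>x. c)}"]) auto

lemma smooth_cmult: "smooth f \<Longrightarrow> smooth (\<lambda>x. c * f x)"
  using smooth_mult smooth_const by blast

lemma smooth_diff: "smooth f \<Longrightarrow> smooth g \<Longrightarrow> smooth (\<lambda>x. f x - g x)"
  using smooth_add[OF _ smooth_cmult, of f g "-1"] by simp

lemma smooth_ident: "smooth (\<lambda>x. x)"
  by (rule smooth_antideriv[OF DERIV_ident smooth_const])

lemma smooth_polynomial_function: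
  assumes "real_polynomial_function p"
  shows "smooth p"
  using assms
proof induction
  case (linear f)
  then obtain c where "f = (\<lambda>x. c * x)"
    by (auto simp: real_bounded_linear mult.commute)
  then show ?case using smooth_cmult[OF smooth_ident] by simp
next
  case (const c)
  show ?case by (rule smooth_const)
next
  case (add f g)
  show ?case by (rule smooth_add[OF add.IH])
next
  case (mult f g)
  show ?case by (rule smooth_mult[OF mult.IH])
qed

lemma smooth_affine:
  assumes "smooth f"
  shows "smooth (\<lambda>x. f (c * x + d))"
proof (rule smooth_coinduct)
  \<comment> \<open>The factor k in this set absorbs the powers of c produced by the chain
    rule.\<close>
  show "(\<lambda>x. f (c * x + d)) \<in> {g. \<exists>f k. smooth f \<and> g = (\<lambda>x. k * f (c * x + d))}"
    using assms by (auto intro!: exI[of _ f] exI[of _ 1])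
next
  fix g x assume "g \<in> {g. \<exists>f k. smooth f \<and> g = (\<lambda>x. k * f (c * x + d))}"
  then obtain f k where f: "smooth f" and g: "g = (\<lambda>x. k * f (c * x + d))" by auto
  have *: "(g has_real_derivative (k * c) * deriv f (c * x + d)) (at x)" for x
    unfolding g
    by (rule derivative_eq_intros DERIV_chain2[where f=f, OF smooth_DERIV[OF f]] refl | simp)+
  then show "g differentiable (at x)" by (auto simp: real_differentiable_def)
  have "deriv g = (\<lambda>x. (k * c) * deriv f (c * x + d))" using * DERIV_imp_deriv by blast
  then show "deriv g \<in> {g. \<exists>f k. smooth f \<and> g = (\<lambda>x. k * f (c * x + d))}"
    using smooth_deriv[OF f] by blast
qed

lemma smooth_exp_compose:
  assumes "smooth g"
  shows "smooth (\<lambda>x. exp (g x))"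
proof (rule smooth_coinduct)
  show "(\<lambda>x. exp (g x)) \<in> {h. \<exists>f. smooth f \<and> h = (\<lambda>x. f x * exp (g x))}"
    using smooth_const[of 1] by (auto intro!: exI[of _ "\<lambda>x. 1"])
next
  fix h x assume "h \<in> {h. \<exists>f. smooth f \<and> h = (\<lambda>x. f x * exp (g x))}"
  then obtain f where f: "smooth f" and h: "h = (\<lambda>x. f x * exp (g x))" by auto
  have *: "(h has_real_derivative (deriv f x + f x * deriv g x) * exp (g x)) (at x)" for x
    unfolding h using smooth_DERIV[OF f, of x] smooth_DERIV[OF assms, of x]
    by (auto intro!: derivative_eq_intros simp: algebra_simps)
  then show "h differentiable (at x)" by (auto simp: real_differentiable_def)
  have "deriv h = (\<lambda>x. (deriv f x + f x * deriv g x) * exp (g x))" using * DERIV_imp_deriv by blast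
  then show "deriv h \<in> {h. \<exists>f. smooth f \<and> h = (\<lambda>x. f x * exp (g x))}"
    using smooth_add[OF smooth_deriv[OF f] smooth_mult[OF f smooth_deriv[OF assms]]] by auto
qed

section \<open>The flat exponential, from which all cutoffs are built\<close>

definition flat_exp :: "real \<Rightarrow> real" where
  "flat_exp x = (if x > 0 then exp (- (1 / x)) else 0)"

lemma poly_exp_neg_tendsto_0: "((\<lambda>y::real. poly p y * exp (- y)) \<longlongrightarrow> 0) at_top"
proof -
  have "((\<lambda>y. \<Sum>i\<le>degree p. coeff p i * (y ^ i / exp y)) \<longlongrightarrow> (\<Sum>i\<le>degree p. coeff p i * 0)) at_top"
    by (intro tendsto_intros tendsto_power_div_exp_0)
  then show ?thesis
    by (simp add: poly_altdef exp_minus sum_divide_distrib field_simps)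
qed

lemma smooth_flat_exp: "smooth flat_exp"
proof (rule smooth_coinduct)
  \<comment> \<open>Differentiating replaces the polynomial in 1/x by another one, so this set is
    closed under \<open>deriv\<close>.\<close>
  define S where "S = {f. \<exists>p. f = (\<lambda>x. if x > 0 then poly p (1/x) * exp (- (1 / x)) else (0::real))}"
  show "flat_exp \<in> S"
    unfolding S_def flat_exp_def by (auto intro!: exI[of _ 1] ext)
  fix f x assume "f \<in> S"
  then obtain p where f: "f = (\<lambda>x. if x > 0 then poly p (1/x) * exp (- (1 / x)) else (0::real))"
    by (auto simp: S_def)
  \<comment> \<open>The derivative of p(1/x) exp(-1/x) is (1/x)^2 (p - p')(1/x) exp(-1/x);
    \<open>[:0,0,1:]\<close> is the square of the variable.\<close>
  define q where "q = [:0,0,1:] * (p - pderiv p)"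
  define f' where "f' = (\<lambda>x. if x > 0 then poly q (1/x) * exp (- (1 / x)) else (0::real))"
  have *: "(f has_real_derivative f' x) (at x)" for x
  proof (cases x "0::real" rule: linorder_cases)
    case less
    have "((\<lambda>x. 0) has_real_derivative f' x) (at x)" using less by (simp add: f'_def)
    then show ?thesis
      by (rule has_field_derivative_transform_within_open[of _ _ _ "{..<0}"]) (use less in \<open>auto simp: f\<close>)
  next
    case greater
    have "((\<lambda>x. poly p (1/x) * exp (- (1 / x))) has_real_derivative f' x) (at x)"
      using greater by (auto intro!: derivative_eq_intros poly_DERIV DERIV_chain2[of "poly p"]
         simp: f'_def q_def field_simps power2_eq_square)
    then show ?thesis
      by (rule has_field_derivative_transform_within_open[of _ _ _ "{0<..}"]) (use greater in \<open>auto simp: f\<close>)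
  next
    case equal
    \<comment> \<open>With y = 1/x the difference quotient f x / x becomes y p(y) exp(-y), hence the
      extra factor \<open>[:0,1:]\<close>.\<close>
    have "((\<lambda>y. poly ([:0,1:] * p) y * exp (- y)) \<longlongrightarrow> 0) at_top"
      by (rule poly_exp_neg_tendsto_0)
    then have "((\<lambda>x. poly ([:0,1:] * p) (inverse x) * exp (- inverse x)) \<longlongrightarrow> 0) (at_right 0)"
      by (rule filterlim_compose[OF _ filterlim_inverse_at_top_right])
    then have "((\<lambda>y. (f y - f 0) / (y - 0)) \<longlongrightarrow> 0) (at_right 0)"
      by (rule Lim_transform_eventually)
        (auto simp: eventually_at_filter f field_simps)
    moreover have "((\<lambda>y. (f y - f 0) / (y - 0)) \<longlongrightarrow> 0) (at_left 0)"
      by (rule Lim_transform_eventually[OF tendsto_const]) (auto simp: eventually_at_filter f)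
    ultimately show ?thesis
      unfolding has_field_derivative_iff equal by (simp add: f'_def filterlim_split_at)
  qed
  then show "f differentiable (at x)" by (auto simp: real_differentiable_def)
  have "deriv f = f'" using * DERIV_imp_deriv by blast
  then show "deriv f \<in> S" unfolding S_def f'_def by blast
qed

section \<open>Test functions, their antiderivatives and cutoffs\<close>

lemma test_functions_iff:
  "\<phi> \<in> test_functions l \<longleftrightarrow> smooth \<phi> \<and> (\<exists>c d. 0 < c \<and> d < l \<and> (\<forall>x. x \<notin> {c..d} \<longrightarrow> \<phi> x = 0))"
  by (simp add: test_functions_def smooth_def)

lemma test_smooth: "\<phi> \<in> test_functions l \<Longrightarrow> smooth \<phi>"
  by (simp add: test_functions_iff)

lemma test_bound: "\<phi> \<in> test_functions l \<Longrightarrow> \<phi> 0 = 0 \<and> \<phi> l = 0"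
  by (force simp: test_functions_iff)

lemma test_mult:
  assumes "\<phi> \<in> test_functions l" "smooth f"
  shows "(\<lambda>x. f x * \<phi> x) \<in> test_functions l"
proof -
  from assms(1) obtain c d where "smooth \<phi>" "0 < c" "d < l" "\<forall>x. x \<notin> {c..d} \<longrightarrow> \<phi> x = 0"
    unfolding test_functions_iff by blast
  moreover from this have "smooth (\<lambda>x. f x * \<phi> x)" using smooth_mult assms(2) by blast
  ultimately show ?thesis
    unfolding test_functions_iff by (intro conjI exI[of _ c] exI[of _ d]) auto
qed

lemma test_add:
  assumes "\<phi> \<in> test_functions l" "\<psi> \<in> test_functions l"
  shows "(\<lambda>x. \<phi> x + \<psi> x) \<in> test_functions l"
proof -
  obtain c d c' d' where *: "0 < c" "d < l" "\<forall>x. x \<notin> {c..d} \<longrightarrow> \<phi> x = 0"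
    "0 < c'" "d' < l" "\<forall>x. x \<notin> {c'..d'} \<longrightarrow> \<psi> x = 0"
    using assms unfolding test_functions_iff by auto
  have 1: "0 < min c c'" "max d d' < l" using * by auto
  have 2: "\<phi> x + \<psi> x = 0" if "x \<notin> {min c c'..max d d'}" for x
  proof -
    have "x \<notin> {c..d}" "x \<notin> {c'..d'}" using that by auto
    then show ?thesis using * by simp
  qed
  then show ?thesis
    using smooth_add[OF test_smooth[OF assms(1)] test_smooth[OF assms(2)]]
    unfolding test_functions_iff using 1 2 by blast
qed

text \<open>To the right of the support of q the antiderivative equals the total integral, so
  vanishing mean is what keeps its support compact.\<close>

lemma test_antideriv:
  assumes q: "q \<in> test_functions l" and 0: "integral {0..l} q = 0"
  shows "(\<lambda>x. integral {0..x} q) \<in> test_functions l" "deriv (\<lambda>x. integral {0..x} q) = q"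
proof -
  obtain c d where cd: "0 < c" "d < l" "\<And>x. x \<notin> {c..d} \<Longrightarrow> q x = 0" and qs: "smooth q"
    using q unfolding test_functions_iff by auto
  have int: "q integrable_on {a..b}" for a b
    using integrable_continuous_real smooth_continuous_on[OF qs] by blast
  have left: "integral {0..x} q = 0" if "x < c" for x
    using cd that by (intro integral_unique has_integral_is_0) auto
  have right: "integral {0..x} q = 0" if "x > d" for x
  proof -
    have z: "integral {a..b} q = 0" if "a > d" for a b
      using cd that by (intro integral_unique has_integral_is_0) auto
    consider "x < 0" | "0 \<le> x" "x \<le> l" | "0 \<le> x" "l \<le> x" by linarith
    then show ?thesis
    proof cases
      case 2
      then show ?thesis
        using HK_integral_combine[of 0 x l q] int 0 z[OF that, of l] by simp
    next
      case 3
      show ?thesis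
      proof (cases "0 \<le> l")
        case True
        then show ?thesis
        using HK_integral_combine[of 0 l x q] int 0 z[of l x] 3 cd by simp
      next
        case False
        then show ?thesis using cd that
          by (intro integral_unique has_integral_is_0) auto
      qed
    qed simp
  qed
  have D: "((\<lambda>x. integral {0..x} q) has_real_derivative q x) (at x)" for x
  proof (cases "x < c")
    case True
    have "((\<lambda>x. 0) has_real_derivative q x) (at x)" using cd True by simp
    then show ?thesis
      by (rule has_field_derivative_transform_within_open[of _ _ _ "{..<c}"]) (use True left in auto)
  next
    case False
    have "((\<lambda>x. integral {0..x} q) has_real_derivative q x) (at x within {0..x+1})"
      using integral_has_real_derivative[OF smooth_continuous_on[OF qs]] False cd by simp
    moreover have "x \<in> interior {0..x+1}" using False cd by simp
    ultimately show ?thesis by (metis at_within_interior)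
  qed
  then show "deriv (\<lambda>x. integral {0..x} q) = q" using DERIV_imp_deriv by blast
  show "(\<lambda>x. integral {0..x} q) \<in> test_functions l"
    unfolding test_functions_iff using smooth_antideriv[OF D qs] cd left right by (metis atLeastAtMost_iff not_le)
qed

lemma flat_exp_mono: "x \<le> y \<Longrightarrow> flat_exp x \<le> flat_exp y"
  by (auto simp: flat_exp_def frac_le)

text \<open>Take \<psi> j positive exactly on the interval shrunk by the margin r j, and \<theta> j
  = 1 - exp (- j \<psi> j). At an interior point \<psi> j eventually stays above a positive number,
  so the factor j drives \<theta> j to 1; no plateau function has to be constructed. The margin
  keeps the support inside (0, l) even if c = 0 or d = l.\<close>

lemma bump_sequence:
  assumes "0 \<le> c" "d \<le> l"
  obtains \<theta> :: "nat \<Rightarrow> real \<Rightarrow> real" where "\<And>j. \<theta> j \<in> test_functions l" "\<And>j x. 0 \<le> \<theta> j x" "\<And>j x. \<theta> j x \<le> 1"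
    "\<And>x. (\<lambda>j. \<theta> j x) \<longlonglongrightarrow> indicator {c<..<d} x"
proof
  define r where "r = (\<lambda>j. inverse (real (Suc j)))"
  define \<psi> where "\<psi> = (\<lambda>j x. flat_exp (x - (c + r j)) * flat_exp (d - r j - x))"
  have r0: "r j > 0" for j by (simp add: r_def)
  have \<psi>pos: "\<psi> j x \<ge> 0" and \<psi>0: "x \<notin> {c + r j..d - r j} \<Longrightarrow> \<psi> j x = 0" for j x
    by (auto simp: \<psi>_def flat_exp_def)
  have \<psi>s: "smooth (\<psi> j)" for j
    unfolding \<psi>_def using smooth_affine[OF smooth_flat_exp, of 1 "-(c + r j)"] smooth_affine[OF smooth_flat_exp, of "-1" "d - r j"]
    by (intro smooth_mult) (auto simp: algebra_simps)
  define \<theta> where "\<theta> = (\<lambda>(j::nat) x. 1 - exp (- real j * \<psi> j x))"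
  have "smooth (\<theta> j)" for j
    unfolding \<theta>_def by (rule smooth_diff[OF smooth_const smooth_exp_compose[OF smooth_cmult[OF \<psi>s]]])
  then show "\<theta> j \<in> test_functions l" for j
    unfolding test_functions_iff using \<psi>0[of _ j] assms r0[of j]
    by (intro conjI exI[of _ "c + r j"] exI[of _ "d - r j"]) (auto simp: \<theta>_def)
  show \<theta>01: "0 \<le> \<theta> j x" "\<theta> j x \<le> 1" for j x
    using \<psi>pos[of j x] by (auto simp: \<theta>_def)
  show "(\<lambda>j. \<theta> j x) \<longlonglongrightarrow> indicator {c<..<d} x" for x
  proof (cases "x \<in> {c<..<d}")
    case True
    obtain J where J: "r J < min (x - c) (d - x)"
      unfolding r_def using reals_Archimedean[of "min (x - c) (d - x)"] True by auto
    have rle: "r j \<le> r J" if "j \<ge> J" for j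
      using that by (simp add: r_def le_imp_inverse_le)
    \<comment> \<open>Shrinking the margin increases both factors, so from J on the exponent is at
      least j times the fixed positive number \<psi> J x.\<close>
    have le: "\<psi> J x \<le> \<psi> j x" if "j \<ge> J" for j
      unfolding \<psi>_def using rle[OF that] by (intro mult_mono flat_exp_mono) (auto simp: flat_exp_def)
    have "exp (- \<psi> J x) < 1" using J by (simp add: \<psi>_def flat_exp_def)
    then have *: "(\<lambda>j. 1 - exp (- \<psi> J x) ^ j) \<longlonglongrightarrow> 1 - 0"
      by (intro tendsto_intros LIMSEQ_realpow_zero) auto
    have "(\<lambda>j. \<theta> j x) \<longlonglongrightarrow> 1 - 0"
    proof (rule tendsto_sandwich[OF _ _ *, of _ "\<lambda>j. 1"])
      have "1 - exp (- \<psi> J x) ^ j \<le> \<theta> j x" if "j \<ge> J" for j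
        using mult_left_mono[OF le[OF that], of "real j"] by (simp add: \<theta>_def exp_of_nat_mult[symmetric])
      then show "\<forall>\<^sub>F j in sequentially. 1 - exp (- \<psi> J x) ^ j \<le> \<theta> j x"
        by (rule eventually_sequentiallyI)
    qed (use \<theta>01 in auto)
    then show ?thesis using True by simp
  next
    case False
    have "\<psi> j x = 0" for j using \<psi>0[of x j] False r0[of j] by force
    then show ?thesis using False by (simp add: \<theta>_def)
  qed
qed

text \<open>Indicators of open intervals are bounded pointwise limits of test functions, so
  dominated convergence carries the vanishing over to intervals; end points do not affect the
  integrals.\<close>

lemma fundamental_lemma_interval:
  fixes G :: "real \<Rightarrow> real"
  assumes G: "G absolutely_integrable_on {0..l}"
    and 0: "\<And>\<phi>. \<phi> \<in> test_functions l \<Longrightarrow> integral {0..l} (\<lambda>x. G x * \<phi> x) = 0"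
    and x: "0 \<le> x" "x \<le> l"
  shows "integral {0..x} G = 0"
proof -
  have *: "integral {c..d} G = 0" if cd: "0 \<le> c" "d \<le> l" for c d
  proof -
    obtain \<theta> where \<theta>: "\<And>j. \<theta> j \<in> test_functions l" "\<And>j x. 0 \<le> \<theta> j x" "\<And>j x. \<theta> j x \<le> 1"
      "\<And>x. (\<lambda>j. \<theta> j x) \<longlonglongrightarrow> indicator {c<..<d} x"
      using bump_sequence[OF cd] by blast
    have "(\<lambda>j. integral {0..l} (\<lambda>x. G x * \<theta> j x)) \<longlonglongrightarrow> integral {0..l} (\<lambda>x. G x * indicator {c<..<d} x)"
    proof (rule dominated_convergence)
      show "(\<lambda>x. G x * \<theta> j x) integrable_on {0..l}" for j
        using abs_int_imp_int[OF abs_int_mult_cont[OF G smooth_continuous_on[OF test_smooth[OF \<theta>(1)]]]]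
        by (simp add: mult.commute)
      show "(\<lambda>x. \<bar>G x\<bar>) integrable_on {0..l}"
        using G by (simp add: absolutely_integrable_on_def)
      show "norm (G x * \<theta> j x) \<le> \<bar>G x\<bar>" for j x
        using \<theta>(2,3)[of j x] by (simp add: abs_mult mult_left_le)
      show "(\<lambda>j. G x * \<theta> j x) \<longlonglongrightarrow> G x * indicator {c<..<d} x" for x
        by (intro tendsto_intros \<theta>)
    qed
    then have "integral {0..l} (\<lambda>x. G x * indicator {c<..<d} x) = 0"
      using 0[OF \<theta>(1)] by (simp add: LIMSEQ_const_iff)
    moreover have "(\<lambda>x. G x * indicator {c<..<d} x) = (\<lambda>x. if x \<in> {c<..<d} then G x else 0)"
      by (auto simp: indicator_def)
    ultimately have "integral ({c<..<d} \<inter> {0..l}) G = 0"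
      using Henstock_Kurzweil_Integration.integral_restrict_Int by metis
    moreover have "{c<..<d} \<inter> {0..l} = {c<..<d}" using cd by auto
    ultimately show ?thesis using integral_open_interval_real by metis
  qed
  show ?thesis using *[of 0 x] x by simp
qed

text \<open>Lebesgue differentiation: at almost every x, g x is the limit of averages over intervals
  starting at x, and these all vanish.\<close>

lemma AE_zero_of_integrals_zero:
  fixes g :: "real \<Rightarrow> real"
  assumes g: "g absolutely_integrable_on {0..l}" and 0: "\<And>x. x \<in> {0..l} \<Longrightarrow> integral {0..x} g = 0"
  shows "AE x in Om l. g x = 0"
proof -
  define f where "f = (\<lambda>x. if x \<in> {0..l} then g x else 0)"
  have F: "primitive_on l (\<lambda>_. 0) g" using g 0 by (intro primitive_onI) auto
  have "f integrable_on UNIV"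
    unfolding f_def using abs_int_imp_int[OF g] integrable_restrict_UNIV by blast
  then have fi: "f integrable_on cbox a b" for a b
    using integrable_on_subcbox by blast
  then obtain N where N: "negligible N"
       "\<And>x e. \<lbrakk>x \<notin> N; 0 < e\<rbrakk> \<Longrightarrow> \<exists>d>0. \<forall>h. 0 < h \<and> h < d \<longrightarrow>
           norm(integral (cbox x (x + h *\<^sub>R One)) f /\<^sub>R h ^ DIM(real) - f x) < e"
    using integrable_ccontinuous_explicit[of f] by blast
  \<comment> \<open>The end point l is discarded together with N, since an interval
    \<open>{x..x+h}\<close> inside [0, l] needs x < l.\<close>
  have "g x = 0" if x: "x \<in> {0..l}" "x \<notin> insert l N" for x
  proof (rule ccontr)
    assume "g x \<noteq> 0"
    then have "\<bar>f x\<bar> > 0" using x by (simp add: f_def)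
    then obtain d where d: "d > 0" "\<And>h. 0 < h \<Longrightarrow> h < d \<Longrightarrow>
           norm(integral (cbox x (x + h *\<^sub>R One)) f /\<^sub>R h ^ DIM(real) - f x) < \<bar>f x\<bar>"
      using N(2)[of x "\<bar>f x\<bar>"] x by blast
    define h where "h = min (d/2) (l - x)"
    have h: "0 < h" "h < d" "x + h \<le> l" using d x by (auto simp: h_def)
    have "integral {x..x+h} f = integral {x..x+h} g"
      using x h by (intro HK_integral_cong) (auto simp: f_def)
    also have "\<dots> = 0" using primitive_diff_eq[OF F, of x "x+h"] x h by simp
    finally show False using d(2)[OF h(1,2)] by simp
  qed
  moreover have "insert l N \<in> null_sets lebesgue"
    using N(1) by (simp add: negligible_iff_null_sets[symmetric])
  ultimately have "AE x in lebesgue. x \<in> {0..l} \<longrightarrow> g x = 0"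
    by (intro AE_I'[of "insert l N"]) auto
  then show ?thesis by (simp add: AE_restrict_space_iff)
qed

section \<open>The space H10 on an interval\<close>

lemma Om_integrable_iff: "integrable (Om l) f \<longleftrightarrow> (f::real \<Rightarrow> real) absolutely_integrable_on {0..l}"
  by (simp add: integrable_restrict_space set_integrable_def)

lemma Om_integral:
  "(f::real \<Rightarrow> real) absolutely_integrable_on {0..l} \<Longrightarrow> (\<integral>x. f x \<partial>(Om l)) = integral {0..l} f"
  by (simp add: lebesgue_integral_eq_integral Om_integrable_iff)

lemma continuous_Om_measurable: "continuous_on {0..l} f \<Longrightarrow> f \<in> borel_measurable (Om l)"
  by (simp add: continuous_imp_measurable_on_sets_lebesgue)

lemma bounded_measurable_abs_int:
  fixes f :: "real \<Rightarrow> real"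
  assumes "f \<in> borel_measurable (Om l)" "\<And>x. x \<in> {0..l} \<Longrightarrow> \<bar>f x\<bar> \<le> C"
  shows "f absolutely_integrable_on {0..l}"
  by (rule measurable_bounded_by_integrable_imp_absolutely_integrable[where g="\<lambda>_. C"]) (use assms in auto)

lemma L2_measurable: "f \<in> L2 l \<Longrightarrow> f \<in> borel_measurable (Om l)"
  by (simp add: L2_def)

lemma L2_square_abs_int: "f \<in> L2 l \<Longrightarrow> (\<lambda>x. (f x)\<^sup>2) absolutely_integrable_on {0..l}"
  by (simp add: L2_def Om_integrable_iff)

lemma L2_mult_abs_int:
  assumes "f \<in> L2 l" "g \<in> L2 l"
  shows "(\<lambda>x. f x * g x) absolutely_integrable_on {0..l}"
proof (rule measurable_bounded_by_integrable_imp_absolutely_integrable)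
  show "(\<lambda>x. f x * g x) \<in> borel_measurable (Om l)"
    using assms by (intro borel_measurable_times L2_measurable)
  show "(\<lambda>x. (f x)\<^sup>2 + (g x)\<^sup>2) integrable_on {0..l}"
    using assms L2_square_abs_int abs_int_imp_int by (intro integrable_add) blast+
  show "norm (f x * g x) \<le> (f x)\<^sup>2 + (g x)\<^sup>2" for x
  proof -
    have "2 * \<bar>f x\<bar> * \<bar>g x\<bar> \<le> (f x)\<^sup>2 + (g x)\<^sup>2"
      using sum_squares_bound[of "\<bar>f x\<bar>" "\<bar>g x\<bar>"] by simp
    moreover have "0 \<le> \<bar>f x\<bar> * \<bar>g x\<bar>" by simp
    ultimately show ?thesis unfolding real_norm_def abs_mult by linarith
  qed
qed auto

lemma L2_bounded:
  assumes "f \<in> borel_measurable (Om l)" "\<And>x. x \<in> {0..l} \<Longrightarrow> \<bar>f x\<bar> \<le> C"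
  shows "f \<in> L2 l"
proof -
  have "(\<lambda>x. (f x)\<^sup>2) absolutely_integrable_on {0..l}"
    by (rule bounded_measurable_abs_int[of _ _ "C\<^sup>2"])
       (use assms power_mono[of "\<bar>f _\<bar>" C 2] in auto)
  then show ?thesis using assms(1) by (simp add: L2_def Om_integrable_iff)
qed

lemma L2_continuous:
  assumes "continuous_on {0..l} f"
  shows "f \<in> L2 l"
  by (rule continuous_bounded_on_Icc[OF assms]) (use L2_bounded continuous_Om_measurable assms in blast)

lemma L2_abs_int: "f \<in> L2 l \<Longrightarrow> f absolutely_integrable_on {0..l}"
  using L2_mult_abs_int[OF _ L2_continuous[of l "\<lambda>_. 1"]] by simp

lemma L2_cmult: "f \<in> L2 l \<Longrightarrow> (\<lambda>x. c * f x) \<in> L2 l"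
  by (auto simp: L2_def power_mult_distrib)

lemma L2_add:
  assumes "f \<in> L2 l" "g \<in> L2 l"
  shows "(\<lambda>x. f x + g x) \<in> L2 l"
proof -
  have "(\<lambda>x. (f x)\<^sup>2 + 2 * (f x * g x) + (g x)\<^sup>2) absolutely_integrable_on {0..l}"
    using L2_mult_abs_int[OF assms] L2_square_abs_int assms by (intro set_integral_add set_integrable_mult_right) auto
  moreover have "(f x + g x)\<^sup>2 = (f x)\<^sup>2 + 2 * (f x * g x) + (g x)\<^sup>2" for x
    by (simp add: power2_sum)
  ultimately have "(\<lambda>x. (f x + g x)\<^sup>2) absolutely_integrable_on {0..l}" by simp
  then show ?thesis using assms by (auto simp: L2_def Om_integrable_iff)
qed

lemma L2_diff: "f \<in> L2 l \<Longrightarrow> g \<in> L2 l \<Longrightarrow> (\<lambda>x. f x - g x) \<in> L2 l"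
  using L2_add[OF _ L2_cmult, of f l g "-1"] by simp

lemma L2_norm_sq: "f \<in> L2 l \<Longrightarrow> (L2_norm l f)\<^sup>2 = integral {0..l} (\<lambda>x. (f x)\<^sup>2)"
  unfolding L2_norm_def Om_integral[OF L2_square_abs_int, symmetric]
  by (rule real_sqrt_pow2) (simp add: Bochner_Integration.integral_nonneg)

text \<open>Weighted AM-GM; with \<open>d\<close> equal to the norm of \<open>f\<close> this is Cauchy-Schwarz up to a constant.\<close>

lemma L1_le_L2:
  assumes f: "f \<in> L2 l" and "d > 0" "l \<ge> 0"
  shows "integral {0..l} (\<lambda>x. \<bar>f x\<bar>) \<le> (l * d + integral {0..l} (\<lambda>x. (f x)\<^sup>2) / d) / 2"
proof -
  have i: "(\<lambda>x. (f x)\<^sup>2) integrable_on {0..l}" using L2_square_abs_int[OF f] abs_int_imp_int by blast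
  have "integral {0..l} (\<lambda>x. \<bar>f x\<bar>) \<le> integral {0..l} (\<lambda>x. d / 2 + (f x)\<^sup>2 * (1 / (2 * d)))"
  proof (rule integral_le)
    show "(\<lambda>x. \<bar>f x\<bar>) integrable_on {0..l}"
      using L2_abs_int[OF f] by (simp add: absolutely_integrable_on_def)
    show "(\<lambda>x. d / 2 + (f x)\<^sup>2 * (1 / (2 * d))) integrable_on {0..l}"
      using i by (intro integrable_add integrable_on_mult_left integrable_const_ivl)
    fix x
    have "2 * d * \<bar>f x\<bar> \<le> d\<^sup>2 + (f x)\<^sup>2" using sum_squares_bound[of d "\<bar>f x\<bar>"] by simp
    then show "\<bar>f x\<bar> \<le> d / 2 + (f x)\<^sup>2 * (1 / (2 * d))"
      using \<open>d > 0\<close> by (simp add: field_simps power2_eq_square)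
  qed
  also have "\<dots> = l * (d / 2) + integral {0..l} (\<lambda>x. (f x)\<^sup>2) * (1 / (2 * d))"
    using i \<open>l \<ge> 0\<close> by (subst HK_integral_add) (auto intro: integrable_on_divide)
  finally show ?thesis using \<open>d > 0\<close> by (simp add: field_simps)
qed

section \<open>Weak derivatives\<close>

lemma test_primitive: "\<phi> \<in> test_functions l \<Longrightarrow> primitive_on l \<phi> (deriv \<phi>)"
  by (meson has_field_derivative_at_within primitive_C1 smooth_DERIV smooth_continuous_on smooth_deriv test_smooth)

lemma L2_smooth: "smooth f \<Longrightarrow> f \<in> L2 l"
  by (simp add: L2_continuous smooth_continuous_on)

text \<open>Integration by parts; the test function comes first in \<open>primitive_mult\<close>
  because that factor must be the one with bounded derivative.\<close>

lemma primitive_weak_deriv: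
  assumes "l > 0" and u: "primitive_on l u g" and g: "g \<in> L2 l"
  shows "has_L2_weak_deriv l u g"
  unfolding has_L2_weak_deriv_def
proof (intro conjI ballI g)
  fix \<phi> assume \<phi>: "\<phi> \<in> test_functions l"
  have s: "smooth \<phi>" "smooth (deriv \<phi>)" using \<phi> test_smooth smooth_deriv by auto
  obtain M where M: "\<And>x. x \<in> {0..l} \<Longrightarrow> \<bar>deriv \<phi> x\<bar> \<le> M" using continuous_bounded_on_Icc[OF smooth_continuous_on[OF s(2)]] by blast
  have uL: "u \<in> L2 l" using primitive_continuous[OF u] by (rule L2_continuous)
  have "primitive_on l (\<lambda>x. \<phi> x * u x) (\<lambda>x. \<phi> x * g x + deriv \<phi> x * u x)"
    by (rule primitive_mult[OF test_primitive[OF \<phi>] u M])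
  then have "integral {0..l} (\<lambda>x. \<phi> x * g x + deriv \<phi> x * u x) = 0"
    using primitive_diff_eq[of l _ _ 0 l] test_bound[OF \<phi>] \<open>l > 0\<close> by fastforce
  then have *: "integral {0..l} (\<lambda>x. g x * \<phi> x + u x * deriv \<phi> x) = 0"
    by (simp only: mult.commute)
  have i: "(\<lambda>x. g x * \<phi> x) absolutely_integrable_on {0..l}" "(\<lambda>x. u x * deriv \<phi> x) absolutely_integrable_on {0..l}"
    using L2_mult_abs_int g uL L2_smooth s by auto
  show "(\<integral>x. u x * deriv \<phi> x \<partial>(Om l)) = - (\<integral>x. g x * \<phi> x \<partial>(Om l))"
    using * HK_integral_add[OF i(1)[THEN abs_int_imp_int] i(2)[THEN abs_int_imp_int]]
    unfolding Om_integral[OF i(1)] Om_integral[OF i(2)] by linarith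
qed

lemma weak_deriv_D:
  assumes "has_L2_weak_deriv l u g" "u \<in> L2 l" "\<phi> \<in> test_functions l"
  shows "integral {0..l} (\<lambda>x. u x * deriv \<phi> x) = - integral {0..l} (\<lambda>x. g x * \<phi> x)"
proof -
  have s: "smooth \<phi>" "smooth (deriv \<phi>)" using assms test_smooth smooth_deriv by auto
  have i: "(\<lambda>x. g x * \<phi> x) absolutely_integrable_on {0..l}" "(\<lambda>x. u x * deriv \<phi> x) absolutely_integrable_on {0..l}"
    using L2_mult_abs_int assms L2_smooth s unfolding has_L2_weak_deriv_def by auto
  show ?thesis
    using assms unfolding has_L2_weak_deriv_def Om_integral[OF i(1), symmetric] Om_integral[OF i(2), symmetric] by blast
qed

text \<open>The difference of two weak derivatives annihilates every test function, hence all its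
  integrals vanish.\<close>

lemma weak_deriv_unique:
  assumes "u \<in> L2 l" "has_L2_weak_deriv l u g" "has_L2_weak_deriv l u h"
  shows "AE x in Om l. g x = h x"
proof -
  have gh: "g \<in> L2 l" "h \<in> L2 l" using assms by (auto simp: has_L2_weak_deriv_def)
  have d: "(\<lambda>x. g x - h x) absolutely_integrable_on {0..l}"
    using L2_abs_int L2_diff gh by blast
  have "integral {0..x} (\<lambda>x. g x - h x) = 0" if "x \<in> {0..l}" for x
  proof (rule fundamental_lemma_interval[OF d])
    fix \<phi> assume \<phi>: "\<phi> \<in> test_functions l"
    have "(\<lambda>x. g x * \<phi> x) integrable_on {0..l}" "(\<lambda>x. h x * \<phi> x) integrable_on {0..l}"
      using L2_mult_abs_int gh L2_smooth[OF test_smooth[OF \<phi>]] abs_int_imp_int by blast+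
    then show "integral {0..l} (\<lambda>x. (g x - h x) * \<phi> x) = 0"
      using weak_deriv_D[OF assms(2,1) \<phi>] weak_deriv_D[OF assms(3,1) \<phi>]
      by (simp add: left_diff_distrib HK_integral_diff)
  qed (use that in auto)
  from AE_zero_of_integrals_zero[OF d this] show ?thesis by simp
qed

text \<open>This makes the choice by \<open>SOME\<close> harmless: the chosen weak derivative may be
  replaced under integrals by an explicit one.\<close>

lemma primitive_weak_deriv_AE:
  assumes "l > 0" "primitive_on l u g" "g \<in> L2 l"
  shows "has_L2_weak_deriv l u (weak_deriv l u)" "AE x in Om l. weak_deriv l u x = g x"
proof -
  have "has_L2_weak_deriv l u g" by (rule primitive_weak_deriv[OF assms])
  then show 1: "has_L2_weak_deriv l u (weak_deriv l u)"
    unfolding weak_deriv_def by (rule someI[of "has_L2_weak_deriv l u"])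
  show "AE x in Om l. weak_deriv l u x = g x"
    using L2_continuous[OF primitive_continuous[OF assms(2)]] 1 primitive_weak_deriv[OF assms]
    by (rule weak_deriv_unique)
qed

text \<open>Subtracting multiples of such a bump makes the mean of another test function vanish, as
  \<open>test_antideriv\<close> requires.\<close>

lemma unit_test_function:
  assumes "l > 0"
  obtains \<psi> where "\<psi> \<in> test_functions l" "integral {0..l} \<psi> = 1"
proof -
  obtain \<theta> where \<theta>: "\<And>j. \<theta> j \<in> test_functions l" "\<And>j x. 0 \<le> \<theta> j x" "\<And>j x. \<theta> j x \<le> 1"
    "\<And>x. (\<lambda>j. \<theta> j x) \<longlonglongrightarrow> indicator {0<..<l} x"
    using bump_sequence[OF order_refl order_refl] by blast
  have "(\<lambda>j. \<theta> j (l/2)) \<longlonglongrightarrow> 1" using \<theta>(4)[of "l/2"] assms by simp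
  then have "\<forall>\<^sub>F j in sequentially. \<theta> j (l/2) > 0" by (rule order_tendstoD) simp
  then obtain j where j: "\<theta> j (l/2) > 0" by (auto dest: eventually_happens)
  have c: "continuous_on {0..l} (\<theta> j)" using \<theta>(1) test_smooth smooth_continuous_on by blast
  have "integral {0..l} (\<theta> j) \<noteq> 0"
  proof
    assume "integral {0..l} (\<theta> j) = 0"
    then have "\<forall>x\<in>{0..l}. \<theta> j x = 0"
      using HK_integral_eq_0_iff[OF c assms] \<theta>(2) by blast
    then show False using j assms by (auto dest: bspec[of _ _ "l/2"])
  qed
  then have "integral {0..l} (\<lambda>x. (1 / integral {0..l} (\<theta> j)) * \<theta> j x) = 1" by simp
  moreover have "(\<lambda>x. (1 / integral {0..l} (\<theta> j)) * \<theta> j x) \<in> test_functions l"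
    using test_mult[OF \<theta>(1) smooth_const] .
  ultimately show ?thesis using that by blast
qed

text \<open>A test function of mean zero is the derivative of a test function. Correcting an
  arbitrary \<phi> by its mean times \<psi> shows that D - \<kappa> annihilates every \<phi>, where
  \<kappa> is the pairing of D with \<psi>. The conclusion is the integrated form of D = \<kappa>
  almost everywhere.\<close>

lemma du_Bois_Reymond:
  assumes "l > 0" and D: "D \<in> L2 l"
    and 0: "\<And>\<phi>. \<phi> \<in> test_functions l \<Longrightarrow> integral {0..l} (\<lambda>x. D x * deriv \<phi> x) = 0"
  obtains \<kappa> where "\<And>x. x \<in> {0..l} \<Longrightarrow> integral {0..x} D = \<kappa> * x"
proof -
  obtain \<psi> where \<psi>: "\<psi> \<in> test_functions l" "integral {0..l} \<psi> = 1"
    using unit_test_function[OF \<open>l > 0\<close>] .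
  define \<kappa> where "\<kappa> = integral {0..l} (\<lambda>x. D x * \<psi> x)"
  have *: "(\<lambda>x. D x - \<kappa>) absolutely_integrable_on {0..l}"
    using D L2_abs_int by (intro set_integral_diff) auto
  have z: "integral {0..x} (\<lambda>x. D x - \<kappa>) = 0" if x: "x \<in> {0..l}" for x
  proof (rule fundamental_lemma_interval[OF *])
    fix \<phi> assume \<phi>: "\<phi> \<in> test_functions l"
    have \<phi>i: "\<phi> integrable_on {0..l}" and \<psi>i: "\<psi> integrable_on {0..l}"
      using \<phi> \<psi> test_smooth smooth_continuous_on integrable_continuous_real by blast+
    have Di: "(\<lambda>x. D x * \<phi> x) integrable_on {0..l}" "(\<lambda>x. D x * \<psi> x) integrable_on {0..l}"
      using L2_mult_abs_int D L2_smooth \<phi> \<psi> test_smooth abs_int_imp_int by blast+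
    define c where "c = integral {0..l} \<phi>"
    define q where "q = (\<lambda>x. \<phi> x + (- c) * \<psi> x)"
    have q: "q \<in> test_functions l"
      unfolding q_def by (rule test_add[OF \<phi> test_mult[OF \<psi>(1) smooth_const]])
    have "integral {0..l} q = 0"
      unfolding q_def using HK_integral_add[OF \<phi>i integrable_on_mult_right[OF \<psi>i, of "- c"]] \<psi>(2)
      by (simp add: c_def)
    from 0[OF test_antideriv(1)[OF q this]] test_antideriv(2)[OF q this]
    have "integral {0..l} (\<lambda>x. D x * q x) = 0" by simp
    moreover have "integral {0..l} (\<lambda>x. D x * q x) = integral {0..l} (\<lambda>x. D x * \<phi> x + (- c) * (D x * \<psi> x))"
      by (simp add: q_def algebra_simps)
    moreover have "\<dots> = integral {0..l} (\<lambda>x. D x * \<phi> x) + (- c) * \<kappa>"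
      using HK_integral_add[OF Di(1) integrable_on_mult_right[OF Di(2), of "- c"]]
      by (simp add: \<kappa>_def)
    ultimately have "integral {0..l} (\<lambda>x. D x * \<phi> x) = c * \<kappa>" by simp
    moreover have "integral {0..l} (\<lambda>x. (D x - \<kappa>) * \<phi> x) = integral {0..l} (\<lambda>x. D x * \<phi> x) - \<kappa> * c"
      using HK_integral_diff[OF Di(1) integrable_on_mult_right[OF \<phi>i, of \<kappa>]]
      by (simp add: left_diff_distrib c_def)
    ultimately show "integral {0..l} (\<lambda>x. (D x - \<kappa>) * \<phi> x) = 0" by simp
  qed (use x in auto)
  show ?thesis
  proof
    fix x assume x: "x \<in> {0..l}"
    have "D integrable_on {0..x}" using x int_sub[OF L2_abs_int[OF D]] by auto
    then have "integral {0..x} (\<lambda>x. D x - \<kappa>) = integral {0..x} D - \<kappa> * x"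
      using x by (subst HK_integral_diff) auto
    then show "integral {0..x} D = \<kappa> * x" using z[OF x] by simp
  qed
qed

text \<open>The difference of u and an indefinite integral G of its weak derivative annihilates all
  derivatives of test functions, hence is constant almost everywhere by du Bois-Reymond, and
  everywhere by continuity.\<close>

lemma H1_continuous_primitive:
  assumes "l > 0" and u: "u \<in> H1 l" and c: "continuous_on {0..l} u"
  shows "weak_deriv l u \<in> L2 l" "primitive_on l u (weak_deriv l u)"
proof -
  define g where "g = weak_deriv l u"
  have g: "has_L2_weak_deriv l u g" unfolding g_def weak_deriv_def
    using u by (intro someI_ex[of "has_L2_weak_deriv l u"]) (simp add: H1_def)
  then show gL: "weak_deriv l u \<in> L2 l" by (simp add: has_L2_weak_deriv_def g_def)
  then have gi: "g absolutely_integrable_on {0..l}" using L2_abs_int g_def by blast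
  define G where "G = (\<lambda>x. integral {0..x} g)"
  have G: "primitive_on l G g" using gi by (intro primitive_onI) (auto simp: G_def)
  have GL: "G \<in> L2 l" using primitive_continuous[OF G] by (rule L2_continuous)
  have Gw: "has_L2_weak_deriv l G g" using primitive_weak_deriv[OF \<open>l > 0\<close> G] gL g_def by simp
  have uL: "u \<in> L2 l" using u by (simp add: H1_def)
  define D where "D = (\<lambda>x. u x - G x)"
  have DL: "D \<in> L2 l" unfolding D_def by (rule L2_diff[OF uL GL])
  have "integral {0..l} (\<lambda>x. D x * deriv \<phi> x) = 0" if \<phi>: "\<phi> \<in> test_functions l" for \<phi>
  proof -
    have "(\<lambda>x. u x * deriv \<phi> x) integrable_on {0..l}" "(\<lambda>x. G x * deriv \<phi> x) integrable_on {0..l}"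
      using L2_mult_abs_int uL GL L2_smooth smooth_deriv[OF test_smooth[OF \<phi>]] abs_int_imp_int by blast+
    then show ?thesis
      using weak_deriv_D[OF g uL \<phi>] weak_deriv_D[OF Gw GL \<phi>]
      by (simp add: D_def left_diff_distrib HK_integral_diff)
  qed
  then obtain \<kappa> where \<kappa>: "\<And>x. x \<in> {0..l} \<Longrightarrow> integral {0..x} D = \<kappa> * x"
    using du_Bois_Reymond[OF \<open>l > 0\<close> DL] by blast
  have cD: "continuous_on {0..l} D"
    unfolding D_def using c primitive_continuous[OF G] by (rule continuous_on_diff)
  \<comment> \<open>Differentiating both sides of the integrated identity gives the pointwise one,
    because D is continuous.\<close>
  have "D x = \<kappa>" if x: "x \<in> {0..l}" for x
  proof -
    have "((\<lambda>x. integral {0..x} D) has_real_derivative D x) (at x within {0..l})"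
      using integral_has_real_derivative[OF cD x] .
    then have "((\<lambda>x. \<kappa> * x) has_real_derivative D x) (at x within {0..l})"
      by (rule has_field_derivative_transform_within[where d=1]) (use x \<kappa> in auto)
    moreover have "((\<lambda>x. \<kappa> * x) has_real_derivative \<kappa>) (at x within {0..l})"
      by (auto intro!: derivative_eq_intros)
    ultimately show ?thesis by (rule deriv_within_Icc_unique[OF \<open>l > 0\<close> x])
  qed
  then have eq: "u x = G x + \<kappa>" if "x \<in> {0..l}" for x using that by (fastforce simp: D_def)
  show "primitive_on l u (weak_deriv l u)"
    unfolding g_def[symmetric]
  proof (rule primitive_onI[OF gi])
    fix x assume "x \<in> {0..l}"
    then show "u x = u 0 + integral {0..x} g" using eq[of x] eq[of 0] \<open>l > 0\<close> by (simp add: G_def)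
  qed
qed

section \<open>The H1 norm, boundary values and density of test functions\<close>

lemma H1_norm_primitive:
  assumes "l > 0" and u: "primitive_on l u g" and g: "g \<in> L2 l"
  shows "u \<in> H1 l" "(H1_norm l u)\<^sup>2 = integral {0..l} (\<lambda>x. (u x)\<^sup>2) + integral {0..l} (\<lambda>x. (g x)\<^sup>2)"
proof -
  have uL: "u \<in> L2 l" using primitive_continuous[OF u] by (rule L2_continuous)
  show "u \<in> H1 l" using uL primitive_weak_deriv[OF assms] by (auto simp: H1_def)
  note w = primitive_weak_deriv_AE[OF assms]
  have wL: "weak_deriv l u \<in> L2 l" using w(1) by (simp add: has_L2_weak_deriv_def)
  have "(\<integral>x. (weak_deriv l u x)\<^sup>2 \<partial>(Om l)) = (\<integral>x. (g x)\<^sup>2 \<partial>(Om l))"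
    using wL g w(2) by (intro Bochner_Integration.integral_cong_AE) (auto simp: L2_def)
  then have "(L2_norm l (weak_deriv l u))\<^sup>2 = (L2_norm l g)\<^sup>2"
    by (simp add: L2_norm_def)
  moreover have "(H1_norm l u)\<^sup>2 = (L2_norm l u)\<^sup>2 + (L2_norm l (weak_deriv l u))\<^sup>2"
    unfolding H1_norm_def by (simp add: real_sqrt_pow2)
  ultimately show "(H1_norm l u)\<^sup>2 = integral {0..l} (\<lambda>x. (u x)\<^sup>2) + integral {0..l} (\<lambda>x. (g x)\<^sup>2)"
    using L2_norm_sq uL g by metis
qed

lemma H1_norm_nonneg: "H1_norm l u \<ge> 0"
  by (simp add: H1_norm_def)

lemma primitive_sup_bound:
  assumes w: "primitive_on l w g" and "x \<in> {0..l}" "y \<in> {0..l}"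
  shows "\<bar>w x - w y\<bar> \<le> integral {0..l} (\<lambda>x. \<bar>g x\<bar>)"
proof -
  have gi: "g absolutely_integrable_on {0..l}" using w by (rule primitive_abs_int)
  then have ai: "(\<lambda>x. \<bar>g x\<bar>) absolutely_integrable_on {0..l}" by (simp add: set_integrable_abs)
  have *: "\<bar>w y - w x\<bar> \<le> integral {0..l} (\<lambda>x. \<bar>g x\<bar>)" if "0 \<le> x" "x \<le> y" "y \<le> l" for x y
  proof -
    have "norm (integral {x..y} g) \<le> integral {x..y} (\<lambda>x. \<bar>g x\<bar>)"
      using int_sub[OF gi] int_sub[OF ai] that by (intro integral_norm_bound_integral) auto
    also have "\<dots> \<le> integral {0..l} (\<lambda>x. \<bar>g x\<bar>)"
      using int_sub[OF ai] that by (intro integral_subset_le) auto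
    finally show ?thesis using primitive_diff_eq[OF w that] by simp
  qed
  show ?thesis using *[of x y] *[of y x] assms by (cases "x \<le> y") (auto simp: abs_minus_commute)
qed

text \<open>The embedding of H1 into the continuous functions with a crude constant: bound \<bar>w
  x\<bar> by \<bar>w y\<bar> plus the L1 norm of g and integrate over y, which produces the factor l
  on the left.\<close>

lemma H1_sup_bound:
  assumes "l > 0" and w: "primitive_on l w g" and g: "g \<in> L2 l"
    and e: "H1_norm l w < e" and x: "x \<in> {0..l}"
  shows "l * \<bar>w x\<bar> \<le> (l + 1) * (l + 1) * e"
proof -
  have "e > 0" using e H1_norm_nonneg[of l w] by linarith
  have wL: "w \<in> L2 l" using primitive_continuous[OF w] by (rule L2_continuous)
  have n0: "integral {0..l} (\<lambda>x. (w x)\<^sup>2) \<ge> 0" "integral {0..l} (\<lambda>x. (g x)\<^sup>2) \<ge> 0"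
    using L2_square_abs_int[OF wL] L2_square_abs_int[OF g] abs_int_imp_int
    by (auto intro!: HK_integral_nonneg)
  have "(H1_norm l w)\<^sup>2 \<le> e\<^sup>2" using e H1_norm_nonneg[of l w] by (intro power_mono) auto
  then have le: "integral {0..l} (\<lambda>x. (w x)\<^sup>2) \<le> e * e" "integral {0..l} (\<lambda>x. (g x)\<^sup>2) \<le> e * e"
    using H1_norm_primitive(2)[OF assms(1-3)] n0 by (auto simp: power2_eq_square)
  \<comment> \<open>\<open>L1_le_L2\<close> with d = e; a strict upper bound e of the norm is
    positive even where the norm is 0.\<close>
  have A: "integral {0..l} (\<lambda>x. \<bar>f x\<bar>) \<le> (l + 1) * e" if "f \<in> L2 l" "integral {0..l} (\<lambda>x. (f x)\<^sup>2) \<le> e * e" for f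
  proof -
    have "integral {0..l} (\<lambda>x. \<bar>f x\<bar>) \<le> (l * e + integral {0..l} (\<lambda>x. (f x)\<^sup>2) / e) / 2"
      using L1_le_L2[OF that(1) \<open>e > 0\<close>] assms by simp
    also have "integral {0..l} (\<lambda>x. (f x)\<^sup>2) / e \<le> e"
      using that \<open>e > 0\<close> by (simp add: pos_divide_le_eq)
    finally have "integral {0..l} (\<lambda>x. \<bar>f x\<bar>) \<le> (l * e + e) / 2" by simp
    also have "\<dots> \<le> (l + 1) * e" using \<open>l > 0\<close> \<open>e > 0\<close> by (simp add: field_simps)
    finally show ?thesis .
  qed
  have "l * \<bar>w x\<bar> = integral {0..l} (\<lambda>y. \<bar>w x\<bar>)" using \<open>l > 0\<close> by simp
  also have "\<dots> \<le> integral {0..l} (\<lambda>y. \<bar>w y\<bar> + integral {0..l} (\<lambda>x. \<bar>g x\<bar>))"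
  proof (rule integral_le)
    show "(\<lambda>y. \<bar>w y\<bar> + integral {0..l} (\<lambda>x. \<bar>g x\<bar>)) integrable_on {0..l}"
      using primitive_continuous[OF w] by (intro integrable_continuous_real continuous_intros)
    show "\<bar>w x\<bar> \<le> \<bar>w y\<bar> + integral {0..l} (\<lambda>x. \<bar>g x\<bar>)" if "y \<in> {0..l}" for y
      using primitive_sup_bound[OF w x that] by linarith
  qed auto
  also have "\<dots> = integral {0..l} (\<lambda>y. \<bar>w y\<bar>) + l * integral {0..l} (\<lambda>x. \<bar>g x\<bar>)"
    using primitive_continuous[OF w] \<open>l > 0\<close>
    by (subst HK_integral_add) (auto intro!: integrable_continuous_real continuous_intros)
  also have "\<dots> \<le> (l + 1) * e + l * ((l + 1) * e)"
    using A[OF wL le(1)] A[OF g le(2)] \<open>l > 0\<close> by (intro add_mono mult_left_mono) auto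
  finally show ?thesis by (simp add: algebra_simps)
qed

text \<open>Test functions vanish at 0 and l, and H1 convergence controls the supremum, so the
  boundary values survive the closure.\<close>

lemma H10_D:
  assumes "l > 0" and v: "v \<in> H10 l"
  shows "weak_deriv l v \<in> L2 l" "primitive_on l v (weak_deriv l v)" "v 0 = 0" "v l = 0"
proof -
  have c: "continuous_on {0..l} v" and H: "v \<in> H1 l" using v by (auto simp: H10_def)
  show 1: "weak_deriv l v \<in> L2 l" "primitive_on l v (weak_deriv l v)"
    using H1_continuous_primitive[OF \<open>l > 0\<close> H c] by auto
  have *: "v x = 0" if x: "x \<in> {0, l}" for x
  proof (rule ccontr)
    assume "v x \<noteq> 0"
    \<comment> \<open>Chosen so that the bound of \<open>H1_sup_bound\<close> becomes half of l
      \<bar>v x\<bar>.\<close>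
    define e where "e = l * \<bar>v x\<bar> / ((l + 1) * (l + 1)) / 2"
    have "e > 0" using \<open>v x \<noteq> 0\<close> \<open>l > 0\<close> by (simp add: e_def)
    then obtain \<phi> where \<phi>: "\<phi> \<in> test_functions l" "H1_norm l (\<lambda>x. v x - \<phi> x) < e"
      using v by (auto simp: H10_def)
    have "primitive_on l (\<lambda>x. v x - \<phi> x) (\<lambda>x. weak_deriv l v x - deriv \<phi> x)"
      by (rule primitive_diff[OF 1(2) test_primitive[OF \<phi>(1)]])
    moreover have "(\<lambda>x. weak_deriv l v x - deriv \<phi> x) \<in> L2 l"
      using 1(1) \<phi>(1) L2_diff L2_smooth smooth_deriv test_smooth by blast
    ultimately have "l * \<bar>v x - \<phi> x\<bar> \<le> (l + 1) * (l + 1) * e"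
      using H1_sup_bound[OF \<open>l > 0\<close> _ _ \<phi>(2)] x \<open>l > 0\<close> by auto
    moreover have "\<phi> x = 0" using test_bound[OF \<phi>(1)] x by auto
    ultimately have "l * \<bar>v x\<bar> \<le> l * \<bar>v x\<bar> / 2"
      using \<open>l > 0\<close> by (simp add: e_def)
    then show False using \<open>v x \<noteq> 0\<close> \<open>l > 0\<close> by simp
  qed
  then show "v 0 = 0" "v l = 0" by auto
qed

text \<open>Weierstrass gives a uniformly close polynomial and a late cutoff makes it a test
  function. The cutoff spoils the mean, which stays small but need not vanish;
  \<open>C1_in_H10\<close> repairs this.\<close>

lemma smooth_approx_C0:
  assumes "l > 0" and w: "continuous_on {0..l} w" and 0: "integral {0..l} w = 0" and "d > 0"
  obtains q where "q \<in> test_functions l" "integral {0..l} (\<lambda>x. (q x - w x)\<^sup>2) < d\<^sup>2 * (l + 1)"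
    "\<bar>integral {0..l} q\<bar> < d * (l + 1)"
proof -
  obtain p where p: "real_polynomial_function p" "\<And>x. x \<in> {0..l} \<Longrightarrow> \<bar>w x - p x\<bar> < d"
    using Stone_Weierstrass_real_polynomial_function[of "{0..l}" w d] w \<open>d > 0\<close> by auto
  have ps: "smooth p" by (rule smooth_polynomial_function[OF p(1)])
  have pc: "continuous_on {0..l} p" using smooth_continuous_on[OF ps] .
  obtain \<theta> where \<theta>: "\<And>j. \<theta> j \<in> test_functions l" "\<And>j x. 0 \<le> \<theta> j x" "\<And>j x. \<theta> j x \<le> 1"
    "\<And>x. (\<lambda>j. \<theta> j x) \<longlonglongrightarrow> indicator {0<..<l} x"
    using bump_sequence[OF order_refl order_refl] by blast
  define q where "q = (\<lambda>j x. p x * \<theta> j x)"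
  have qt: "q j \<in> test_functions l" for j unfolding q_def by (rule test_mult[OF \<theta>(1) ps])
  have qc: "continuous_on S (q j)" for S j using qt test_smooth smooth_continuous_on by blast
  have qle: "\<bar>q j x\<bar> \<le> \<bar>p x\<bar>" for j x
    using \<theta>(2,3)[of j x] by (simp add: q_def abs_mult mult_left_le)
  have qlim: "(\<lambda>j. q j x) \<longlonglongrightarrow> p x" if "x \<in> {0<..<l}" for x
    using tendsto_mult[OF tendsto_const[of "p x"] \<theta>(4)[of x]] that by (simp add: q_def)
  \<comment> \<open>Dominated convergence is applied on the open interval, where the cutoffs tend to
    1 at every point.\<close>
  have oi: "integral {0<..<l} f = integral {0..l} f" for f :: "real \<Rightarrow> real"
    by (metis integral_open_interval_real)
  have io: "f integrable_on {0<..<l}" if "continuous_on {0..l} f" for f :: "real \<Rightarrow> real"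
    using integrable_continuous_real[OF that] integrable_on_open_interval_real by blast
  have "(\<lambda>j. integral {0<..<l} (\<lambda>x. (q j x - w x)\<^sup>2)) \<longlonglongrightarrow> integral {0<..<l} (\<lambda>x. (p x - w x)\<^sup>2)"
  proof (rule dominated_convergence)
    show "(\<lambda>x. (q j x - w x)\<^sup>2) integrable_on {0<..<l}" for j
      by (intro io continuous_intros qc w)
    show "(\<lambda>x. (\<bar>p x\<bar> + \<bar>w x\<bar>)\<^sup>2) integrable_on {0<..<l}"
      by (intro io continuous_intros pc w)
    show "norm ((q j x - w x)\<^sup>2) \<le> (\<bar>p x\<bar> + \<bar>w x\<bar>)\<^sup>2" for j x
      using qle[of j x] by (simp, subst abs_le_square_iff[symmetric]) (auto simp: abs_le_iff)
    show "(\<lambda>j. (q j x - w x)\<^sup>2) \<longlonglongrightarrow> (p x - w x)\<^sup>2" if "x \<in> {0<..<l}" for x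
      by (intro tendsto_intros qlim that)
  qed
  \<comment> \<open>The slack between l and l + 1 makes the inequality strict for the limit, so it
    holds for all late j.\<close>
  moreover have "integral {0<..<l} (\<lambda>x. (p x - w x)\<^sup>2) < d\<^sup>2 * (l + 1)"
  proof -
    have "integral {0..l} (\<lambda>x. (p x - w x)\<^sup>2) \<le> integral {0..l} (\<lambda>x. d\<^sup>2)"
    proof (rule integral_le)
      show "(\<lambda>x. (p x - w x)\<^sup>2) integrable_on {0..l}"
        by (intro integrable_continuous_real continuous_intros pc w)
      show "(p x - w x)\<^sup>2 \<le> d\<^sup>2" if "x \<in> {0..l}" for x
        using p(2)[OF that] \<open>d > 0\<close> by (subst abs_le_square_iff[symmetric]) auto
    qed auto
    also have "\<dots> < d\<^sup>2 * (l + 1)" using \<open>l > 0\<close> \<open>d > 0\<close> by (simp add: algebra_simps)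
    finally show ?thesis using oi by simp
  qed
  ultimately have 1: "\<forall>\<^sub>F j in sequentially. integral {0<..<l} (\<lambda>x. (q j x - w x)\<^sup>2) < d\<^sup>2 * (l + 1)"
    by (rule order_tendstoD)
  have "(\<lambda>j. integral {0<..<l} (q j)) \<longlonglongrightarrow> integral {0<..<l} p"
  proof (rule dominated_convergence)
    show "q j integrable_on {0<..<l}" for j by (intro io qc)
    show "(\<lambda>x. \<bar>p x\<bar>) integrable_on {0<..<l}" by (intro io continuous_intros pc)
  qed (use qle qlim in auto)
  then have "(\<lambda>j. \<bar>integral {0<..<l} (q j)\<bar>) \<longlonglongrightarrow> \<bar>integral {0<..<l} p\<bar>"
    by (rule tendsto_rabs)
  moreover have "\<bar>integral {0<..<l} p\<bar> < d * (l + 1)"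
  proof -
    have "integral {0..l} p = integral {0..l} (\<lambda>x. p x - w x)"
      using 0 pc w by (subst HK_integral_diff) (auto intro: integrable_continuous_real)
    also have "norm \<dots> \<le> d * (l - 0)"
      by (rule integral_bound) (use \<open>l > 0\<close> p(2) pc w in \<open>auto intro!: continuous_intros simp: abs_minus_commute less_imp_le\<close>)
    also have "\<dots> < d * (l + 1)" using \<open>l > 0\<close> \<open>d > 0\<close> by (simp add: algebra_simps)
    finally show ?thesis using oi by simp
  qed
  ultimately have 2: "\<forall>\<^sub>F j in sequentially. \<bar>integral {0<..<l} (q j)\<bar> < d * (l + 1)"
    by (rule order_tendstoD)
  from eventually_happens[OF eventually_conj[OF 1 2]] obtain j where
    "integral {0<..<l} (\<lambda>x. (q j x - w x)\<^sup>2) < d\<^sup>2 * (l + 1)" "\<bar>integral {0<..<l} (q j)\<bar> < d * (l + 1)" by auto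
  then show ?thesis using that[OF qt[of j]] oi by simp
qed

lemma integral_square_add_le:
  assumes "f \<in> L2 l" "g \<in> L2 l"
  shows "integral {0..l} (\<lambda>x. (f x + g x)\<^sup>2) \<le> 2 * integral {0..l} (\<lambda>x. (f x)\<^sup>2) + 2 * integral {0..l} (\<lambda>x. (g x)\<^sup>2)"
proof -
  have i: "(\<lambda>x. (f x)\<^sup>2) integrable_on {0..l}" "(\<lambda>x. (g x)\<^sup>2) integrable_on {0..l}" "(\<lambda>x. (f x + g x)\<^sup>2) integrable_on {0..l}"
    using L2_square_abs_int L2_add assms abs_int_imp_int by blast+
  have "integral {0..l} (\<lambda>x. (f x + g x)\<^sup>2) \<le> integral {0..l} (\<lambda>x. 2 * (f x)\<^sup>2 + 2 * (g x)\<^sup>2)"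
  proof (rule integral_le)
    fix x show "(f x + g x)\<^sup>2 \<le> 2 * (f x)\<^sup>2 + 2 * (g x)\<^sup>2"
      using sum_squares_bound[of "f x" "g x"] by (simp add: power2_sum)
  qed (use i in \<open>auto intro!: integrable_add\<close>)
  also have "\<dots> = 2 * integral {0..l} (\<lambda>x. (f x)\<^sup>2) + 2 * integral {0..l} (\<lambda>x. (g x)\<^sup>2)"
    using i by (subst HK_integral_add) auto
  finally show ?thesis .
qed

text \<open>Approximate \<open>u'\<close> in \<open>L\<^sup>2\<close> by a polynomial times a cutoff, correct its mean with a fixed
  bump, and integrate.\<close>

lemma C1_in_H10:
  assumes "l > 0" and u: "primitive_on l u w" and w: "continuous_on {0..l} w" and "u 0 = 0" "u l = 0"
  shows "u \<in> H10 l"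
proof -
  have wL: "w \<in> L2 l" using w by (rule L2_continuous)
  have uc: "continuous_on {0..l} u" using u by (rule primitive_continuous)
  have int0: "integral {0..l} w = 0"
    using primitive_diff_eq[OF u, of 0 l] assms by simp
  obtain \<psi> where \<psi>: "\<psi> \<in> test_functions l" "integral {0..l} \<psi> = 1"
    using unit_test_function[OF \<open>l > 0\<close>] .
  define A where "A = integral {0..l} (\<lambda>x. (\<psi> x)\<^sup>2)"
  have A0: "A \<ge> 0" unfolding A_def
    using L2_square_abs_int[OF L2_smooth[OF test_smooth[OF \<psi>(1)]]] abs_int_imp_int
    by (intro HK_integral_nonneg) auto
  \<comment> \<open>d^2 C will bound the squared L2 error of the derivative: 2 (l + 1) comes from
    the approximation, the other term from the mean correction, whose coefficient is below d (l +
    1).\<close>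
  define C where "C = 2 * (l + 1) + 2 * ((l + 1)\<^sup>2 * A)"
  have C0: "C > 0" using A0 \<open>l > 0\<close> by (simp add: C_def add_pos_nonneg)
  \<comment> \<open>d^2 K will bound the squared H1 error; the first term comes from the supremum of
    the error of u, itself bounded by the L1 error of the derivative.\<close>
  define K where "K = l * ((l + C) / 2)\<^sup>2 + C"
  have K0: "K > 0" using C0 \<open>l > 0\<close> by (simp add: K_def add_nonneg_pos)
  have "\<exists>\<phi>\<in>test_functions l. H1_norm l (\<lambda>x. u x - \<phi> x) < e" if "e > 0" for e
  proof -
    \<comment> \<open>With this value d^2 K = (e / 2)^2.\<close>
    define d where "d = e / (2 * sqrt K)"
    have d0: "d > 0" using that K0 by (simp add: d_def)
    obtain q0 where q0: "q0 \<in> test_functions l" "integral {0..l} (\<lambda>x. (q0 x - w x)\<^sup>2) < d\<^sup>2 * (l + 1)"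
      "\<bar>integral {0..l} q0\<bar> < d * (l + 1)"
      using smooth_approx_C0[OF \<open>l > 0\<close> w int0 d0] .
    define c where "c = - integral {0..l} q0"
    define q where "q = (\<lambda>x. q0 x + c * \<psi> x)"
    have q: "q \<in> test_functions l"
      unfolding q_def by (rule test_add[OF q0(1) test_mult[OF \<psi>(1) smooth_const]])
    have i: "q0 integrable_on {0..l}" "\<psi> integrable_on {0..l}"
      using q0(1) \<psi>(1) test_smooth smooth_continuous_on integrable_continuous_real by blast+
    have q_int: "integral {0..l} q = 0"
      unfolding q_def using HK_integral_add[OF i(1) integrable_on_mult_right[OF i(2), of c]] \<psi>(2)
      by (simp add: c_def)
    define \<phi> where "\<phi> = (\<lambda>x. integral {0..x} q)"
    have \<phi>: "\<phi> \<in> test_functions l" and d\<phi>: "deriv \<phi> = q"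
      unfolding \<phi>_def using test_antideriv[OF q q_int] by auto
    have pr: "primitive_on l (\<lambda>x. u x - \<phi> x) (\<lambda>x. w x - q x)"
      using primitive_diff[OF u test_primitive[OF \<phi>]] d\<phi> by simp
    have wqL: "(\<lambda>x. w x - q x) \<in> L2 l"
      using wL q L2_diff L2_smooth test_smooth by blast
    have "integral {0..l} (\<lambda>x. (w x - q x)\<^sup>2) = integral {0..l} (\<lambda>x. ((q0 x - w x) + c * \<psi> x)\<^sup>2)"
      by (rule HK_integral_cong) (simp add: q_def power2_eq_square algebra_simps)
    also have "\<dots> \<le> 2 * integral {0..l} (\<lambda>x. (q0 x - w x)\<^sup>2) + 2 * integral {0..l} (\<lambda>x. (c * \<psi> x)\<^sup>2)"
      using q0(1) \<psi>(1)
      by (intro integral_square_add_le L2_diff[OF L2_smooth wL] L2_cmult[OF L2_smooth]) (auto intro: test_smooth)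
    also have "\<dots> = 2 * integral {0..l} (\<lambda>x. (q0 x - w x)\<^sup>2) + 2 * (c\<^sup>2 * A)"
      by (simp add: A_def power_mult_distrib)
    also have "\<dots> \<le> 2 * (d\<^sup>2 * (l + 1)) + 2 * ((d * (l + 1))\<^sup>2 * A)"
    proof -
      have "c\<^sup>2 \<le> (d * (l + 1))\<^sup>2"
        using q0(3) d0 \<open>l > 0\<close> by (subst abs_le_square_iff[symmetric]) (auto simp: c_def abs_mult)
      then show ?thesis using q0(2) A0 by (intro add_mono mult_left_mono mult_right_mono) auto
    qed
    also have "\<dots> = d\<^sup>2 * C" unfolding C_def power_mult_distrib by (simp add: algebra_simps)
    finally have w2: "integral {0..l} (\<lambda>x. (w x - q x)\<^sup>2) \<le> d\<^sup>2 * C" .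
    have "integral {0..l} (\<lambda>x. \<bar>w x - q x\<bar>) \<le> (l * d + integral {0..l} (\<lambda>x. (w x - q x)\<^sup>2) / d) / 2"
      using L1_le_L2[OF wqL d0] \<open>l > 0\<close> by simp
    also have "\<dots> \<le> (l * d + d * C) / 2"
      using w2 d0 by (simp add: pos_divide_le_eq power2_eq_square algebra_simps)
    finally have w1: "integral {0..l} (\<lambda>x. \<bar>w x - q x\<bar>) \<le> d * ((l + C) / 2)" by (simp add: algebra_simps)
    have \<phi>0: "\<phi> 0 = 0" by (simp add: \<phi>_def)
    have sup: "\<bar>u x - \<phi> x\<bar> \<le> d * ((l + C) / 2)" if "x \<in> {0..l}" for x
      using primitive_sup_bound[OF pr that, of 0] \<open>l > 0\<close> \<open>u 0 = 0\<close> \<phi>0 w1 by simp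
    have "integral {0..l} (\<lambda>x. (u x - \<phi> x)\<^sup>2) \<le> integral {0..l} (\<lambda>x. (d * ((l + C) / 2))\<^sup>2)"
    proof (rule integral_le)
      show "(\<lambda>x. (u x - \<phi> x)\<^sup>2) integrable_on {0..l}"
        using primitive_continuous[OF pr] by (intro integrable_continuous_real continuous_on_power)
      show "(u x - \<phi> x)\<^sup>2 \<le> (d * ((l + C) / 2))\<^sup>2" if "x \<in> {0..l}" for x
        using sup[OF that] by (subst abs_le_square_iff[symmetric]) auto
    qed auto
    also have "\<dots> = l * (d * ((l + C) / 2))\<^sup>2"
      using \<open>l > 0\<close> by simp
    also have "\<dots> = d\<^sup>2 * (l * ((l + C) / 2)\<^sup>2)"
      by (metis mult.left_commute power_mult_distrib)
    finally have u2: "integral {0..l} (\<lambda>x. (u x - \<phi> x)\<^sup>2) \<le> d\<^sup>2 * (l * ((l + C) / 2)\<^sup>2)" .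
    have "d\<^sup>2 * K = d\<^sup>2 * (l * ((l + C) / 2)\<^sup>2) + d\<^sup>2 * C"
      unfolding K_def by (rule distrib_left)
    then have "(H1_norm l (\<lambda>x. u x - \<phi> x))\<^sup>2 \<le> d\<^sup>2 * K"
      using H1_norm_primitive(2)[OF \<open>l > 0\<close> pr wqL] w2 u2 by linarith
    also have "\<dots> = (e / 2)\<^sup>2" using K0 by (simp add: d_def power_divide power_mult_distrib)
    finally have "(H1_norm l (\<lambda>x. u x - \<phi> x))\<^sup>2 \<le> (e / 2)\<^sup>2" .
    then have "H1_norm l (\<lambda>x. u x - \<phi> x) \<le> e / 2"
      by (rule power2_le_imp_le) (use that in auto)
    then show ?thesis using \<phi> that by (intro bexI[of _ \<phi>]) auto
  qed
  then show ?thesis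
    using H1_norm_primitive(1)[OF \<open>l > 0\<close> u wL] uc by (simp add: H10_def)
qed

section \<open>The integral form of the problem\<close>

text \<open>The bounds hold at every point of [0, l], which spares null sets in all estimates;
  \<open>clamp_weight\<close> brings the given weights into this form.\<close>

definition weight :: "real \<Rightarrow> real \<Rightarrow> real \<Rightarrow> (real \<Rightarrow> real) \<Rightarrow> bool" where
  "weight a b l m \<longleftrightarrow> m \<in> borel_measurable (Om l) \<and> (\<forall>x\<in>{0..l}. a \<le> m x \<and> m x \<le> b)"

definition fucik_rhs :: "(real \<Rightarrow> real) \<Rightarrow> (real \<Rightarrow> real) \<Rightarrow> real \<Rightarrow> real \<Rightarrow> (real \<Rightarrow> real) \<Rightarrow> real \<Rightarrow> real" where
  "fucik_rhs m n \<alpha> \<beta> u x = \<alpha> * m x * max 0 (u x) - \<beta> * n x * max 0 (- u x)"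

text \<open>The Caratheodory form of the initial value problem: \<open>w\<close> is the continuous representative of \<open>u'\<close>.\<close>

definition solves ::
  "real \<Rightarrow> (real \<Rightarrow> real) \<Rightarrow> (real \<Rightarrow> real) \<Rightarrow> real \<Rightarrow> real \<Rightarrow> (real \<Rightarrow> real) \<Rightarrow> (real \<Rightarrow> real) \<Rightarrow> bool" where
  "solves l m n \<alpha> \<beta> u w \<longleftrightarrow>
     primitive_on l u w \<and> u 0 = 0 \<and> primitive_on l w (\<lambda>x. - fucik_rhs m n \<alpha> \<beta> u x)"

lemma weight_measurable: "weight a b l m \<Longrightarrow> m \<in> borel_measurable (Om l)"
  by (simp add: weight_def)

lemma weight_bounds: "weight a b l m \<Longrightarrow> x \<in> {0..l} \<Longrightarrow> a \<le> m x \<and> m x \<le> b"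
  by (simp add: weight_def)

lemma fucik_rhs_measurable:
  assumes "m \<in> borel_measurable (Om l)" "n \<in> borel_measurable (Om l)" "u \<in> borel_measurable (Om l)"
  shows "fucik_rhs m n \<alpha> \<beta> u \<in> borel_measurable (Om l)"
  unfolding fucik_rhs_def[abs_def] using assms by measurable

lemma fucik_rhs_bound:
  assumes "\<bar>m x\<bar> \<le> b" "\<bar>n x\<bar> \<le> b"
  shows "\<bar>fucik_rhs m n \<alpha> \<beta> u x\<bar> \<le> (\<bar>\<alpha>\<bar> + \<bar>\<beta>\<bar>) * b * \<bar>u x\<bar>"
proof -
  have "\<bar>fucik_rhs m n \<alpha> \<beta> u x\<bar> \<le> \<bar>\<alpha>\<bar> * \<bar>m x\<bar> * \<bar>max 0 (u x)\<bar> + \<bar>\<beta>\<bar> * \<bar>n x\<bar> * \<bar>max 0 (- u x)\<bar>"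
    unfolding fucik_rhs_def abs_mult[symmetric] by (rule abs_triangle_ineq4)
  also have "\<dots> \<le> \<bar>\<alpha>\<bar> * b * \<bar>u x\<bar> + \<bar>\<beta>\<bar> * b * \<bar>u x\<bar>"
    using assms by (intro add_mono mult_mono mult_nonneg_nonneg) auto
  finally show ?thesis by (simp add: algebra_simps)
qed

lemma fucik_rhs_weight_bound:
  assumes "weight a b l m" "weight a b l n" "0 < a" "x \<in> {0..l}"
  shows "\<bar>fucik_rhs m n \<alpha> \<beta> u x\<bar> \<le> (\<bar>\<alpha>\<bar> + \<bar>\<beta>\<bar>) * b * \<bar>u x\<bar>"
  using assms weight_bounds[OF assms(1)] weight_bounds[OF assms(2)] by (intro fucik_rhs_bound) force+

lemma fucik_rhs_bounded:
  assumes "weight a b l m" "weight a b l n" "0 < a" "a \<le> b" and u: "continuous_on {0..l} u"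
  obtains M where "M \<ge> 0" "\<And>x. x \<in> {0..l} \<Longrightarrow> \<bar>fucik_rhs m n \<alpha> \<beta> u x\<bar> \<le> M"
proof -
  obtain U where U: "U \<ge> 0" "\<And>x. x \<in> {0..l} \<Longrightarrow> \<bar>u x\<bar> \<le> U"
    using continuous_bounded_on_Icc[OF u] by blast
  show ?thesis
  proof
    show "0 \<le> (\<bar>\<alpha>\<bar> + \<bar>\<beta>\<bar>) * b * U" using U assms by simp
    fix x assume x: "x \<in> {0..l}"
    have "(\<bar>\<alpha>\<bar> + \<bar>\<beta>\<bar>) * b * \<bar>u x\<bar> \<le> (\<bar>\<alpha>\<bar> + \<bar>\<beta>\<bar>) * b * U"
      using U(2)[OF x] assms by (intro mult_left_mono) auto
    with fucik_rhs_weight_bound[OF assms(1-3) x]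
    show "\<bar>fucik_rhs m n \<alpha> \<beta> u x\<bar> \<le> (\<bar>\<alpha>\<bar> + \<bar>\<beta>\<bar>) * b * U" by (rule order_trans)
  qed
qed

lemma fucik_rhs_L2:
  assumes "weight a b l m" "weight a b l n" "0 < a" "a \<le> b" "continuous_on {0..l} u"
  shows "fucik_rhs m n \<alpha> \<beta> u \<in> L2 l"
proof -
  obtain M where "\<And>x. x \<in> {0..l} \<Longrightarrow> \<bar>fucik_rhs m n \<alpha> \<beta> u x\<bar> \<le> M"
    using fucik_rhs_bounded[OF assms] by blast
  then show ?thesis
    using assms by (intro L2_bounded fucik_rhs_measurable continuous_Om_measurable weight_measurable)
qed

lemma solves_continuous:
  assumes "solves l m n \<alpha> \<beta> u w"
  shows "continuous_on {0..l} u" "continuous_on {0..l} w"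
  using assms primitive_continuous unfolding solves_def by blast+

lemma solves_deriv:
  assumes "solves l m n \<alpha> \<beta> u w" "x \<in> {0..l}"
  shows "(u has_real_derivative w x) (at x within {0..l})"
  using assms primitive_deriv solves_continuous unfolding solves_def by blast

section \<open>Equivalence of the weak and the integral form\<close>

lemma test_weak_deriv_integral:
  assumes "l > 0" "\<phi> \<in> test_functions l" "f \<in> L2 l"
  shows "(\<integral>x. f x * weak_deriv l \<phi> x \<partial>(Om l)) = integral {0..l} (\<lambda>x. f x * deriv \<phi> x)"
proof -
  have dL: "deriv \<phi> \<in> L2 l" using assms L2_smooth smooth_deriv test_smooth by blast
  note w = primitive_weak_deriv_AE[OF assms(1) test_primitive[OF assms(2)] dL]
  have wL: "weak_deriv l \<phi> \<in> L2 l" using w(1) by (simp add: has_L2_weak_deriv_def)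
  have "(\<integral>x. f x * weak_deriv l \<phi> x \<partial>(Om l)) = (\<integral>x. f x * deriv \<phi> x \<partial>(Om l))"
    using w(2) L2_measurable[OF assms(3)] L2_measurable[OF dL] L2_measurable[OF wL]
    by (intro Bochner_Integration.integral_cong_AE borel_measurable_times) auto
  then show ?thesis using Om_integral[OF L2_mult_abs_int[OF assms(3) dL]] by simp
qed

text \<open>Let H be an indefinite integral of the right-hand side h. Integrating h \<phi> by parts,
  the weak equation says that u' + H annihilates all \<phi>', so u' = \<kappa> - H almost
  everywhere, and w = \<kappa> - H is its continuous version.\<close>

lemma weak_solution_imp_solves:
  assumes "l > 0" and mn: "weight a b l m" "weight a b l n" "0 < a" "a \<le> b"
    and ws: "weak_solution l m n \<alpha> \<beta> u"
  shows "\<exists>w. solves l m n \<alpha> \<beta> u w \<and> u l = 0"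
proof -
  have u: "u \<in> H10 l" using ws by (simp add: weak_solution_def)
  note uD = H10_D[OF \<open>l > 0\<close> u]
  define g where "g = weak_deriv l u"
  have g: "g \<in> L2 l" "primitive_on l u g" using uD by (simp_all add: g_def)
  have uc: "continuous_on {0..l} u" using g(2) by (rule primitive_continuous)
  define h where "h = fucik_rhs m n \<alpha> \<beta> u"
  have hL: "h \<in> L2 l" unfolding h_def using fucik_rhs_L2[OF mn uc] .
  have hi: "h absolutely_integrable_on {0..l}" using hL by (rule L2_abs_int)
  define H where "H = (\<lambda>x. integral {0..x} h)"
  have H: "primitive_on l H h" using hi by (intro primitive_onI) (auto simp: H_def)
  have HL: "H \<in> L2 l" using primitive_continuous[OF H] by (rule L2_continuous)
  define D where "D = (\<lambda>x. g x + H x)"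
  have DL: "D \<in> L2 l" unfolding D_def using g(1) HL by (rule L2_add)
  have "integral {0..l} (\<lambda>x. D x * deriv \<phi> x) = 0" if \<phi>: "\<phi> \<in> test_functions l" for \<phi>
  proof -
    have dL: "deriv \<phi> \<in> L2 l" "\<phi> \<in> L2 l" using \<phi> L2_smooth smooth_deriv test_smooth by blast+
    have "\<phi> \<in> H10 l"
      using C1_in_H10[OF \<open>l > 0\<close> test_primitive[OF \<phi>]] test_bound[OF \<phi>]
        smooth_continuous_on[OF smooth_deriv[OF test_smooth[OF \<phi>]]] by blast
    then have "(\<integral>x. g x * weak_deriv l \<phi> x \<partial>(Om l)) = (\<integral>x. h x * \<phi> x \<partial>(Om l))"
      using ws by (simp add: weak_solution_def g_def h_def fucik_rhs_def)
    then have 1: "integral {0..l} (\<lambda>x. g x * deriv \<phi> x) = integral {0..l} (\<lambda>x. h x * \<phi> x)"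
      unfolding test_weak_deriv_integral[OF \<open>l > 0\<close> \<phi> g(1)] Om_integral[OF L2_mult_abs_int[OF hL dL(2)]] .
    have 2: "integral {0..l} (\<lambda>x. H x * deriv \<phi> x) = - integral {0..l} (\<lambda>x. h x * \<phi> x)"
      by (rule weak_deriv_D[OF primitive_weak_deriv[OF \<open>l > 0\<close> H hL] HL \<phi>])
    show ?thesis
      using 1 2 HK_integral_add
        [OF L2_mult_abs_int[OF g(1) dL(1), THEN abs_int_imp_int] L2_mult_abs_int[OF HL dL(1), THEN abs_int_imp_int]]
      by (simp add: D_def distrib_right)
  qed
  then obtain \<kappa> where \<kappa>: "\<And>x. x \<in> {0..l} \<Longrightarrow> integral {0..x} D = \<kappa> * x"
    using du_Bois_Reymond[OF \<open>l > 0\<close> DL] by blast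
  define w where "w = (\<lambda>x. \<kappa> - H x)"
  have w: "primitive_on l w (\<lambda>x. - h x)"
    using primitive_cmult[OF H, of "-1"] by (auto simp: primitive_on_def w_def)
  have wc: "continuous_on {0..l} w" using w by (rule primitive_continuous)
  have "primitive_on l u w"
  proof (rule primitive_onI)
    show "w absolutely_integrable_on {0..l}" using wc by (rule absolutely_integrable_continuous_real)
    fix x assume x: "x \<in> {0..l}"
    have "{0..x} \<subseteq> {0..l}" using x by auto
    have i: "g integrable_on {0..x}" "H integrable_on {0..x}"
      using L2_abs_int[OF g(1)] L2_abs_int[OF HL] x by (auto intro: int_sub)
    have "integral {0..x} D = integral {0..x} g + integral {0..x} H"
      unfolding D_def using i by (rule HK_integral_add)
    moreover have "integral {0..x} w = \<kappa> * x - integral {0..x} H"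
      unfolding w_def using i(2) x by (subst HK_integral_diff) auto
    moreover have "integral {0..x} g = u x - u 0" using g(2) x by (simp add: primitive_on_def)
    ultimately show "u x = u 0 + integral {0..x} w" using \<kappa>[OF x] by simp
  qed
  then show ?thesis using w uD by (auto simp: solves_def h_def)
qed

text \<open>Integrate the derivative of w v; here w is the factor with bounded derivative, since the
  weak derivative of v is only square integrable. The boundary terms vanish with v.\<close>

lemma solves_imp_weak_solution:
  assumes "l > 0" and mn: "weight a b l m" "weight a b l n" "0 < a" "a \<le> b"
    and s: "solves l m n \<alpha> \<beta> u w" and ul: "u l = 0"
  shows "weak_solution l m n \<alpha> \<beta> u"
  unfolding weak_solution_def
proof (intro conjI ballI)
  have pu: "primitive_on l u w" and u0: "u 0 = 0" and pw: "primitive_on l w (\<lambda>x. - fucik_rhs m n \<alpha> \<beta> u x)"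
    using s by (auto simp: solves_def)
  note c = solves_continuous[OF s]
  have wL: "w \<in> L2 l" using c(2) by (rule L2_continuous)
  show "u \<in> H10 l" by (rule C1_in_H10[OF \<open>l > 0\<close> pu c(2) u0 ul])
  fix v assume v: "v \<in> H10 l"
  note vD = H10_D[OF \<open>l > 0\<close> v]
  have vL: "v \<in> L2 l" using primitive_continuous[OF vD(2)] by (rule L2_continuous)
  define h where "h = fucik_rhs m n \<alpha> \<beta> u"
  have hL: "h \<in> L2 l" unfolding h_def using fucik_rhs_L2[OF mn c(1)] .
  obtain M where M: "\<And>x. x \<in> {0..l} \<Longrightarrow> \<bar>h x\<bar> \<le> M"
    using fucik_rhs_bounded[OF mn c(1)] unfolding h_def by blast
  have "primitive_on l (\<lambda>x. w x * v x) (\<lambda>x. w x * weak_deriv l v x + - h x * v x)"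
    using primitive_mult[OF pw vD(2), of M] M unfolding h_def by simp
  then have "integral {0..l} (\<lambda>x. w x * weak_deriv l v x + - h x * v x) = 0"
    using primitive_diff_eq[of l _ _ 0 l] vD \<open>l > 0\<close> by fastforce
  then have "integral {0..l} (\<lambda>x. w x * weak_deriv l v x) = integral {0..l} (\<lambda>x. h x * v x)"
    using HK_integral_diff
        [OF L2_mult_abs_int[OF wL vD(1), THEN abs_int_imp_int] L2_mult_abs_int[OF hL vL, THEN abs_int_imp_int]]
    by simp
  then have "(\<integral>x. w x * weak_deriv l v x \<partial>(Om l)) = (\<integral>x. h x * v x \<partial>(Om l))"
    unfolding Om_integral[OF L2_mult_abs_int[OF wL vD(1)]] Om_integral[OF L2_mult_abs_int[OF hL vL]] .
  moreover have "(\<integral>x. weak_deriv l u x * weak_deriv l v x \<partial>(Om l)) = (\<integral>x. w x * weak_deriv l v x \<partial>(Om l))"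
  proof -
    note W = primitive_weak_deriv_AE[OF \<open>l > 0\<close> pu wL]
    have "weak_deriv l u \<in> L2 l" using W(1) by (simp add: has_L2_weak_deriv_def)
    then show ?thesis using W(2) L2_measurable[OF vD(1)] L2_measurable[OF wL] L2_measurable
      by (intro Bochner_Integration.integral_cong_AE borel_measurable_times) auto
  qed
  ultimately show "(\<integral>x. weak_deriv l u x * weak_deriv l v x \<partial>(Om l)) =
        (\<integral>x. (\<alpha> * m x * max 0 (u x) - \<beta> * n x * max 0 (- u x)) * v x \<partial>(Om l))"
    by (simp add: h_def fucik_rhs_def)
qed

lemma eigenfunction_iff:
  assumes "l > 0" "weight a b l m" "weight a b l n" "0 < a" "a \<le> b"
  shows "eigenfunction l m n \<alpha> \<beta> u \<longleftrightarrow>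
    (\<exists>w. solves l m n \<alpha> \<beta> u w) \<and> u l = 0 \<and> (\<exists>x\<in>{0..l}. u x \<noteq> 0)"
  unfolding eigenfunction_def
  using weak_solution_imp_solves[OF assms] solves_imp_weak_solution[OF assms] by blast

section \<open>Changing the weights on null sets; the linear case\<close>

lemma weak_solution_cong_AE:
  assumes meas: "m \<in> borel_measurable (Om l)" "m' \<in> borel_measurable (Om l)"
      "n \<in> borel_measurable (Om l)" "n' \<in> borel_measurable (Om l)"
    and AE: "AE x in Om l. m x = m' x" "AE x in Om l. n x = n' x"
  shows "weak_solution l m n \<alpha> \<beta> u \<longleftrightarrow> weak_solution l m' n' \<alpha> \<beta> u"
proof -
  have "(\<integral>x. (\<alpha> * m x * max 0 (u x) - \<beta> * n x * max 0 (- u x)) * v x \<partial>(Om l)) =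
      (\<integral>x. (\<alpha> * m' x * max 0 (u x) - \<beta> * n' x * max 0 (- u x)) * v x \<partial>(Om l))"
    if uv: "u \<in> H10 l" "v \<in> H10 l" for v
  proof -
    have [measurable]: "u \<in> borel_measurable (Om l)" "v \<in> borel_measurable (Om l)"
      using uv by (auto simp: H10_def intro: continuous_Om_measurable)
    note meas[measurable]
    show ?thesis
      by (rule Bochner_Integration.integral_cong_AE) (use AE in auto)
  qed
  then show ?thesis unfolding weak_solution_def by (auto simp del: max.absorb1)
qed

text \<open>With equal weights and equal parameters the right-hand side is linear, because u is its
  positive part minus its negative part. Eigenvalues thus fall under the tools for
  \<open>solves\<close>.\<close>

lemma is_eigenvalue_iff: "is_eigenvalue l r \<mu> \<longleftrightarrow> (\<exists>u. eigenfunction l r r \<mu> \<mu> u)"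
proof -
  have "(\<lambda>x. (\<mu> * r x * max 0 (u x) - \<mu> * r x * max 0 (- u x)) * v x) = (\<lambda>x. \<mu> * r x * u x * v x)" for u v :: "real \<Rightarrow> real"
    by (auto simp: max_def algebra_simps)
  then show ?thesis
    unfolding is_eigenvalue_def eigenfunction_def weak_solution_def
    by auto
qed

lemma weak_curves_cong_AE:
  assumes "m \<in> borel_measurable (Om l)" "m' \<in> borel_measurable (Om l)"
      "n \<in> borel_measurable (Om l)" "n' \<in> borel_measurable (Om l)"
    and "AE x in Om l. m x = m' x" "AE x in Om l. n x = n' x"
  shows "eigenfunction l m n = eigenfunction l m' n'"
    "C_plus l k m n = C_plus l k m' n'" "C_minus l k m n = C_minus l k m' n'"
proof -
  show e: "eigenfunction l m n = eigenfunction l m' n'"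
    unfolding eigenfunction_def[abs_def] using weak_solution_cong_AE[OF assms] by blast
  have "first_eigenvalue l m = first_eigenvalue l m'" "first_eigenvalue l n = first_eigenvalue l n'"
    using weak_solution_cong_AE[OF assms(1,2) assms(1,2) assms(5) assms(5)]
      weak_solution_cong_AE[OF assms(3,4) assms(3,4) assms(6) assms(6)]
    unfolding first_eigenvalue_def is_eigenvalue_iff eigenfunction_def by auto
  then show "C_plus l k m n = C_plus l k m' n'" "C_minus l k m n = C_minus l k m' n'"
    unfolding C_plus_def C_minus_def e by auto
qed

text \<open>The set of double zeros is closed by continuity. It is relatively open: on a short
  interval around a double zero, with \<bar>w\<bar> maximal at q, integrating twice gives
  \<bar>u\<bar> \<le> d \<bar>w q\<bar> and then \<bar>w q\<bar> \<le> B d^2 \<bar>w q\<bar> with B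
  d^2 < 1, so u and w vanish there. Connectedness does the rest.\<close>

lemma double_zero_imp_zero:
  assumes u: "primitive_on l u w" and w: "primitive_on l w f"
    and f: "\<And>x. x \<in> {0..l} \<Longrightarrow> \<bar>f x\<bar> \<le> C * \<bar>u x\<bar>"
    and z: "x0 \<in> {0..l}" "u x0 = 0" "w x0 = 0" and x: "x \<in> {0..l}"
  shows "u x = 0 \<and> w x = 0"
proof -
  define S where "S = {x \<in> {0..l}. u x = 0 \<and> w x = 0}"
  note c = primitive_continuous[OF u] primitive_continuous[OF w]
  define B where "B = \<bar>C\<bar> + 1"
  have B: "B \<ge> 1" by (simp add: B_def)
  have fB: "\<bar>f x\<bar> \<le> B * \<bar>u x\<bar>" if "x \<in> {0..l}" for x
    using f[OF that] by (smt (verit, ccfv_SIG) B_def abs_ge_zero mult_right_mono)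
  \<comment> \<open>As B \<ge> 1, this gives B d^2 = 1 / (4 B) < 1.\<close>
  define d where "d = 1 / (2 * B)"
  have d: "d > 0" "B * d * d < 1" using B by (auto simp: d_def field_simps)
  have "closedin (top_of_set {0..l}) S"
  proof -
    have "S = {x\<in>{0..l}. u x = 0} \<inter> {x\<in>{0..l}. w x = 0}" by (auto simp: S_def)
    then show ?thesis
      using continuous_closedin_preimage_constant[OF c(1)] continuous_closedin_preimage_constant[OF c(2)]
      by (auto intro: closedin_Int)
  qed
  moreover have "openin (top_of_set {0..l}) S"
    unfolding openin_euclidean_subtopology_iff
  proof (intro conjI ballI)
    fix p assume p: "p \<in> S"
    define I where "I = {max 0 (p - d)..min l (p + d)}"
    have Isub: "I \<subseteq> {0..l}" by (auto simp: I_def)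
    have pI: "p \<in> I" using p d(1) by (auto simp: I_def S_def)
    have "continuous_on I (\<lambda>x. \<bar>w x\<bar>)" using c(2) Isub by (intro continuous_intros) (rule continuous_on_subset)
    then obtain q where q: "q \<in> I" "\<And>s. s \<in> I \<Longrightarrow> \<bar>w s\<bar> \<le> \<bar>w q\<bar>"
      using continuous_attains_sup[of I "\<lambda>x. \<bar>w x\<bar>"] pI by (auto simp: I_def)
    have between: "s \<in> I" if "y \<in> I" "min p y \<le> s" "s \<le> max p y" for s y
      using that pI by (auto simp: I_def)
    have dist: "\<bar>y - p\<bar> \<le> d" if "y \<in> I" for y using that by (auto simp: I_def)
    have uI: "\<bar>u y\<bar> \<le> \<bar>w q\<bar> * d" if y: "y \<in> I" for y
    proof -
      have "\<bar>u y - u p\<bar> \<le> \<bar>w q\<bar> * \<bar>y - p\<bar>"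
      proof (rule primitive_lipschitz[OF u])
        show "\<bar>w s\<bar> \<le> \<bar>w q\<bar>" if "min p y \<le> s" "s \<le> max p y" for s
          by (rule q(2)[OF between[OF y that]])
      qed (use y pI Isub in blast)+
      also have "\<dots> \<le> \<bar>w q\<bar> * d" using dist[OF y] by (intro mult_left_mono) auto
      finally show ?thesis using p by (simp add: S_def)
    qed
    have "\<bar>w q - w p\<bar> \<le> (B * (\<bar>w q\<bar> * d)) * \<bar>q - p\<bar>"
    proof (rule primitive_lipschitz[OF w])
      fix s assume s: "s \<in> {0..l}" "min p q \<le> s" "s \<le> max p q"
      have "B * \<bar>u s\<bar> \<le> B * (\<bar>w q\<bar> * d)"
        using uI[OF between[OF q(1) s(2,3)]] B by (intro mult_left_mono) auto
      with fB[OF s(1)] show "\<bar>f s\<bar> \<le> B * (\<bar>w q\<bar> * d)" by linarith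
    qed (use p q Isub in \<open>auto simp: S_def\<close>)
    also have "\<dots> \<le> (B * (\<bar>w q\<bar> * d)) * d"
      using dist[OF q(1)] B d(1) by (intro mult_left_mono) auto
    finally have "\<bar>w q\<bar> \<le> (B * d * d) * \<bar>w q\<bar>" using p by (simp add: S_def mult_ac)
    then have "(1 - B * d * d) * \<bar>w q\<bar> \<le> 0" by (simp add: algebra_simps)
    then have wq: "w q = 0" using d(2) by (simp add: mult_le_0_iff)
    have "y \<in> S" if y: "y \<in> {0..l}" "dist y p < d" for y
    proof -
      have "y \<in> I" using y by (auto simp: I_def dist_real_def)
      then show "y \<in> S" using uI[of y] q(2)[of y] wq y by (simp add: S_def)
    qed
    then show "\<exists>e>0. \<forall>y\<in>{0..l}. dist y p < e \<longrightarrow> y \<in> S" using d(1) by blast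
  qed (auto simp: S_def)
  moreover have "connected {0..l}" by simp
  ultimately have "S = {} \<or> S = {0..l}" unfolding connected_clopen by blast
  moreover have "x0 \<in> S" using z by (simp add: S_def)
  ultimately have "x \<in> S" using x by blast
  then show ?thesis by (simp add: S_def)
qed

lemma solves_double_zero:
  assumes "weight a b l m" "weight a b l n" "0 < a" and s: "solves l m n \<alpha> \<beta> u w"
    and "x0 \<in> {0..l}" "u x0 = 0" "w x0 = 0" and "x \<in> {0..l}"
  shows "u x = 0 \<and> w x = 0"
proof (rule double_zero_imp_zero[of l u w "\<lambda>x. - fucik_rhs m n \<alpha> \<beta> u x" "(\<bar>\<alpha>\<bar> + \<bar>\<beta>\<bar>) * b" x0])
  show "primitive_on l u w" "primitive_on l w (\<lambda>x. - fucik_rhs m n \<alpha> \<beta> u x)"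
    using s by (auto simp: solves_def)
  show "\<bar>- fucik_rhs m n \<alpha> \<beta> u x\<bar> \<le> (\<bar>\<alpha>\<bar> + \<bar>\<beta>\<bar>) * b * \<bar>u x\<bar>" if "x \<in> {0..l}" for x
    using fucik_rhs_weight_bound[OF assms(1-3) that] by simp
qed (use assms in auto)

text \<open>The nonlinearity is only positively homogeneous; a change of sign is the business of
  \<open>solves_uminus\<close>.\<close>

lemma solves_scale:
  assumes "solves l m n \<alpha> \<beta> u w" "c > 0"
  shows "solves l m n \<alpha> \<beta> (\<lambda>x. c * u x) (\<lambda>x. c * w x)"
proof -
  have "max 0 (c * y) = c * max 0 y" for y using \<open>c > 0\<close> by (auto simp: max_def zero_le_mult_iff)
  from this[of "u _"] this[of "- u _"]
  have "fucik_rhs m n \<alpha> \<beta> (\<lambda>x. c * u x) x = c * fucik_rhs m n \<alpha> \<beta> u x" for x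
    by (simp add: fucik_rhs_def algebra_simps)
  then show ?thesis
    using assms primitive_cmult[of l u w c] primitive_cmult[of l w "\<lambda>x. - fucik_rhs m n \<alpha> \<beta> u x" c]
    by (simp add: solves_def)
qed

text \<open>The symmetry behind all reductions of negative solutions and of \<open>C_minus\<close>
  to the positive case.\<close>

lemma solves_uminus:
  assumes "solves l m n \<alpha> \<beta> u w"
  shows "solves l n m \<beta> \<alpha> (\<lambda>x. - u x) (\<lambda>x. - w x)"
proof -
  have "fucik_rhs n m \<beta> \<alpha> (\<lambda>x. - u x) x = - fucik_rhs m n \<alpha> \<beta> u x" for x
    by (simp add: fucik_rhs_def)
  then show ?thesis
    using assms primitive_cmult[of l u w "-1"] primitive_cmult[of l w "\<lambda>x. - fucik_rhs m n \<alpha> \<beta> u x" "-1"]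
    by (simp add: solves_def)
qed

lemma fucik_rhs_linear: "fucik_rhs r r \<mu> \<mu> u x = \<mu> * r x * u x"
  by (simp add: fucik_rhs_def max_def)

text \<open>The negative part of u vanishes, so the second weight and parameter do not enter. This
  is why a positive first eigenfunction for m solves the Fucik problem for every \<beta>, putting
  the whole line for k = 0 into the spectrum.\<close>

lemma solves_nonneg:
  assumes "solves l m n \<alpha> \<beta> u w" "\<And>x. x \<in> {0..l} \<Longrightarrow> u x \<ge> 0"
  shows "solves l m n' \<alpha> \<beta>' u w"
proof -
  have "fucik_rhs m n \<alpha> \<beta> u x = fucik_rhs m n' \<alpha> \<beta>' u x" if "x \<in> {0..l}" for x
    using assms(2)[OF that] by (simp add: fucik_rhs_def)
  then show ?thesis using assms(1) unfolding solves_def by (auto elim: primitive_cong)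
qed

lemma solves_normalize:
  assumes s: "solves l m n \<alpha> \<beta> u w" and nz: "\<exists>x\<in>{0..l}. w x \<noteq> 0"
  obtains c where "c > 0" "solves l m n \<alpha> \<beta> (\<lambda>x. c * u x) (\<lambda>x. c * w x)"
    "\<And>x. x \<in> {0..l} \<Longrightarrow> \<bar>c * w x\<bar> \<le> 1" "\<exists>x\<in>{0..l}. \<bar>c * w x\<bar> = 1"
proof -
  have "continuous_on {0..l} (\<lambda>x. \<bar>w x\<bar>)" using solves_continuous[OF s] by (intro continuous_intros)
  then obtain q where q: "q \<in> {0..l}" "\<And>x. x \<in> {0..l} \<Longrightarrow> \<bar>w x\<bar> \<le> \<bar>w q\<bar>"
    using continuous_attains_sup[of "{0..l}" "\<lambda>x. \<bar>w x\<bar>"] nz by auto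
  have "w q \<noteq> 0" using q(2) nz by force
  then show ?thesis
    using solves_scale[OF s, of "1 / \<bar>w q\<bar>"] q by (intro that[of "1 / \<bar>w q\<bar>"]) (auto simp: abs_mult)
qed

text \<open>Since u 0 = 0, a vanishing slope at 0 would be a double zero; nontriviality can
  therefore be read off at this single point.\<close>

lemma solves_nontrivial_iff:
  assumes "weight a b l m" "weight a b l n" "0 < a" "l > 0" and s: "solves l m n \<alpha> \<beta> u w"
  shows "(\<exists>x\<in>{0..l}. u x \<noteq> 0) \<longleftrightarrow> w 0 \<noteq> 0" "(\<exists>x\<in>{0..l}. w x \<noteq> 0) \<longleftrightarrow> w 0 \<noteq> 0"
proof -
  have u0: "u 0 = 0" using s by (simp add: solves_def)
  have "w 0 = 0" if "\<forall>x\<in>{0..l}. u x = 0"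
  proof -
    have D: "((\<lambda>x. 0) has_real_derivative w 0) (at 0 within {0..l})"
      by (rule has_field_derivative_transform_within[OF solves_deriv[OF s], where d=1])
        (use that \<open>l > 0\<close> in auto)
    show ?thesis by (rule deriv_within_Icc_unique[OF \<open>l > 0\<close> _ D DERIV_const]) (use \<open>l > 0\<close> in simp)
  qed
  then show "(\<exists>x\<in>{0..l}. u x \<noteq> 0) \<longleftrightarrow> w 0 \<noteq> 0"
    using solves_double_zero[OF assms(1-3) s, of 0] u0 \<open>l > 0\<close> by (meson atLeastAtMost_iff less_eq_real_def order_refl)
  show "(\<exists>x\<in>{0..l}. w x \<noteq> 0) \<longleftrightarrow> w 0 \<noteq> 0"
    using solves_double_zero[OF assms(1-3) s, of 0] u0 \<open>l > 0\<close> by (meson atLeastAtMost_iff less_eq_real_def order_refl)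
qed

section \<open>Compactness and stability of zeros\<close>

lemma weight_bounded_image: "weight a b l m \<Longrightarrow> bounded (m ` {0..l})"
  unfolding bounded_iff by (intro exI[of _ "\<bar>a\<bar> + \<bar>b\<bar>"]) (force simp: weight_def)

lemma weight_mult_abs_int:
  assumes "weight a b l m" "continuous_on {0..l} f"
  shows "(\<lambda>s. m s * f s) absolutely_integrable_on {0..l}"
  by (rule absolutely_integrable_bounded_measurable_product_real)
    (use assms weight_measurable weight_bounded_image absolutely_integrable_continuous_real in auto)

text \<open>A weak* convergent factor times a uniformly convergent one: write m f - m0 g as m (f -
  g) + (m - m0) g. The first term is small because the weights are bounded by b, the second tends to
  0 by weak* convergence.\<close>

lemma weak_star_uniform:
  assumes m: "\<And>j. weight a b l (m j)" and m0: "weight a b l m0" and "0 < a"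
    and ws: "weak_star_Linfty l m m0 sequentially"
    and fc: "\<And>j. continuous_on {0..l} (f j)" and f: "uniform_limit {0..l} f g sequentially"
    and x: "x \<in> {0..l}"
  shows "(\<lambda>j. integral {0..x} (\<lambda>s. m j s * f j s)) \<longlonglongrightarrow> integral {0..x} (\<lambda>s. m0 s * g s)"
proof -
  have gc: "continuous_on {0..l} g"
    by (rule uniform_limit_theorem[OF _ f]) (use fc in auto)
  \<comment> \<open>Truncating g at x gives an integrable function against which weak* convergence
    may be tested.\<close>
  define \<phi> where "\<phi> = (\<lambda>s. if s \<in> {0..x} then g s else 0)"
  have "g absolutely_integrable_on {0..x}"
    by (rule abs_int_sub[OF absolutely_integrable_continuous_real[OF gc]]) (use x in auto)
  then have "\<phi> absolutely_integrable_on UNIV"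
    unfolding \<phi>_def by (rule absolutely_integrable_restrict_UNIV[THEN iffD2])
  then have \<phi>i: "\<phi> absolutely_integrable_on {0..l}"
    by (rule set_integrable_subset) auto
  have eq: "(\<integral>s. r s * \<phi> s \<partial>(Om l)) = integral {0..x} (\<lambda>s. r s * g s)" if r: "weight a b l r" for r
  proof -
    have "(\<lambda>s. r s * \<phi> s) absolutely_integrable_on {0..l}"
      by (rule absolutely_integrable_bounded_measurable_product_real[OF _ _ _ \<phi>i])
        (use r weight_measurable weight_bounded_image in auto)
    then have "(\<integral>s. r s * \<phi> s \<partial>(Om l)) = integral {0..l} (\<lambda>s. r s * \<phi> s)"
      by (rule Om_integral)
    also have "\<dots> = integral {0..l} (\<lambda>s. if s \<in> {0..x} then r s * g s else 0)"
      by (rule HK_integral_cong) (simp add: \<phi>_def)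
    also have "\<dots> = integral ({0..x} \<inter> {0..l}) (\<lambda>s. r s * g s)"
      by (rule Henstock_Kurzweil_Integration.integral_restrict_Int)
    also have "{0..x} \<inter> {0..l} = {0..x}" using x by auto
    finally show ?thesis .
  qed
  have B: "(\<lambda>j. integral {0..x} (\<lambda>s. m j s * g s)) \<longlonglongrightarrow> integral {0..x} (\<lambda>s. m0 s * g s)"
    using ws \<phi>i unfolding weak_star_Linfty_def Om_integrable_iff eq[OF m, symmetric] eq[OF m0, symmetric]
    by blast
  have A: "(\<lambda>j. integral {0..x} (\<lambda>s. m j s * f j s) - integral {0..x} (\<lambda>s. m j s * g s)) \<longlonglongrightarrow> 0"
  proof (rule LIMSEQ_I)
    fix e :: real assume "e > 0"
    have b: "b > 0" using weight_bounds[OF m0 x] \<open>0 < a\<close> by auto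
    have l: "l \<ge> 0" using x by auto
    \<comment> \<open>Makes b d (l + 1) = e / 2; the summand 1 covers l = 0.\<close>
    define d where "d = e / (2 * b * (l + 1))"
    have d: "d > 0" using \<open>e > 0\<close> b l by (simp add: d_def)
    obtain N where N: "\<And>j s. j \<ge> N \<Longrightarrow> s \<in> {0..l} \<Longrightarrow> dist (f j s) (g s) < d"
      using uniform_limitD[OF f d] unfolding eventually_sequentially by blast
    show "\<exists>N. \<forall>j\<ge>N. norm (integral {0..x} (\<lambda>s. m j s * f j s) - integral {0..x} (\<lambda>s. m j s * g s) - 0) < e"
    proof (intro exI[of _ N] allI impI)
      fix j assume j: "j \<ge> N"
      have i: "(\<lambda>s. m j s * f j s) integrable_on {0..x}" "(\<lambda>s. m j s * g s) integrable_on {0..x}"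
        using weight_mult_abs_int[OF m fc] weight_mult_abs_int[OF m gc] x by (auto intro: int_sub)
      have "norm (integral {0..x} (\<lambda>s. m j s * f j s - m j s * g s)) \<le> integral {0..x} (\<lambda>s. b * d)"
      proof (rule integral_norm_bound_integral)
        fix s assume s: "s \<in> {0..x}"
        then have s': "s \<in> {0..l}" using x by auto
        have "norm (m j s * f j s - m j s * g s) = \<bar>m j s\<bar> * dist (f j s) (g s)"
          by (simp add: dist_real_def abs_mult[symmetric] right_diff_distrib)
        also have "\<dots> \<le> b * d"
        proof (rule mult_mono)
          show "\<bar>m j s\<bar> \<le> b" using weight_bounds[OF m[of j] s'] \<open>0 < a\<close> by auto
        qed (use N[OF j s'] b in auto)
        finally show "norm (m j s * f j s - m j s * g s) \<le> b * d" .
      qed (use i in \<open>auto intro: integrable_diff\<close>)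
      also have "\<dots> = b * d * x" using x by simp
      also have "\<dots> \<le> b * d * (l + 1)" using x b d by (intro mult_left_mono) auto
      also have "\<dots> = e / 2"
      proof -
        have "b * (e / (2 * b * L)) * L = e / 2" if "L \<noteq> 0" for L using that b by simp
        from this[of "l + 1"] show ?thesis using l by (simp add: d_def)
      qed
      also have "\<dots> < e" using \<open>e > 0\<close> by simp
      finally show "norm (integral {0..x} (\<lambda>s. m j s * f j s) - integral {0..x} (\<lambda>s. m j s * g s) - 0) < e"
        using i by (simp add: HK_integral_diff)
    qed
  qed
  from tendsto_add[OF A B] show ?thesis by simp
qed

lemma uniform_limit_primitive:
  assumes "l > 0" and p: "\<And>j. primitive_on l (u j) (w j)" and u0: "\<And>j. u j 0 = 0"
    and wc: "\<And>j. continuous_on {0..l} (w j)" and w: "uniform_limit {0..l} w w0 sequentially"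
  shows "primitive_on l (\<lambda>x. integral {0..x} w0) w0"
    "uniform_limit {0..l} u (\<lambda>x. integral {0..x} w0) sequentially"
proof -
  have w0c: "continuous_on {0..l} w0"
    by (rule uniform_limit_theorem[OF _ w]) (use wc in auto)
  show pu: "primitive_on l (\<lambda>x. integral {0..x} w0) w0"
    using absolutely_integrable_continuous_real[OF w0c] by (intro primitive_onI) auto
  show "uniform_limit {0..l} u (\<lambda>x. integral {0..x} w0) sequentially"
  proof (rule uniform_limitI)
    fix e :: real assume "e > 0"
    then have "\<forall>\<^sub>F j in sequentially. \<forall>x\<in>{0..l}. dist (w j x) (w0 x) < e / (2 * l)"
      using \<open>l > 0\<close> by (intro uniform_limitD[OF w]) simp
    then show "\<forall>\<^sub>F j in sequentially. \<forall>x\<in>{0..l}. dist (u j x) (integral {0..x} w0) < e"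
    proof (eventually_elim, intro ballI)
      fix j x assume *: "\<forall>x\<in>{0..l}. dist (w j x) (w0 x) < e / (2 * l)" and x: "x \<in> {0..l}"
      have "primitive_on l (\<lambda>x. u j x - integral {0..x} w0) (\<lambda>x. w j x - w0 x)"
        using p pu by (rule primitive_diff)
      from primitive_abs_diff_le[OF this, of 0 x "e / (2 * l)"] x *
      have "\<bar>u j x - integral {0..x} w0 - (u j 0 - integral {0..0} w0)\<bar> \<le> e / (2 * l) * x"
        by (auto simp: dist_real_def less_imp_le)
      also have "\<dots> \<le> e / (2 * l) * l" using x \<open>e > 0\<close> \<open>l > 0\<close> by (intro mult_left_mono) auto
      also have "\<dots> < e" using \<open>e > 0\<close> \<open>l > 0\<close> by simp
      finally show "dist (u j x) (integral {0..x} w0) < e"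
        using u0 by (simp add: dist_real_def)
    qed
  qed
qed

lemma solves_limit:
  assumes wt: "\<And>j. weight a b l (m j)" "\<And>j. weight a b l (n j)" "weight a b l m0" "weight a b l n0" "0 < a" "l > 0"
    and ws: "weak_star_Linfty l m m0 sequentially" "weak_star_Linfty l n n0 sequentially"
    and \<alpha>: "\<alpha> \<longlonglongrightarrow> \<alpha>0" and \<beta>: "\<beta> \<longlonglongrightarrow> \<beta>0"
    and s: "\<And>j. solves l (m j) (n j) (\<alpha> j) (\<beta> j) (u j) (w j)"
    and w: "uniform_limit {0..l} w w0 sequentially"
  obtains u0 where "solves l m0 n0 \<alpha>0 \<beta>0 u0 w0" "uniform_limit {0..l} u u0 sequentially"
proof
  have wc: "continuous_on {0..l} (w j)" and uc: "continuous_on {0..l} (u j)" for j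
    using solves_continuous[OF s] by auto
  define u0 where "u0 = (\<lambda>x. integral {0..x} w0)"
  have u00: "u0 0 = 0" by (simp add: u0_def)
  have p: "primitive_on l (u j) (w j)" "u j 0 = 0" for j using s by (auto simp: solves_def)
  have pu: "primitive_on l u0 w0" and ul: "uniform_limit {0..l} u u0 sequentially"
    unfolding u0_def by (rule uniform_limit_primitive[OF \<open>l > 0\<close> p wc w])+
  show "uniform_limit {0..l} u u0 sequentially" by (rule ul)
  have u0c: "continuous_on {0..l} u0" using pu by (rule primitive_continuous)
  \<comment> \<open>Positive and negative parts are 1-Lipschitz, so they inherit uniform
    convergence.\<close>
  have up: "uniform_limit {0..l} (\<lambda>j x. max 0 (u j x)) (\<lambda>x. max 0 (u0 x)) sequentially"
    and un: "uniform_limit {0..l} (\<lambda>j x. max 0 (- u j x)) (\<lambda>x. max 0 (- u0 x)) sequentially"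
  proof -
    have d: "dist (max 0 p) (max 0 q) \<le> dist p q" "dist (max 0 (- p)) (max 0 (- q)) \<le> dist p q" for p q :: real
      by (auto simp: dist_real_def)
    show "uniform_limit {0..l} (\<lambda>j x. max 0 (u j x)) (\<lambda>x. max 0 (u0 x)) sequentially"
      by (rule uniform_limitI, rule eventually_mono[OF uniform_limitD[OF ul]]) (use d(1) le_less_trans in blast)+
    show "uniform_limit {0..l} (\<lambda>j x. max 0 (- u j x)) (\<lambda>x. max 0 (- u0 x)) sequentially"
      by (rule uniform_limitI, rule eventually_mono[OF uniform_limitD[OF ul]]) (use d(2) le_less_trans in blast)+
  qed
  \<comment> \<open>Separating the two parts takes the converging parameters out of the integrals
    and leaves products of a weight and a uniformly convergent factor.\<close>
  have rhs_int: "integral {0..x} (\<lambda>s. - fucik_rhs r q A B v s) =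
      B * integral {0..x} (\<lambda>s. q s * max 0 (- v s)) - A * integral {0..x} (\<lambda>s. r s * max 0 (v s))"
    if "weight a b l r" "weight a b l q" "continuous_on {0..l} v" "x \<in> {0..l}" for r q A B v x
  proof -
    have "(\<lambda>s. q s * max 0 (- v s)) integrable_on {0..x}" "(\<lambda>s. r s * max 0 (v s)) integrable_on {0..x}"
      using that by (auto intro!: int_sub[where l=l] weight_mult_abs_int[of a b l] continuous_on_max continuous_on_const continuous_on_minus)
    then have "((\<lambda>s. B * (q s * max 0 (- v s)) - A * (r s * max 0 (v s))) has_integral
      B * integral {0..x} (\<lambda>s. q s * max 0 (- v s)) - A * integral {0..x} (\<lambda>s. r s * max 0 (v s))) {0..x}"
      by (intro has_integral_diff has_integral_mult_right integrable_integral)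
    moreover have "(\<lambda>s. - fucik_rhs r q A B v s) = (\<lambda>s. B * (q s * max 0 (- v s)) - A * (r s * max 0 (v s)))"
      by (auto simp: fucik_rhs_def)
    ultimately show ?thesis by (simp add: integral_unique)
  qed
  show "solves l m0 n0 \<alpha>0 \<beta>0 u0 w0"
    unfolding solves_def
  proof (intro conjI pu u00 primitive_onI)
    have ab: "a \<le> b" using weight_bounds[OF wt(3), of 0] \<open>l > 0\<close> by auto
    show "(\<lambda>x. - fucik_rhs m0 n0 \<alpha>0 \<beta>0 u0 x) absolutely_integrable_on {0..l}"
      using L2_abs_int[OF L2_cmult[OF fucik_rhs_L2[OF wt(3,4,5) ab u0c], of "-1"]] by simp
    fix x assume x: "x \<in> {0..l}"
    have eq: "w j x = w j 0 + integral {0..x} (\<lambda>s. - fucik_rhs (m j) (n j) (\<alpha> j) (\<beta> j) (u j) s)" for j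
      using s[of j] x by (auto simp: solves_def primitive_on_def)
    have lim: "(\<lambda>j. w j y) \<longlonglongrightarrow> w0 y" if "y \<in> {0..l}" for y
      using tendsto_uniform_limitI[OF w that] .
    have "(\<lambda>j. w j 0 + integral {0..x} (\<lambda>s. - fucik_rhs (m j) (n j) (\<alpha> j) (\<beta> j) (u j) s))
        \<longlonglongrightarrow> w0 0 + integral {0..x} (\<lambda>s. - fucik_rhs m0 n0 \<alpha>0 \<beta>0 u0 s)"
      unfolding rhs_int[OF wt(1,2) uc x] rhs_int[OF wt(3,4) u0c x]
      by (intro tendsto_intros lim \<alpha> \<beta> weak_star_uniform[OF wt(2,4,5) ws(2) _ un x]
          weak_star_uniform[OF wt(1,3,5) ws(1) _ up x] continuous_on_max continuous_on_const continuous_on_minus uc)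
        (use \<open>l > 0\<close> in auto)
    then show "w0 x = w0 0 + integral {0..x} (\<lambda>s. - fucik_rhs m0 n0 \<alpha>0 \<beta>0 u0 s)"
      using LIMSEQ_unique[OF lim[OF x]] eq by simp
  qed
qed

lemma weak_star_subseq:
  assumes "weak_star_Linfty l m m0 sequentially" "strict_mono r"
  shows "weak_star_Linfty l (\<lambda>j. m (r j)) m0 sequentially"
  using assms(1) unfolding weak_star_Linfty_def
  by (auto dest: filterlim_compose[OF _ filterlim_subseq[OF assms(2)]])

lemma solves_compact:
  assumes wt: "\<And>j. weight a b l (m j)" "\<And>j. weight a b l (n j)" "weight a b l m0" "weight a b l n0" "0 < a" "l > 0"
    and ws: "weak_star_Linfty l m m0 sequentially" "weak_star_Linfty l n n0 sequentially"
    and \<alpha>: "\<alpha> \<longlonglongrightarrow> \<alpha>0" and \<beta>: "\<beta> \<longlonglongrightarrow> \<beta>0"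
    and s: "\<And>j. solves l (m j) (n j) (\<alpha> j) (\<beta> j) (u j) (w j)"
    and w1: "\<And>j x. x \<in> {0..l} \<Longrightarrow> \<bar>w j x\<bar> \<le> 1" and w2: "\<And>j. \<exists>x\<in>{0..l}. \<bar>w j x\<bar> = 1"
  obtains r u0 w0 where "strict_mono r" "solves l m0 n0 \<alpha>0 \<beta>0 u0 w0" "w0 0 \<noteq> 0"
    "uniform_limit {0..l} (\<lambda>j. u (r j)) u0 sequentially" "uniform_limit {0..l} (\<lambda>j. w (r j)) w0 sequentially"
proof -
  have b: "b > 0" using weight_bounds[OF wt(3), of 0] wt(5,6) by auto
  obtain A where A: "\<And>j. \<bar>\<alpha> j\<bar> \<le> A" using \<alpha> convergent_imp_Bseq[of \<alpha>] by (auto simp: convergent_def Bseq_def)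
  obtain B where B: "\<And>j. \<bar>\<beta> j\<bar> \<le> B" using \<beta> convergent_imp_Bseq[of \<beta>] by (auto simp: convergent_def Bseq_def)
  \<comment> \<open>A common Lipschitz constant of the slopes: u 0 = 0 and \<bar>w\<bar> \<le> 1
    give \<bar>u\<bar> \<le> l, so the right-hand side is at most (A + B) b l.\<close>
  define K where "K = (A + B) * b * l"
  have K: "K \<ge> 0" using A[of 0] B[of 0] b wt(6) by (auto simp: K_def)
  have lip: "\<bar>w j y - w j x\<bar> \<le> K * \<bar>y - x\<bar>" if x: "x \<in> {0..l}" and y: "y \<in> {0..l}" for j x y
  proof (rule primitive_lipschitz[OF _ x y])
    show "primitive_on l (w j) (\<lambda>x. - fucik_rhs (m j) (n j) (\<alpha> j) (\<beta> j) (u j) x)"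
      using s by (auto simp: solves_def)
    fix t assume t: "t \<in> {0..l}"
    have "\<bar>u j t - u j 0\<bar> \<le> 1 * (t - 0)"
      by (rule primitive_abs_diff_le[of l _ "w j"]) (use s t w1 in \<open>auto simp: solves_def\<close>)
    then have ul: "\<bar>u j t\<bar> \<le> l" using s[of j] t by (auto simp: solves_def)
    have "\<bar>fucik_rhs (m j) (n j) (\<alpha> j) (\<beta> j) (u j) t\<bar> \<le> (\<bar>\<alpha> j\<bar> + \<bar>\<beta> j\<bar>) * b * \<bar>u j t\<bar>"
      by (rule fucik_rhs_weight_bound[OF wt(1,2,5) t])
    also have "\<dots> \<le> (A + B) * b * l"
      using A[of j] B[of j] ul b by (intro mult_mono add_mono) auto
    finally show "\<bar>- fucik_rhs (m j) (n j) (\<alpha> j) (\<beta> j) (u j) t\<bar> \<le> K" by (simp add: K_def)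
  qed
  obtain w0 r where r: "strict_mono (r :: nat \<Rightarrow> nat)"
    and lim: "\<And>e. 0 < e \<Longrightarrow> \<exists>N. \<forall>j x. j \<ge> N \<and> x \<in> {0..l} \<longrightarrow> norm (w (r j) x - w0 x) < e"
  proof (rule Arzela_Ascoli[of "{0..l}" w 1])
    show "compact {0..l}" by simp
    show "norm (w j x) \<le> 1" if "x \<in> {0..l}" for j x using w1[OF that] by simp
    show "\<exists>d>0. \<forall>j y. y \<in> {0..l} \<and> norm (x - y) < d \<longrightarrow> norm (w j x - w j y) < e"
      if x: "x \<in> {0..l}" and e: "0 < e" for x e
    proof (intro exI[of _ "e / (K + 1)"] conjI allI impI)
      show "0 < e / (K + 1)" using e K by simp
      fix j y assume y: "y \<in> {0..l} \<and> norm (x - y) < e / (K + 1)"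
      have "\<bar>w j x - w j y\<bar> \<le> K * \<bar>x - y\<bar>" using lip[OF _ x] y by blast
      also have "\<dots> \<le> (K + 1) * \<bar>x - y\<bar>" by (simp add: distrib_right)
      also have "\<dots> < (K + 1) * (e / (K + 1))"
        using y K by (intro mult_strict_left_mono) auto
      also have "\<dots> = e" using K by simp
      finally show "norm (w j x - w j y) < e" by simp
    qed
  qed blast
  have wl: "uniform_limit {0..l} (\<lambda>j. w (r j)) w0 sequentially"
  proof (rule uniform_limitI)
    fix e :: real assume "e > 0"
    then show "\<forall>\<^sub>F j in sequentially. \<forall>x\<in>{0..l}. dist (w (r j) x) (w0 x) < e"
      using lim[of e] unfolding eventually_sequentially dist_norm by blast
  qed
  obtain u0 where u0: "solves l m0 n0 \<alpha>0 \<beta>0 u0 w0" "uniform_limit {0..l} (\<lambda>j. u (r j)) u0 sequentially"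
    by (rule solves_limit[OF wt(1) wt(2) wt(3-6) weak_star_subseq[OF ws(1) r] weak_star_subseq[OF ws(2) r]
        LIMSEQ_subseq_LIMSEQ[OF \<alpha> r, unfolded o_def] LIMSEQ_subseq_LIMSEQ[OF \<beta> r, unfolded o_def] s wl])
  \<comment> \<open>Each slope reaches modulus 1 somewhere, which uniform convergence to 0 would
    forbid.\<close>
  have "\<exists>x\<in>{0..l}. w0 x \<noteq> 0"
  proof (rule ccontr)
    assume "\<not> ?thesis"
    then have z: "\<And>x. x \<in> {0..l} \<Longrightarrow> w0 x = 0" by auto
    obtain N where "\<And>x. x \<in> {0..l} \<Longrightarrow> norm (w (r N) x - w0 x) < 1"
      using lim[of 1] by auto
    then show False using w2[of "r N"] z by fastforce
  qed
  then have "w0 0 \<noteq> 0" using solves_nontrivial_iff(2)[OF wt(3-6) u0(1)] by simp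
  with that r u0 wl show ?thesis by blast
qed

section \<open>Stability of simple zeros under C1 convergence\<close>

lemma within_MVT:
  assumes "\<And>x. x \<in> {0..l} \<Longrightarrow> (u has_real_derivative w x) (at x within {0..l})"
    and "0 \<le> x" "x < y" "y \<le> l"
  obtains \<xi> where "x < \<xi>" "\<xi> < y" "u y - u x = w \<xi> * (y - x)"
proof -
  have "\<exists>\<xi>\<in>{x<..<y}. u y - u x = (\<lambda>h. w \<xi> * h) (y - x)"
  proof (rule mvt_simple[OF \<open>x < y\<close>])
    fix \<xi> assume "x \<le> \<xi>" "\<xi> \<le> y"
    then have "(u has_real_derivative w \<xi>) (at \<xi> within {x..y})"
      using assms by (intro DERIV_subset[OF assms(1)]) auto
    then show "(u has_derivative (\<lambda>h. w \<xi> * h)) (at \<xi> within {x..y})"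
      by (simp add: has_field_derivative_def)
  qed
  then show ?thesis using that by auto
qed

text \<open>Send each point of A to a point of B closer than \<rho> / 3. Two points with the same
  image would be closer than 2 \<rho> / 3, so the map is injective by separation of A; for the same
  reason it is onto by separation of B.\<close>

lemma card_eq_of_close_separated:
  fixes A B :: "real set"
  assumes "finite A" and A: "\<And>x y. x \<in> A \<Longrightarrow> y \<in> A \<Longrightarrow> x \<noteq> y \<Longrightarrow> \<rho> \<le> \<bar>x - y\<bar>"
    and B: "\<And>x y. x \<in> B \<Longrightarrow> y \<in> B \<Longrightarrow> x \<noteq> y \<Longrightarrow> \<rho> \<le> \<bar>x - y\<bar>"
    and AB: "\<And>x. x \<in> A \<Longrightarrow> \<exists>y\<in>B. \<bar>x - y\<bar> < \<rho> / 3" and BA: "\<And>y. y \<in> B \<Longrightarrow> \<exists>x\<in>A. \<bar>x - y\<bar> < \<rho> / 3"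
  shows "finite B" "card B = card A"
proof -
  obtain f where f: "\<And>x. x \<in> A \<Longrightarrow> f x \<in> B \<and> \<bar>x - f x\<bar> < \<rho> / 3" using AB by metis
  have "inj_on f A"
  proof (rule inj_onI, rule ccontr)
    fix x y assume xy: "x \<in> A" "y \<in> A" "f x = f y" "x \<noteq> y"
    then have "\<bar>x - f x\<bar> < \<rho> / 3" "\<bar>y - f x\<bar> < \<rho> / 3" "\<rho> \<le> \<bar>x - y\<bar>"
      using f[of x] f[of y] A[of x y] by auto
    then show False by linarith
  qed
  moreover have "f ` A = B"
  proof
    show "B \<subseteq> f ` A"
    proof
      fix y assume y: "y \<in> B"
      then obtain x where x: "x \<in> A" "\<bar>x - y\<bar> < \<rho> / 3" using BA by blast
      then have "\<not> \<rho> \<le> \<bar>f x - y\<bar>" using f[of x] by linarith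
      then have "f x = y" using f[of x] B[of "f x" y] y x(1) by blast
      then show "y \<in> f ` A" using x by blast
    qed
  qed (use f in auto)
  ultimately show "finite B" "card B = card A"
    using \<open>finite A\<close> card_image by auto
qed

lemma finite_separated:
  fixes S :: "real set"
  assumes "S \<subseteq> {0..l}" "\<rho> > 0" "\<And>x y. x \<in> S \<Longrightarrow> y \<in> S \<Longrightarrow> x \<noteq> y \<Longrightarrow> \<rho> \<le> \<bar>x - y\<bar>"
  shows "finite S"
proof (rule ccontr)
  assume "infinite S"
  then obtain x where "x islimpt S"
    using Heine_Borel_imp_Bolzano_Weierstrass[OF compact_Icc _ assms(1)] by blast
  then have "infinite (S \<inter> ball x (\<rho>/2))" using \<open>\<rho> > 0\<close> by (simp add: islimpt_eq_infinite_ball)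
  then obtain y z where "y \<in> S \<inter> ball x (\<rho>/2)" "z \<in> S \<inter> ball x (\<rho>/2)" "y \<noteq> z"
    by (metis finite.emptyI finite_insert finite_subset insertI1 subsetI)
  then have "\<bar>x - y\<bar> < \<rho> / 2" "\<bar>x - z\<bar> < \<rho> / 2" "\<rho> \<le> \<bar>y - z\<bar>"
    using assms(3)[of y z] by (auto simp: dist_real_def)
  then show False by linarith
qed

text \<open>Zeros of \<open>C\<^sup>1\<close>-convergent functions stay uniformly separated when the limit has no double zero,
  because two close zeros enclose a zero of the derivative.\<close>

lemma zeros_separated:
  assumes "l > 0"
    and D: "\<And>j x. x \<in> {0..l} \<Longrightarrow> (u j has_real_derivative w j x) (at x within {0..l})"
    and c: "continuous_on {0..l} u0" "continuous_on {0..l} w0"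
    and ul: "uniform_limit {0..l} u u0 sequentially" and wl: "uniform_limit {0..l} w w0 sequentially"
    and simple: "\<And>x. x \<in> {0..l} \<Longrightarrow> u0 x = 0 \<Longrightarrow> w0 x \<noteq> 0"
  obtains \<rho> where "\<rho> > 0" "\<forall>\<^sub>F j in sequentially. \<forall>x\<in>{0..l}. \<forall>y\<in>{0..l}. u j x = 0 \<longrightarrow> u j y = 0 \<longrightarrow> x \<noteq> y \<longrightarrow> \<rho> \<le> \<bar>x - y\<bar>"
proof -
  have "continuous_on {0..l} (\<lambda>x. \<bar>u0 x\<bar> + \<bar>w0 x\<bar>)" using c by (intro continuous_intros)
  then obtain q where q: "q \<in> {0..l}" "\<And>x. x \<in> {0..l} \<Longrightarrow> \<bar>u0 q\<bar> + \<bar>w0 q\<bar> \<le> \<bar>u0 x\<bar> + \<bar>w0 x\<bar>"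
    using continuous_attains_inf[of "{0..l}" "\<lambda>x. \<bar>u0 x\<bar> + \<bar>w0 x\<bar>"] \<open>l > 0\<close> by auto
  \<comment> \<open>A quarter of the minimum of \<bar>u0\<bar> + \<bar>w0\<bar>. Two close zeros of
    u j would bring this sum below 3 \<eta> at one of them: one error from u j, one from w j, one
    from moving x to \<xi>.\<close>
  define \<eta> where "\<eta> = (\<bar>u0 q\<bar> + \<bar>w0 q\<bar>) / 4"
  have \<eta>: "\<eta> > 0" using simple[OF q(1)] by (cases "u0 q = 0") (auto simp: \<eta>_def add_pos_nonneg)
  have "uniformly_continuous_on {0..l} w0" using c(2) by (rule compact_uniformly_continuous) simp
  then obtain \<rho> where \<rho>: "\<rho> > 0" "\<And>x y. x \<in> {0..l} \<Longrightarrow> y \<in> {0..l} \<Longrightarrow> dist y x < \<rho> \<Longrightarrow> dist (w0 y) (w0 x) < \<eta>"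
    using \<eta> unfolding uniformly_continuous_on_def by metis
  have "\<forall>\<^sub>F j in sequentially. \<forall>x\<in>{0..l}. \<forall>y\<in>{0..l}. u j x = 0 \<longrightarrow> u j y = 0 \<longrightarrow> x \<noteq> y \<longrightarrow> \<rho> \<le> \<bar>x - y\<bar>"
    using uniform_limitD[OF ul \<eta>] uniform_limitD[OF wl \<eta>]
  proof eventually_elim
    case (elim j)
    have *: False if xy: "0 \<le> x" "x < y" "y \<le> l" "u j x = 0" "u j y = 0" "y - x < \<rho>" for x y
    proof -
      obtain \<xi> where \<xi>: "x < \<xi>" "\<xi> < y" "u j y - u j x = w j \<xi> * (y - x)"
        using within_MVT[of l "u j" "w j", OF D xy(1-3)] by blast
      then have "w j \<xi> = 0" using xy by auto
      moreover have "dist (w j \<xi>) (w0 \<xi>) < \<eta>"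
        using elim(2) \<xi>(1,2) xy(1,3) by (auto dest!: bspec[of _ _ \<xi>])
      moreover have "dist (w0 x) (w0 \<xi>) < \<eta>" using \<rho>(2)[of \<xi> x] \<xi> xy by (auto simp: dist_real_def)
      moreover have "dist (u j x) (u0 x) < \<eta>" using elim(1) xy(1-3) by (auto dest!: bspec[of _ _ x])
      ultimately have "\<bar>u0 x\<bar> + \<bar>w0 x\<bar> < 3 * \<eta>" using xy(4) by (auto simp: dist_real_def)
      moreover have "4 * \<eta> \<le> \<bar>u0 x\<bar> + \<bar>w0 x\<bar>" using q(2)[of x] xy by (simp add: \<eta>_def)
      ultimately show False using \<eta> by linarith
    qed
    show ?case
    proof (intro ballI impI, rule ccontr)
      fix x y assume "x \<in> {0..l}" "y \<in> {0..l}" "u j x = 0" "u j y = 0" "x \<noteq> y" "\<not> \<rho> \<le> \<bar>x - y\<bar>"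
      then show False using *[of x y] *[of y x] by (cases "x < y") auto
    qed
  qed
  with \<rho>(1) show ?thesis using that by blast
qed

text \<open>At a simple zero u0 changes sign, which is an open condition on two values; the
  intermediate value theorem then gives a zero of u j between them.\<close>

lemma simple_zero_persists:
  assumes D: "(u0 has_real_derivative d) (at z within {0..l})" "d \<noteq> 0" "u0 z = 0" "z \<in> {0<..<l}"
    and ul: "uniform_limit {0..l} u u0 sequentially" and uc: "\<And>j. continuous_on {0..l} (u j)" and "\<rho> > 0"
  shows "\<forall>\<^sub>F j in sequentially. \<exists>y\<in>{0..l}. u j y = 0 \<and> \<bar>z - y\<bar> < \<rho>"
proof -
  have "z \<in> interior {0..l}" using assms(4) by simp
  then have D': "(u0 has_real_derivative d) (at z)" using D(1) by (metis at_within_interior)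
  obtain \<delta> where \<delta>: "\<delta> > 0" "\<And>h. 0 < h \<Longrightarrow> h < \<delta> \<Longrightarrow> u0 (z - h) * u0 (z + h) < 0"
  proof (cases "d > 0")
    case True
    from DERIV_pos_inc_right[OF D' True] DERIV_pos_inc_left[OF D' True] obtain d1 d2 where
      "d1 > 0" "\<forall>h>0. h < d1 \<longrightarrow> u0 z < u0 (z + h)" "d2 > 0" "\<forall>h>0. h < d2 \<longrightarrow> u0 (z - h) < u0 z" by blast
    then show ?thesis using that[of "min d1 d2"] assms(3) by (auto simp: mult_less_0_iff)
  next
    case False
    then have "d < 0" using assms(2) by auto
    from DERIV_neg_dec_right[OF D' this] DERIV_neg_dec_left[OF D' this] obtain d1 d2 where
      "d1 > 0" "\<forall>h>0. h < d1 \<longrightarrow> u0 z > u0 (z + h)" "d2 > 0" "\<forall>h>0. h < d2 \<longrightarrow> u0 (z - h) > u0 z" by blast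
    then show ?thesis using that[of "min d1 d2"] assms(3) by (auto simp: mult_less_0_iff)
  qed
  \<comment> \<open>Small enough for the sign change, for the distance \<rho>, and for both points
    to stay inside [0, l].\<close>
  define h where "h = min (min (\<delta> / 2) (\<rho> / 2)) (min (z / 2) ((l - z) / 2))"
  have h: "0 < h" "h < \<delta>" "h < \<rho>" "0 \<le> z - h" "z + h \<le> l"
    using \<delta>(1) assms(4) \<open>\<rho> > 0\<close> by (auto simp: h_def min_def field_simps)
  have "(\<lambda>j. u j (z - h) * u j (z + h)) \<longlonglongrightarrow> u0 (z - h) * u0 (z + h)"
    using h by (intro tendsto_mult tendsto_uniform_limitI[OF ul]) auto
  then have "\<forall>\<^sub>F j in sequentially. u j (z - h) * u j (z + h) < 0"
    using \<delta>(2)[OF h(1,2)] by (rule order_tendstoD)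
  then show ?thesis
  proof eventually_elim
    case (elim j)
    have cc: "continuous_on {z - h..z + h} (u j)"
      using h by (intro continuous_on_subset[OF uc]) auto
    have "\<exists>y. z - h \<le> y \<and> y \<le> z + h \<and> u j y = 0"
    proof (cases "u j (z - h) < 0")
      case True
      then have "u j (z + h) > 0" using elim by (auto simp: mult_less_0_iff)
      then show ?thesis using IVT'[of "u j" "z - h" 0 "z + h"] True cc h by auto
    next
      case False
      then have "u j (z - h) > 0" "u j (z + h) < 0" using elim by (auto simp: mult_less_0_iff)
      then show ?thesis using IVT2'[of "u j" "z + h" 0 "z - h"] cc h by auto
    qed
    then obtain y where y: "z - h \<le> y" "y \<le> z + h" "u j y = 0" by blast
    then have "\<bar>z - y\<bar> < \<rho>" "y \<in> {0..l}" using h by auto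
    then show ?case using y(3) by blast
  qed
qed

text \<open>Zeros are counted on the closed interval. The end points are common zeros of all u j, so
  separation also prevents interior zeros from merging into the boundary or emerging from
  it.\<close>

lemma zeros_stable:
  assumes "l > 0"
    and D: "\<And>j x. x \<in> {0..l} \<Longrightarrow> (u j has_real_derivative w j x) (at x within {0..l})"
    and D0: "\<And>x. x \<in> {0..l} \<Longrightarrow> (u0 has_real_derivative w0 x) (at x within {0..l})"
    and c: "continuous_on {0..l} w0"
    and ul: "uniform_limit {0..l} u u0 sequentially" and wl: "uniform_limit {0..l} w w0 sequentially"
    and simple: "\<And>x. x \<in> {0..l} \<Longrightarrow> u0 x = 0 \<Longrightarrow> w0 x \<noteq> 0"
    and bc: "\<And>j. u j 0 = 0" "\<And>j. u j l = 0"
  shows "finite {x\<in>{0..l}. u0 x = 0}"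
    "\<forall>\<^sub>F j in sequentially. finite {x\<in>{0..l}. u j x = 0} \<and> card {x\<in>{0..l}. u j x = 0} = card {x\<in>{0..l}. u0 x = 0}"
proof -
  have uc: "continuous_on {0..l} (u j)" for j using D DERIV_continuous_on by blast
  have u0c: "continuous_on {0..l} u0" using D0 DERIV_continuous_on by blast
  define Z where "Z = {x\<in>{0..l}. u0 x = 0}"
  obtain \<rho>1 where \<rho>1: "\<rho>1 > 0" "\<forall>\<^sub>F j in sequentially. \<forall>x\<in>{0..l}. \<forall>y\<in>{0..l}. u j x = 0 \<longrightarrow> u j y = 0 \<longrightarrow> x \<noteq> y \<longrightarrow> \<rho>1 \<le> \<bar>x - y\<bar>"
    by (rule zeros_separated[OF \<open>l > 0\<close> D u0c c ul wl simple])
  obtain \<rho>2 where \<rho>2: "\<rho>2 > 0" "\<forall>\<^sub>F j::nat in sequentially. \<forall>x\<in>{0..l}. \<forall>y\<in>{0..l}. u0 x = 0 \<longrightarrow> u0 y = 0 \<longrightarrow> x \<noteq> y \<longrightarrow> \<rho>2 \<le> \<bar>x - y\<bar>"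
    by (rule zeros_separated[OF \<open>l > 0\<close> D0 u0c c uniform_limit_const uniform_limit_const simple])
  define \<rho> where "\<rho> = min \<rho>1 \<rho>2"
  have \<rho>: "\<rho> > 0" using \<rho>1 \<rho>2 by (simp add: \<rho>_def)
  have sepZ: "\<rho> \<le> \<bar>x - y\<bar>" if "x \<in> Z" "y \<in> Z" "x \<noteq> y" for x y
    using \<rho>2(2) that by (fastforce simp: Z_def \<rho>_def)
  show fZ: "finite {x\<in>{0..l}. u0 x = 0}"
    unfolding Z_def[symmetric] by (rule finite_separated[of _ l \<rho>]) (use \<rho> sepZ in \<open>auto simp: Z_def\<close>)
  have lim: "(\<lambda>j. u j x) \<longlonglongrightarrow> u0 x" if "x \<in> {0..l}" for x
    using tendsto_uniform_limitI[OF ul that] .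
  have AB: "\<forall>\<^sub>F j in sequentially. \<forall>z\<in>Z. \<exists>y\<in>{0..l}. u j y = 0 \<and> \<bar>z - y\<bar> < \<rho> / 3"
  proof (rule eventually_ball_finite)
    show "finite Z" using fZ by (simp add: Z_def)
    show "\<forall>z\<in>Z. \<forall>\<^sub>F j in sequentially. \<exists>y\<in>{0..l}. u j y = 0 \<and> \<bar>z - y\<bar> < \<rho> / 3"
    proof
      fix z assume z: "z \<in> Z"
      show "\<forall>\<^sub>F j in sequentially. \<exists>y\<in>{0..l}. u j y = 0 \<and> \<bar>z - y\<bar> < \<rho> / 3"
      proof (cases "z \<in> {0<..<l}")
        case True
        show ?thesis
          by (rule simple_zero_persists[OF D0 simple _ True ul uc]) (use z True \<rho> in \<open>auto simp: Z_def\<close>)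
      next
        case False
        then have "z = 0 \<or> z = l" using z by (auto simp: Z_def)
        then show ?thesis using bc \<rho> \<open>l > 0\<close> by (intro always_eventually allI bexI[of _ z]) auto
      qed
    qed
  qed
  have BA: "\<forall>\<^sub>F j in sequentially. \<forall>y\<in>{0..l}. u j y = 0 \<longrightarrow> (\<exists>z\<in>Z. \<bar>z - y\<bar> < \<rho> / 3)"
  proof -
    \<comment> \<open>Away from the zeros \<bar>u0\<bar> has a positive minimum, so a late u j
      cannot vanish there.\<close>
    define K where "K = {0..l} - (\<Union>z\<in>Z. ball z (\<rho> / 3))"
    have "compact K" unfolding K_def by (intro compact_diff) auto
    have "continuous_on K (\<lambda>x. \<bar>u0 x\<bar>)"
      using continuous_on_subset[OF u0c, of K] by (intro continuous_intros) (auto simp: K_def)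
    obtain \<eta> where \<eta>: "\<eta> > 0" "\<And>x. x \<in> K \<Longrightarrow> \<eta> \<le> \<bar>u0 x\<bar>"
    proof (cases "K = {}")
      case False
      obtain q where q: "q \<in> K" "\<And>x. x \<in> K \<Longrightarrow> \<bar>u0 q\<bar> \<le> \<bar>u0 x\<bar>"
        using continuous_attains_inf[OF \<open>compact K\<close> False \<open>continuous_on K (\<lambda>x. \<bar>u0 x\<bar>)\<close>] by blast
      have "q \<notin> Z" using q(1) \<rho> by (auto simp: K_def)
      then have "\<bar>u0 q\<bar> > 0" using q(1) by (auto simp: K_def Z_def)
      then show ?thesis using that q by blast
    qed (use that[of 1] in auto)
    show ?thesis
      using uniform_limitD[OF ul \<eta>(1)]
    proof eventually_elim
      case (elim j)
      show ?case
      proof (intro ballI impI, rule ccontr)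
        fix y assume y: "y \<in> {0..l}" "u j y = 0" "\<not> (\<exists>z\<in>Z. \<bar>z - y\<bar> < \<rho> / 3)"
        then have "y \<in> K" by (auto simp: K_def dist_real_def)
        moreover have "\<bar>u j y - u0 y\<bar> < \<eta>" using elim y(1) by (auto simp: dist_real_def)
        ultimately show False using \<eta>(2)[of y] y(2) by simp
      qed
    qed
  qed
  show "\<forall>\<^sub>F j in sequentially. finite {x\<in>{0..l}. u j x = 0} \<and> card {x\<in>{0..l}. u j x = 0} = card {x\<in>{0..l}. u0 x = 0}"
    using \<rho>1(2) AB BA
  proof eventually_elim
    case (elim j)
    have 1: "\<rho> \<le> \<bar>x - y\<bar>" if "x \<in> {x\<in>{0..l}. u j x = 0}" "y \<in> {x\<in>{0..l}. u j x = 0}" "x \<noteq> y" for x y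
      using elim(1) that by (fastforce simp: \<rho>_def)
    have 2: "\<exists>y\<in>{x\<in>{0..l}. u j x = 0}. \<bar>x - y\<bar> < \<rho> / 3" if "x \<in> Z" for x
      using elim(2) that by blast
    have 3: "\<exists>x\<in>Z. \<bar>x - y\<bar> < \<rho> / 3" if "y \<in> {x\<in>{0..l}. u j x = 0}" for y
      using elim(3) that by blast
    show ?case
      using card_eq_of_close_separated[OF fZ[folded Z_def] sepZ 1 2 3] unfolding Z_def by blast
  qed
qed

text \<open>The summand 2 stands for the end points.\<close>

lemma exactly_zeros_iff:
  assumes "l > 0" "u 0 = 0" "u l = 0"
  shows "exactly_zeros l k u \<longleftrightarrow> finite {x\<in>{0..l}. u x = 0} \<and> card {x\<in>{0..l}. u x = 0} = k + 2"
proof -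
  have "{x\<in>{0..l}. u x = 0} = insert 0 (insert l {x\<in>{0<..<l}. u x = 0})"
    using assms by auto
  then show ?thesis
    using \<open>l > 0\<close> unfolding exactly_zeros_def by auto
qed

section \<open>Sturm comparison and the initial value problem\<close>

text \<open>The Lagrange identity for u'' = -h and v'' = -g; the products of the slopes cancel. Both
  comparison arguments below integrate it.\<close>

lemma wronskian_primitive:
  assumes u: "primitive_on l u w" "primitive_on l w (\<lambda>x. - h x)" and v: "primitive_on l v z" "primitive_on l z (\<lambda>x. - g x)"
    and b: "\<And>x. x \<in> {0..l} \<Longrightarrow> \<bar>h x\<bar> \<le> H" "\<And>x. x \<in> {0..l} \<Longrightarrow> \<bar>g x\<bar> \<le> G"
  shows "primitive_on l (\<lambda>x. w x * v x - u x * z x) (\<lambda>x. u x * g x - h x * v x)"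
proof -
  have 1: "primitive_on l (\<lambda>x. w x * v x) (\<lambda>x. w x * z x + - h x * v x)"
    by (rule primitive_mult[OF u(2) v(1), of H]) (use b in auto)
  have 2: "primitive_on l (\<lambda>x. z x * u x) (\<lambda>x. z x * w x + - g x * u x)"
    by (rule primitive_mult[OF v(2) u(1), of G]) (use b in auto)
  show ?thesis
    by (rule primitive_cong[OF primitive_diff[OF 1 2]]) (auto simp: algebra_simps)
qed

lemma nonneg_at_closure:
  fixes u :: "real \<Rightarrow> real"
  assumes "continuous_on {p..q} u" "p < q" "\<And>x. x \<in> {p<..<q} \<Longrightarrow> u x > 0" "x \<in> {p..q}"
  shows "u x \<ge> 0"
proof -
  have cl: "closure {p<..<q} = {p..q}" using \<open>p < q\<close> by simp
  show ?thesis
    by (rule continuous_ge_on_closure[of "{p<..<q}" u x 0]) (use assms cl in \<open>auto intro: less_imp_le\<close>)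
qed

text \<open>The comparison function is the positive sine vanishing at p and q, with frequency c = pi
  / (q - p). If \<alpha> a exceeded c^2, the derivative of the Wronskian would have negative
  integral, while its boundary terms give c (u p + u q) \<ge> 0.\<close>

lemma pos_interval_bound:
  assumes wt: "weight a b l m" "weight a b l n" "0 < a" and s: "solves l m n \<alpha> \<beta> u w"
    and pq: "0 \<le> p" "p < q" "q \<le> l" and pos: "\<And>x. x \<in> {p<..<q} \<Longrightarrow> u x > 0"
  shows "\<alpha> * a \<le> (pi / (q - p))\<^sup>2"
proof (rule ccontr)
  assume neg: "\<not> \<alpha> * a \<le> (pi / (q - p))\<^sup>2"
  define c where "c = pi / (q - p)"
  have c: "c > 0" "c * (q - p) = pi" using pq by (auto simp: c_def)
  have ac: "c\<^sup>2 < \<alpha> * a" using neg by (simp add: c_def)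
  then have \<alpha>: "\<alpha> > 0" using \<open>0 < a\<close> by (smt (verit) mult_nonpos_nonneg zero_le_power2)
  have ab: "a \<le> b" using weight_bounds[OF wt(1), of p] pq by auto
  note uc = solves_continuous[OF s]
  define v where "v = (\<lambda>x. sin (c * (x - p)))"
  define z where "z = (\<lambda>x. c * cos (c * (x - p)))"
  have vz: "primitive_on l v z"
    by (rule primitive_C1) (auto simp: v_def z_def intro!: derivative_eq_intros continuous_intros)
  have zz: "primitive_on l z (\<lambda>x. - (c\<^sup>2 * v x))"
    by (rule primitive_C1) (auto simp: v_def z_def power2_eq_square intro!: derivative_eq_intros continuous_intros)
  obtain H where H: "\<And>x. x \<in> {0..l} \<Longrightarrow> \<bar>fucik_rhs m n \<alpha> \<beta> u x\<bar> \<le> H"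
    using fucik_rhs_bounded[OF wt ab uc(1)] by blast
  have su: "primitive_on l u w" "primitive_on l w (\<lambda>x. - fucik_rhs m n \<alpha> \<beta> u x)"
    using s by (auto simp: solves_def)
  have "\<bar>c\<^sup>2 * v x\<bar> \<le> c\<^sup>2" for x by (simp add: v_def abs_mult mult_left_le)
  then have W: "primitive_on l (\<lambda>x. w x * v x - u x * z x) (\<lambda>x. u x * (c\<^sup>2 * v x) - fucik_rhs m n \<alpha> \<beta> u x * v x)"
    using wronskian_primitive[OF su vz zz H] by blast
  define k where "k = (\<lambda>x. u x * (c\<^sup>2 * v x) - fucik_rhs m n \<alpha> \<beta> u x * v x)"
  have uc': "continuous_on {p..q} u" using pq by (intro continuous_on_subset[OF uc(1)]) auto
  have u0: "u x \<ge> 0" if "x \<in> {p..q}" for x using nonneg_at_closure[OF uc' pq(2) pos that] by auto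
  have v0: "v x > 0" if "x \<in> {p<..<q}" for x
    unfolding v_def using that c mult_strict_left_mono[of "x - p" "q - p" c] by (intro sin_gt_zero) auto
  have vpq: "v p = 0" "v q = 0" "z p = c" "z q = - c"
    using c by (auto simp: v_def z_def)
  have "integral {p..q} k = u q * c + u p * c"
    using primitive_diff_eq[OF W, of p q] pq vpq by (simp add: k_def)
  then have ge: "integral {p..q} k \<ge> 0" using u0[of p] u0[of q] pq c by simp
  have cuv: "continuous_on {p..q} (\<lambda>x. u x * v x)"
    unfolding v_def by (intro continuous_intros uc')
  have I: "integral {p..q} (\<lambda>x. 0) < integral {p..q} (\<lambda>x. u x * v x)"
    by (rule integral_less_real) (use cuv pos v0 pq in auto)
  have "integral {p..q} k \<le> integral {p..q} (\<lambda>x. (c\<^sup>2 - \<alpha> * a) * (u x * v x))"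
  proof (rule integral_le)
    show "k integrable_on {p..q}" unfolding k_def using primitive_abs_int[OF W] pq by (intro int_sub) auto
    show "(\<lambda>x. (c\<^sup>2 - \<alpha> * a) * (u x * v x)) integrable_on {p..q}"
      using integrable_continuous_real[OF cuv] by (rule integrable_on_mult_right)
    fix x assume x: "x \<in> {p..q}"
    have vx: "v x \<ge> 0" using v0[of x] vpq x by (cases "x = p \<or> x = q") (auto intro: less_imp_le)
    have "fucik_rhs m n \<alpha> \<beta> u x = \<alpha> * m x * u x" using u0[OF x] by (simp add: fucik_rhs_def)
    then have "k x = (c\<^sup>2 - \<alpha> * m x) * (u x * v x)" by (simp add: k_def algebra_simps)
    also have "\<dots> \<le> (c\<^sup>2 - \<alpha> * a) * (u x * v x)"
      using weight_bounds[OF wt(1), of x] x pq \<alpha> u0[OF x] vx by (intro mult_right_mono) auto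
    finally show "k x \<le> (c\<^sup>2 - \<alpha> * a) * (u x * v x)" .
  qed
  also have "\<dots> = (c\<^sup>2 - \<alpha> * a) * integral {p..q} (\<lambda>x. u x * v x)" by simp
  also have "\<dots> < 0" using I ac by (simp add: mult_neg_pos)
  finally show False using ge by simp
qed

text \<open>p is the last zero to the left of x0 and q the first to the right; both exist by
  compactness.\<close>

lemma nodal_interval:
  fixes v :: "real \<Rightarrow> real"
  assumes c: "continuous_on {0..l} v" and "v 0 = 0" "v l = 0" "x0 \<in> {0..l}" "v x0 > 0"
  obtains p q where "0 \<le> p" "p < q" "q \<le> l" "v p = 0" "v q = 0" "\<And>x. x \<in> {p<..<q} \<Longrightarrow> v x > 0"
proof -
  have c1: "continuous_on {0..x0} v" "continuous_on {x0..l} v"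
    using assms(4) by (auto intro: continuous_on_subset[OF c])
  have comp: "compact {x\<in>{0..x0}. v x = 0}" "compact {x\<in>{x0..l}. v x = 0}"
    using continuous_closed_preimage_constant[OF c1(1), of 0] continuous_closed_preimage_constant[OF c1(2), of 0]
    by (auto intro!: compact_eq_bounded_closed[THEN iffD2] bounded_subset[OF bounded_closed_interval])
  obtain p where p: "p \<in> {0..x0}" "v p = 0" "\<And>x. x \<in> {0..x0} \<Longrightarrow> v x = 0 \<Longrightarrow> x \<le> p"
    using compact_attains_sup[OF comp(1)] assms by force
  obtain q where q: "q \<in> {x0..l}" "v q = 0" "\<And>x. x \<in> {x0..l} \<Longrightarrow> v x = 0 \<Longrightarrow> q \<le> x"
    using compact_attains_inf[OF comp(2)] assms by force
  have "v x > 0" if x: "x \<in> {p<..<q}" for x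
  proof (rule ccontr)
    assume n: "\<not> v x > 0"
    show False
    proof (cases "x \<le> x0")
      case True
      then obtain y where "x \<le> y" "y \<le> x0" "v y = 0"
        using IVT'[of v x 0 x0] n x p \<open>v x0 > 0\<close> continuous_on_subset[OF c1(1), of "{x..x0}"] by auto
      then show False using p(1) p(3)[of y] x by auto
    next
      case False
      then obtain y where "x0 \<le> y" "y \<le> x" "v y = 0"
        using IVT2'[of v x 0 x0] n x q \<open>v x0 > 0\<close> continuous_on_subset[OF c1(2), of "{x0..x}"] by auto
      then show False using q(1) q(3)[of y] x by auto
    qed
  qed
  moreover have "p \<noteq> x0" using p \<open>v x0 > 0\<close> by auto
  ultimately show ?thesis using that[of p q] p q by auto
qed

text \<open>Integrate the Wronskian over a nodal interval of v. As v is positive there, its slope is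
  nonnegative at p and nonpositive at q, so the boundary terms are nonnegative; \<mu> > \<nu> would
  make the integral negative. If v is nowhere positive, use -v.\<close>

lemma sturm_comparison:
  assumes wt: "weight a b l r" "0 < a" and u: "solves l r r \<mu> \<mu> u w" and pos: "\<And>x. x \<in> {0<..<l} \<Longrightarrow> u x > 0"
    and v: "solves l r r \<nu> \<nu> v z" and vl: "v l = 0" and nz: "\<exists>x\<in>{0..l}. v x \<noteq> 0"
  shows "\<mu> \<le> \<nu>"
proof -
  have main: "\<mu> \<le> \<nu>" if v: "solves l r r \<nu> \<nu> v z" and vl: "v l = 0" and x0: "x0 \<in> {0..l}" "v x0 > 0" for v z x0
  proof (rule ccontr)
    assume "\<not> \<mu> \<le> \<nu>"
    note uc = solves_continuous[OF u] and vc = solves_continuous[OF v]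
    have v00: "v 0 = 0" using v by (simp add: solves_def)
    obtain p q where pq: "0 \<le> p" "p < q" "q \<le> l" "v p = 0" "v q = 0" "\<And>x. x \<in> {p<..<q} \<Longrightarrow> v x > 0"
      using nodal_interval[OF vc(1) v00 vl x0] by blast
    have ab: "a \<le> b" using weight_bounds[OF wt(1) x0(1)] by auto
    obtain H where H: "\<And>x. x \<in> {0..l} \<Longrightarrow> \<bar>fucik_rhs r r \<mu> \<mu> u x\<bar> \<le> H"
      using fucik_rhs_bounded[OF wt(1,1,2) ab uc(1)] by blast
    obtain G where G: "\<And>x. x \<in> {0..l} \<Longrightarrow> \<bar>fucik_rhs r r \<nu> \<nu> v x\<bar> \<le> G"
      using fucik_rhs_bounded[OF wt(1,1,2) ab vc(1)] by blast
    have W: "primitive_on l (\<lambda>x. w x * v x - u x * z x) (\<lambda>x. u x * fucik_rhs r r \<nu> \<nu> v x - fucik_rhs r r \<mu> \<mu> u x * v x)"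
      using u v by (intro wronskian_primitive[where G=G and H=H] H G) (auto simp: solves_def)
    define k where "k = (\<lambda>x. u x * fucik_rhs r r \<nu> \<nu> v x - fucik_rhs r r \<mu> \<mu> u x * v x)"
    have keq: "k x = (\<nu> - \<mu>) * r x * (u x * v x)" for x
      by (simp add: k_def fucik_rhs_linear algebra_simps)
    have l: "0 < l" using pq by auto
    have u0: "u x \<ge> 0" if "x \<in> {0..l}" for x
      using nonneg_at_closure[OF uc(1) l pos that] by auto
    have zp: "z p \<ge> 0"
    proof (rule ccontr)
      assume "\<not> z p \<ge> 0"
      then obtain d where d: "d > 0" "\<And>h. h > 0 \<Longrightarrow> p + h \<in> {0..l} \<Longrightarrow> h < d \<Longrightarrow> v p > v (p + h)"
        using has_real_derivative_neg_dec_right[OF solves_deriv[OF v, of p]] pq by (auto simp: not_le)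
      define h where "h = min (d / 2) ((q - p) / 2)"
      have "h > 0" "h < d" "p + h < q" using d(1) pq by (auto simp: h_def min_def field_simps)
      moreover have "v (p + h) > 0" using \<open>h > 0\<close> \<open>p + h < q\<close> by (intro pq(6)) auto
      ultimately show False using d(2)[of h] pq(1-5) by auto
    qed
    have zq: "z q \<le> 0"
    proof (rule ccontr)
      assume "\<not> z q \<le> 0"
      then obtain d where d: "d > 0" "\<And>h. h > 0 \<Longrightarrow> q - h \<in> {0..l} \<Longrightarrow> h < d \<Longrightarrow> v (q - h) < v q"
        using has_real_derivative_pos_inc_left[OF solves_deriv[OF v, of q]] pq by (auto simp: not_le)
      define h where "h = min (d / 2) ((q - p) / 2)"
      have "h > 0" "h < d" "p < q - h" using d(1) pq by (auto simp: h_def min_def field_simps)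
      moreover have "v (q - h) > 0" using \<open>h > 0\<close> \<open>p < q - h\<close> by (intro pq(6)) auto
      ultimately show False using d(2)[of h] pq(1-5) by auto
    qed
    have "integral {p..q} k = u p * z p - u q * z q"
      using primitive_diff_eq[OF W, of p q] pq by (simp add: k_def)
    moreover have "u p * z p \<ge> 0" "u q * z q \<le> 0"
      using u0[of p] u0[of q] zp zq pq by (auto intro: mult_nonneg_nonneg mult_nonneg_nonpos)
    ultimately have ge: "integral {p..q} k \<ge> 0" by simp
    have cuv: "continuous_on {p..q} (\<lambda>x. u x * v x)"
      using pq by (intro continuous_intros continuous_on_subset[OF uc(1)] continuous_on_subset[OF vc(1)]) auto
    have I: "integral {p..q} (\<lambda>x. 0) < integral {p..q} (\<lambda>x. u x * v x)"
      by (rule integral_less_real) (use cuv pos pq in auto)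
    have "integral {p..q} k \<le> integral {p..q} (\<lambda>x. ((\<nu> - \<mu>) * a) * (u x * v x))"
    proof (rule integral_le)
      show "k integrable_on {p..q}" unfolding k_def using primitive_abs_int[OF W] pq by (intro int_sub) auto
      show "(\<lambda>x. ((\<nu> - \<mu>) * a) * (u x * v x)) integrable_on {p..q}"
        using integrable_continuous_real[OF cuv] by (rule integrable_on_mult_right)
      fix x assume x: "x \<in> {p..q}"
      have vx: "v x \<ge> 0" using pq x by (cases "x = p \<or> x = q") (auto intro: less_imp_le)
      show "k x \<le> ((\<nu> - \<mu>) * a) * (u x * v x)"
        unfolding keq using weight_bounds[OF wt(1), of x] x pq u0[of x] vx \<open>\<not> \<mu> \<le> \<nu>\<close>
        by (intro mult_right_mono mult_left_mono_neg) auto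
    qed
    also have "\<dots> = ((\<nu> - \<mu>) * a) * integral {p..q} (\<lambda>x. u x * v x)" by simp
    also have "\<dots> < 0" using I \<open>\<not> \<mu> \<le> \<nu>\<close> \<open>0 < a\<close> by (intro mult_neg_pos) auto
    finally show False using ge by simp
  qed
  obtain x0 where x0: "x0 \<in> {0..l}" "v x0 \<noteq> 0" using nz by blast
  show ?thesis
  proof (cases "v x0 > 0")
    case True
    show ?thesis by (rule main[OF v vl x0(1) True])
  next
    case False
    show ?thesis by (rule main[OF solves_uminus[OF v] _ x0(1)]) (use vl False x0 in auto)
  qed
qed

lemma first_eigenvalue_eqI:
  assumes "l > 0" "weight a b l r" "0 < a" "a \<le> b"
    and u: "solves l r r \<mu> \<mu> u w" "u l = 0" and pos: "\<And>x. x \<in> {0<..<l} \<Longrightarrow> u x > 0"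
  shows "first_eigenvalue l r = \<mu>"
  unfolding first_eigenvalue_def
proof (rule Least_equality)
  note iff = eigenfunction_iff[OF assms(1,2,2,3,4)]
  have "u (l/2) \<noteq> 0" "l/2 \<in> {0..l}" using pos[of "l/2"] \<open>l > 0\<close> by auto
  then show "is_eigenvalue l r \<mu>" unfolding is_eigenvalue_iff iff using u by blast
  show "\<mu> \<le> \<nu>" if "is_eigenvalue l r \<nu>" for \<nu>
    using that sturm_comparison[OF assms(2,3) u(1) pos] unfolding is_eigenvalue_iff iff by blast
qed

text \<open>Picard iteration, contracting in the norm weighted by \<open>exp (- K x)\<close>.\<close>

lemma ivp_exists:
  assumes "l > 0" and r: "weight a b l r" "0 < a"
  shows "\<exists>u w. solves l r r \<mu> \<mu> u w \<and> w 0 = 1"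
proof -
  have b: "b > 0" using weight_bounds[OF r(1), of 0] assms by auto
  define J :: "(real \<Rightarrow> real) \<Rightarrow> real \<Rightarrow> real" where "J = (\<lambda>w x. integral {0..x} w)"
  \<comment> \<open>The integrated equation for the slope with initial value 1, where J recovers u
    from its slope.\<close>
  define T where "T = (\<lambda>w x. 1 - \<mu> * integral {0..x} (\<lambda>s. r s * J w s))"
  define W where "W = (\<lambda>k. (T ^^ k) (\<lambda>_. 1))"
  have W0: "W 0 = (\<lambda>_. 1)" and WS: "W (Suc k) = T (W k)" for k by (auto simp: W_def)
  have Jp: "primitive_on l (J w) w" if "continuous_on {0..l} w" for w
    unfolding J_def using absolutely_integrable_continuous_real[OF that] by (intro primitive_onI) auto
  have Tp: "primitive_on l (T w) (\<lambda>x. - (\<mu> * (r x * J w x)))" if "continuous_on {0..l} w" for w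
  proof -
    have i: "(\<lambda>s. r s * J w s) absolutely_integrable_on {0..l}"
      by (rule weight_mult_abs_int[OF r(1) primitive_continuous[OF Jp[OF that]]])
    have "(\<lambda>x. (- \<mu>) * (r x * J w x)) absolutely_integrable_on {0..l}"
      using i by (rule set_integrable_mult_right)
    then show ?thesis
      by (intro primitive_onI) (simp_all add: T_def)
  qed
  have Wc: "continuous_on {0..l} (W k)" for k
    by (induction k) (auto simp: W0 WS intro: primitive_continuous[OF Tp])
  define C where "C = \<bar>\<mu>\<bar> * b * l"
  \<comment> \<open>Integrating exp (K s) gains a factor 1 / K, and C / K \<le> 1/2 turns one Picard
    step into a contraction by 1/2.\<close>
  define K where "K = 2 * (C + 1)"
  have C: "C \<ge> 0" using b \<open>l > 0\<close> by (simp add: C_def)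
  have K: "K > 0" using C by (simp add: K_def)
  have rb: "\<bar>r x\<bar> \<le> b" if "x \<in> {0..l}" for x using weight_bounds[OF r(1) that] \<open>0 < a\<close> by auto
  define M where "M = C * l"
  have M: "M \<ge> 0" using C \<open>l > 0\<close> by (simp add: M_def)
  have expint: "((\<lambda>s. exp (K * s)) has_integral (exp (K * x) / K - 1 / K)) {0..x}" if "x \<ge> 0" for x
  proof -
    have "((\<lambda>s. exp (K * s)) has_integral (exp (K * x) / K - exp (K * 0) / K)) {0..x}"
      using that K by (intro fundamental_theorem_of_calculus)
        (auto intro!: derivative_eq_intros simp: has_real_derivative_iff_has_vector_derivative[symmetric])
    then show ?thesis by simp
  qed
  have d: "\<bar>W (Suc k) x - W k x\<bar> \<le> M * (1/2)^k * exp (K * x)" if x: "x \<in> {0..l}" for k x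
    using x
  proof (induction k arbitrary: x)
    case 0
    have "\<bar>T (\<lambda>_. 1) x - T (\<lambda>_. 1) 0\<bar> \<le> C * (x - 0)"
    proof (rule primitive_abs_diff_le[OF Tp])
      fix s assume s: "s \<in> {0..x}"
      have "\<bar>- (\<mu> * (r s * J (\<lambda>_. 1) s))\<bar> = \<bar>\<mu>\<bar> * \<bar>r s\<bar> * s" using s by (simp add: J_def abs_mult)
      also have "\<dots> \<le> \<bar>\<mu>\<bar> * b * l" using rb[of s] s 0 b by (intro mult_mono) auto
      finally show "\<bar>- (\<mu> * (r s * J (\<lambda>_. 1) s))\<bar> \<le> C" by (simp add: C_def)
    qed (use 0 in auto)
    also have "\<dots> \<le> M" using 0 C by (simp add: M_def mult_left_mono)
    also have "\<dots> \<le> M * exp (K * x)" using M K 0 by (simp add: mult_le_cancel_left1)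
    finally show ?case by (simp add: WS W0 T_def)
  next
    case (Suc k)
    define e where "e = M * (1/2)^k"
    have e: "e \<ge> 0" using M by (simp add: e_def)
    have J: "\<bar>J (W (Suc k)) s - J (W k) s\<bar> \<le> l * (e * exp (K * s))" if s: "s \<in> {0..l}" for s
    proof -
      have "primitive_on l (\<lambda>s. J (W (Suc k)) s - J (W k) s) (\<lambda>s. W (Suc k) s - W k s)"
        by (rule primitive_diff[OF Jp[OF Wc] Jp[OF Wc]])
      from primitive_abs_diff_le[OF this, of 0 s "e * exp (K * s)"]
      have "\<bar>J (W (Suc k)) s - J (W k) s\<bar> \<le> e * exp (K * s) * s"
      proof -
        have "\<bar>W (Suc k) y - W k y\<bar> \<le> e * exp (K * s)" if y: "y \<in> {0..s}" for y
        proof -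
          have "\<bar>W (Suc k) y - W k y\<bar> \<le> e * exp (K * y)" using Suc.IH[of y] y s by (simp add: e_def)
          also have "\<dots> \<le> e * exp (K * s)" using y K e by (intro mult_left_mono) auto
          finally show ?thesis .
        qed
        with primitive_abs_diff_le[OF \<open>primitive_on l _ _\<close>, of 0 s "e * exp (K * s)"] s
        show ?thesis by (simp add: J_def)
      qed
      also have "\<dots> \<le> e * exp (K * s) * l" using s e by (intro mult_left_mono) auto
      finally show ?thesis by (simp add: mult_ac)
    qed
    have p: "primitive_on l (\<lambda>x. T (W (Suc k)) x - T (W k) x)
        (\<lambda>x. - (\<mu> * (r x * J (W (Suc k)) x)) - - (\<mu> * (r x * J (W k) x)))"
      by (rule primitive_diff[OF Tp[OF Wc] Tp[OF Wc]])
    have "norm (integral {0..x} (\<lambda>x. - (\<mu> * (r x * J (W (Suc k)) x)) - - (\<mu> * (r x * J (W k) x))))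
      \<le> integral {0..x} (\<lambda>s. (C * e) * exp (K * s))"
    proof (rule integral_norm_bound_integral)
      show "(\<lambda>x. - (\<mu> * (r x * J (W (Suc k)) x)) - - (\<mu> * (r x * J (W k) x))) integrable_on {0..x}"
        using primitive_abs_int[OF p] Suc.prems by (intro int_sub) auto
      show "(\<lambda>s. (C * e) * exp (K * s)) integrable_on {0..x}"
        using expint[of x] Suc.prems by (intro integrable_on_mult_right) auto
      fix s assume s: "s \<in> {0..x}"
      then have s': "s \<in> {0..l}" using Suc.prems by auto
      have "norm (- (\<mu> * (r s * J (W (Suc k)) s)) - - (\<mu> * (r s * J (W k) s)))
          = \<bar>\<mu>\<bar> * (\<bar>r s\<bar> * \<bar>J (W (Suc k)) s - J (W k) s\<bar>)"
        unfolding real_norm_def abs_mult[symmetric] by (subst abs_minus_cancel[symmetric]) (simp add: algebra_simps)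
      also have "\<dots> \<le> \<bar>\<mu>\<bar> * (b * (l * (e * exp (K * s))))"
        using rb[OF s'] J[OF s'] b by (intro mult_left_mono mult_mono) auto
      finally show "norm (- (\<mu> * (r s * J (W (Suc k)) s)) - - (\<mu> * (r s * J (W k) s))) \<le> (C * e) * exp (K * s)"
        by (simp add: C_def mult_ac)
    qed
    also have "\<dots> = C * e * (exp (K * x) / K - 1 / K)"
      using expint[of x] Suc.prems by (simp add: integral_unique)
    also have "\<dots> \<le> C * e * (exp (K * x) / K)"
      using C e K by (intro mult_left_mono) auto
    also have "\<dots> = (C / K) * (e * exp (K * x))" by simp
    also have "\<dots> \<le> (1/2) * (e * exp (K * x))"
      using C e by (intro mult_right_mono) (auto simp: K_def field_simps)
    also have "\<dots> = M * (1/2) ^ Suc k * exp (K * x)" by (simp add: e_def)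
    finally show ?case
      using primitive_diff_eq[OF p, of 0 x] Suc.prems by (simp add: WS T_def)
  qed
  \<comment> \<open>The iterates are partial sums of a telescoping series dominated by a geometric
    one.\<close>
  have "uniform_limit {0..l} (\<lambda>n x. \<Sum>k<n. W (Suc k) x - W k x) (\<lambda>x. \<Sum>k. W (Suc k) x - W k x) sequentially"
  proof (rule Weierstrass_m_test)
    fix k x assume x: "x \<in> {0..l}"
    have "\<bar>W (Suc k) x - W k x\<bar> \<le> M * (1/2)^k * exp (K * x)" by (rule d[OF x])
    also have "\<dots> \<le> M * (1/2)^k * exp (K * l)" using x M K by (intro mult_left_mono) auto
    finally show "norm (W (Suc k) x - W k x) \<le> (M * exp (K * l)) * (1/2)^k" by (simp add: mult_ac)
  next
    show "summable (\<lambda>k. (M * exp (K * l)) * (1/2)^k)" by (intro summable_mult summable_geometric) auto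
  qed
  moreover have "(\<Sum>k<n. W (Suc k) x - W k x) = W n x - W 0 x" for n x
    by (rule sum_lessThan_telescope[of "\<lambda>k. W k x"])
  ultimately have "uniform_limit {0..l} (\<lambda>n x. W n x - W 0 x) (\<lambda>x. \<Sum>k. W (Suc k) x - W k x) sequentially"
    by simp
  then have "uniform_limit {0..l} (\<lambda>n x. (W n x - W 0 x) + 1) (\<lambda>x. (\<Sum>k. W (Suc k) x - W k x) + 1) sequentially"
    by (intro uniform_limit_add uniform_limit_const)
  then obtain w where wl: "uniform_limit {0..l} W w sequentially" by (auto simp: W0)
  have wc: "continuous_on {0..l} w" by (rule uniform_limit_theorem[OF _ wl]) (use Wc in auto)
  have Jl: "uniform_limit {0..l} (\<lambda>k. J (W k)) (J w) sequentially"
    using uniform_limit_primitive(2)[OF \<open>l > 0\<close> Jp[OF Wc] _ Wc wl] by (simp add: J_def)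
  have Jc: "continuous_on {0..l} (J (W k))" for k using primitive_continuous[OF Jp[OF Wc]] .
  have weq: "w x = T w x" if x: "x \<in> {0..l}" for x
  proof -
    have 1: "(\<lambda>k. W (Suc k) x) \<longlonglongrightarrow> w x"
      using tendsto_uniform_limitI[OF wl x] by (rule LIMSEQ_Suc)
    \<comment> \<open>A constant family of weights converges weakly*, so
      \<open>weak_star_uniform\<close> also passes to the limit under this integral.\<close>
    have ws: "weak_star_Linfty l (\<lambda>_. r) r sequentially" by (simp add: weak_star_Linfty_def)
    have "(\<lambda>k. integral {0..x} (\<lambda>s. r s * J (W k) s)) \<longlonglongrightarrow> integral {0..x} (\<lambda>s. r s * J w s)"
      by (rule weak_star_uniform[OF r(1) r(1) \<open>0 < a\<close> ws Jc Jl x])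
    then have "(\<lambda>k. W (Suc k) x) \<longlonglongrightarrow> T w x"
      unfolding WS T_def by (intro tendsto_intros)
    with 1 show ?thesis by (rule LIMSEQ_unique)
  qed
  have "solves l r r \<mu> \<mu> (J w) w"
    unfolding solves_def
  proof (intro conjI Jp wc)
    show "J w 0 = 0" by (simp add: J_def)
    show "primitive_on l w (\<lambda>x. - fucik_rhs r r \<mu> \<mu> (J w) x)"
      by (rule primitive_cong[OF Tp[OF wc]]) (use weq in \<open>auto simp: fucik_rhs_linear mult_ac\<close>)
  qed
  moreover have "w 0 = 1" using weq[of 0] \<open>l > 0\<close> by (simp add: T_def)
  ultimately show ?thesis by blast
qed

section \<open>First eigenvalue, nodal curves and the limit theorem\<close>

lemma uniform_limit_pos:
  fixes f :: "nat \<Rightarrow> real \<Rightarrow> real"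
  assumes "uniform_limit S f g sequentially" "compact S" "continuous_on S g" "\<And>x. x \<in> S \<Longrightarrow> g x > 0"
  shows "\<forall>\<^sub>F j in sequentially. \<forall>x\<in>S. f j x > 0"
proof -
  obtain \<eta> where \<eta>: "\<eta> > 0" "\<And>x. x \<in> S \<Longrightarrow> \<eta> \<le> g x"
  proof (cases "S = {}")
    case False
    then show ?thesis
      using continuous_attains_inf[OF assms(2) False assms(3)] assms(4) that by metis
  qed (use that[of 1] in auto)
  show ?thesis
    using uniform_limitD[OF assms(1) \<eta>(1)]
  proof eventually_elim
    case (elim j)
    show ?case
    proof
      fix x assume x: "x \<in> S"
      have "dist (f j x) (g x) < \<eta>" using elim x by blast
      then show "f j x > 0" using \<eta>(2)[OF x] unfolding dist_real_def by linarith
    qed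
  qed
qed

text \<open>Compactness for unnormalized solutions; the scaling factors c are already re-indexed
  along r.\<close>

lemma solves_normalized_limit:
  assumes wt: "\<And>j. weight a b l (m j)" "\<And>j. weight a b l (n j)" "weight a b l m0" "weight a b l n0" "0 < a" "l > 0"
    and ws: "weak_star_Linfty l m m0 sequentially" "weak_star_Linfty l n n0 sequentially"
    and \<alpha>: "\<alpha> \<longlonglongrightarrow> \<alpha>0" and \<beta>: "\<beta> \<longlonglongrightarrow> \<beta>0"
    and s: "\<And>j. solves l (m j) (n j) (\<alpha> j) (\<beta> j) (u j) (w j)" and nz: "\<And>j. w j 0 \<noteq> 0"
  obtains r c u0 w0 where "strict_mono (r :: nat \<Rightarrow> nat)" "\<And>j. c j > 0" "solves l m0 n0 \<alpha>0 \<beta>0 u0 w0" "w0 0 \<noteq> 0"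
    "uniform_limit {0..l} (\<lambda>j x. c j * u (r j) x) u0 sequentially"
    "uniform_limit {0..l} (\<lambda>j x. c j * w (r j) x) w0 sequentially"
proof -
  have "\<exists>c>0. solves l (m j) (n j) (\<alpha> j) (\<beta> j) (\<lambda>x. c * u j x) (\<lambda>x. c * w j x) \<and>
      (\<forall>x\<in>{0..l}. \<bar>c * w j x\<bar> \<le> 1) \<and> (\<exists>x\<in>{0..l}. \<bar>c * w j x\<bar> = 1)" for j
  proof -
    have "\<exists>x\<in>{0..l}. w j x \<noteq> 0" using nz[of j] \<open>l > 0\<close> by (intro bexI[of _ 0]) auto
    from solves_normalize[OF s this] show ?thesis by metis
  qed
  then obtain c where c: "\<And>j. c j > 0"
    "\<And>j. solves l (m j) (n j) (\<alpha> j) (\<beta> j) (\<lambda>x. c j * u j x) (\<lambda>x. c j * w j x)"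
    "\<And>j x. x \<in> {0..l} \<Longrightarrow> \<bar>c j * w j x\<bar> \<le> 1" "\<And>j. \<exists>x\<in>{0..l}. \<bar>c j * w j x\<bar> = 1"
    by metis
  obtain r u0 w0 where "strict_mono r" "solves l m0 n0 \<alpha>0 \<beta>0 u0 w0" "w0 0 \<noteq> 0"
    "uniform_limit {0..l} (\<lambda>j. (\<lambda>j x. c j * u j x) (r j)) u0 sequentially"
    "uniform_limit {0..l} (\<lambda>j. (\<lambda>j x. c j * w j x) (r j)) w0 sequentially"
    by (rule solves_compact[OF wt ws \<alpha> \<beta> c(2-4)])
  then show ?thesis using that[of r "\<lambda>j. c (r j)" u0 w0] c(1) by simp
qed

lemma limit_slope_pos:
  fixes w0 :: "real \<Rightarrow> real"
  assumes "uniform_limit {0..l} (\<lambda>j x. c j * w j x) w0 sequentially" "l > 0" "w0 0 \<noteq> 0"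
    "\<And>j::nat. c j > 0" "\<And>j. w j 0 > 0"
  shows "w0 0 > 0"
proof -
  have "(\<lambda>j. c j * w j 0) \<longlonglongrightarrow> w0 0"
    by (rule tendsto_uniform_limitI[OF assms(1)]) (use \<open>l > 0\<close> in auto)
  moreover have "0 \<le> c j * w j 0" for j using assms(4,5)[of j] by simp
  ultimately have "w0 0 \<ge> 0" by (blast intro: LIMSEQ_le_const)
  then show ?thesis using assms(3) by simp
qed

text \<open>An interior zero of a nonnegative function is a minimum, hence a double zero, which
  forces the trivial solution.\<close>

lemma no_interior_zero:
  assumes "weight a b l m" "weight a b l n" "0 < a" and s: "solves l m n \<alpha> \<beta> u w" and "w 0 \<noteq> 0"
    and nn: "\<And>x. x \<in> {0..l} \<Longrightarrow> u x \<ge> 0" and x: "x \<in> {0<..<l}"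
  shows "u x > 0"
proof (rule ccontr)
  assume "\<not> u x > 0"
  then have ux: "u x = 0" using nn[of x] x by auto
  have "x \<in> interior {0..l}" using x by simp
  then have D: "(u has_real_derivative w x) (at x)"
    using solves_deriv[OF s, of x] x by (metis at_within_interior interior_subset subsetD)
  have "w x = 0"
    by (rule DERIV_local_min[OF D, of "min x (l - x)"]) (use x ux nn in \<open>auto simp: abs_less_iff\<close>)
  then show False
    using solves_double_zero[OF assms(1-3) s, of x 0] ux x \<open>w 0 \<noteq> 0\<close> by auto
qed

text \<open>Shooting: take the supremum of the parameters whose solution is positive on \<open>(0, l]\<close>.\<close>

lemma first_eigenfunction_exists:
  assumes "l > 0" and r: "weight a b l r" "0 < a"
  obtains \<mu> u w where "solves l r r \<mu> \<mu> u w" "u l = 0" "w 0 > 0" "\<And>x. x \<in> {0<..<l} \<Longrightarrow> u x > 0"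
proof -
  define S where "S = {\<mu>. \<mu> \<ge> 0 \<and> (\<exists>u w. solves l r r \<mu> \<mu> u w \<and> w 0 = 1 \<and> (\<forall>x\<in>{0<..l}. u x > 0))}"
  have ws: "weak_star_Linfty l (\<lambda>_. r) r sequentially" by (simp add: weak_star_Linfty_def)
  have "0 \<in> S"
  proof -
    have "solves l r r 0 0 (\<lambda>x. x) (\<lambda>_. 1)"
      unfolding solves_def by (auto simp: fucik_rhs_def intro!: primitive_C1 derivative_eq_intros)
    then show ?thesis unfolding S_def by force
  qed
  have bdd: "bdd_above S"
  proof (rule bdd_aboveI)
    fix \<mu> assume "\<mu> \<in> S"
    then obtain u w where u: "solves l r r \<mu> \<mu> u w" "\<forall>x\<in>{0<..l}. u x > 0" by (auto simp: S_def)
    have "\<mu> * a \<le> (pi / (l - 0))\<^sup>2"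
      by (rule pos_interval_bound[OF r(1) r(1) r(2) u(1)]) (use u(2) \<open>l > 0\<close> in auto)
    then show "\<mu> \<le> (pi / l)\<^sup>2 / a" using \<open>0 < a\<close> by (simp add: pos_le_divide_eq)
  qed
  define \<mu> where "\<mu> = Sup S"
  have "\<mu> \<in> closure S" unfolding \<mu>_def using \<open>0 \<in> S\<close> bdd by (intro closure_contains_Sup) auto
  then obtain \<nu> where \<nu>: "\<And>j. \<nu> j \<in> S" "\<nu> \<longlonglongrightarrow> \<mu>" by (auto simp: closure_sequential)
  obtain u w where u: "\<And>j. solves l r r (\<nu> j) (\<nu> j) (u j) (w j)" "\<And>j. w j 0 = 1" "\<And>j x. x \<in> {0<..l} \<Longrightarrow> u j x > 0"
    using \<nu>(1) unfolding S_def mem_Collect_eq by metis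
  obtain \<rho> c u0 w0 where lim: "strict_mono (\<rho> :: nat \<Rightarrow> nat)" "\<And>j. c j > 0" "solves l r r \<mu> \<mu> u0 w0" "w0 0 \<noteq> 0"
    "uniform_limit {0..l} (\<lambda>j x. c j * u (\<rho> j) x) u0 sequentially"
    "uniform_limit {0..l} (\<lambda>j x. c j * w (\<rho> j) x) w0 sequentially"
  proof (rule solves_normalized_limit[OF r(1) r(1) r(1) r(1) r(2) \<open>l > 0\<close> ws ws \<nu>(2) \<nu>(2) u(1)])
    show "w j 0 \<noteq> 0" for j using u(2)[of j] by simp
  qed blast
  have w00: "w0 0 > 0"
    by (rule limit_slope_pos[OF lim(6) \<open>l > 0\<close> lim(4) lim(2)]) (simp add: u(2))
  have nn: "u0 x \<ge> 0" if x: "x \<in> {0..l}" for x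
  proof (rule LIMSEQ_le_const[OF tendsto_uniform_limitI[OF lim(5) x]])
    have "u j x \<ge> 0" for j
      using u(3)[of x j] u(1)[of j] x by (cases "x = 0") (auto simp: solves_def intro: less_imp_le)
    then have "0 \<le> c j * u (\<rho> j) x" for j using lim(2)[of j] by simp
    then show "\<exists>N. \<forall>j\<ge>N. 0 \<le> c j * u (\<rho> j) x" by blast
  qed
  have pos: "u0 x > 0" if "x \<in> {0<..<l}" for x
    using no_interior_zero[OF r(1) r(1) r(2) lim(3,4) nn that] by blast
  have "u0 l = 0"
  proof (rule ccontr)
    assume "u0 l \<noteq> 0"
    then have u0l: "u0 l > 0" using nn[of l] \<open>l > 0\<close> by simp
    have pos': "u0 x > 0" if "x \<in> {0<..l}" for x using pos[of x] u0l that by (cases "x = l") auto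
    \<comment> \<open>Parameters just above the supremum: each of their solutions fails to be
      positive somewhere on (0, l], yet the limit will turn out positive there.\<close>
    define \<nu>' where "\<nu>' = (\<lambda>j. \<mu> + inverse (real (Suc j)))"
    have \<nu>'l: "\<nu>' \<longlonglongrightarrow> \<mu>" unfolding \<nu>'_def using LIMSEQ_inverse_real_of_nat_add by blast
    have \<mu>0: "\<mu> \<ge> 0" unfolding \<mu>_def using \<open>0 \<in> S\<close> bdd by (rule cSup_upper)
    have \<nu>'S: "\<nu>' j \<notin> S" for j
    proof
      assume "\<nu>' j \<in> S"
      then have "\<nu>' j \<le> \<mu>" unfolding \<mu>_def using bdd by (rule cSup_upper)
      then show False by (simp add: \<nu>'_def)
    qed
    obtain v z where v: "\<And>j. solves l r r (\<nu>' j) (\<nu>' j) (v j) (z j)" "\<And>j. z j 0 = 1"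
    proof -
      have "\<forall>j. \<exists>v z. solves l r r (\<nu>' j) (\<nu>' j) v z \<and> z 0 = 1" using ivp_exists[OF \<open>l > 0\<close> r] by blast
      then show ?thesis using that by metis
    qed
    have vn: "\<exists>x\<in>{0<..l}. \<not> v j x > 0" for j
    proof (rule ccontr)
      assume "\<not> ?thesis"
      moreover have "\<nu>' j \<ge> 0" using \<mu>0 by (simp add: \<nu>'_def)
      ultimately have "\<nu>' j \<in> S" unfolding S_def using v[of j] by blast
      then show False using \<nu>'S by blast
    qed
    obtain \<rho>' c' v0 z0 where lim': "strict_mono (\<rho>' :: nat \<Rightarrow> nat)" "\<And>j. c' j > 0" "solves l r r \<mu> \<mu> v0 z0" "z0 0 \<noteq> 0"
      "uniform_limit {0..l} (\<lambda>j x. c' j * v (\<rho>' j) x) v0 sequentially"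
      "uniform_limit {0..l} (\<lambda>j x. c' j * z (\<rho>' j) x) z0 sequentially"
    proof (rule solves_normalized_limit[OF r(1) r(1) r(1) r(1) r(2) \<open>l > 0\<close> ws ws \<nu>'l \<nu>'l v(1)])
      show "z j 0 \<noteq> 0" for j using v(2)[of j] by simp
    qed blast
    have z00: "z0 0 > 0"
      by (rule limit_slope_pos[OF lim'(6) \<open>l > 0\<close> lim'(4) lim'(2)]) (simp add: v(2))
    \<comment> \<open>The limit problem is linear and both limits vanish at 0; matching their slopes
      there makes v0 - k u0 a solution with a double zero, so v0 = k u0 is positive on (0,
      l].\<close>
    define k where "k = z0 0 / w0 0"
    have k: "k > 0" using z00 w00 by (simp add: k_def)
    have su: "primitive_on l u0 w0" "u0 0 = 0" "primitive_on l w0 (\<lambda>x. - fucik_rhs r r \<mu> \<mu> u0 x)"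
      and sv: "primitive_on l v0 z0" "v0 0 = 0" "primitive_on l z0 (\<lambda>x. - fucik_rhs r r \<mu> \<mu> v0 x)"
      using lim(3) lim'(3) by (auto simp: solves_def)
    have eq: "v0 x = k * u0 x" if x: "x \<in> {0..l}" for x
    proof -
      have "v0 x - k * u0 x = 0 \<and> z0 x - k * w0 x = 0"
      proof (rule double_zero_imp_zero[OF primitive_diff[OF sv(1) primitive_cmult[OF su(1)]]
            primitive_diff[OF sv(3) primitive_cmult[OF su(3)]], where ?x0.0 = 0])
        fix y assume y: "y \<in> {0..l}"
        have "- fucik_rhs r r \<mu> \<mu> v0 y - k * - fucik_rhs r r \<mu> \<mu> u0 y = - (\<mu> * r y * (v0 y - k * u0 y))"
          by (simp add: fucik_rhs_linear algebra_simps)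
        also have "\<bar>\<dots>\<bar> \<le> (\<bar>\<mu>\<bar> * b) * \<bar>v0 y - k * u0 y\<bar>"
          using weight_bounds[OF r(1) y] \<open>0 < a\<close> unfolding abs_minus_cancel abs_mult by (intro mult_right_mono mult_left_mono) auto
        finally show "\<bar>- fucik_rhs r r \<mu> \<mu> v0 y - k * - fucik_rhs r r \<mu> \<mu> u0 y\<bar> \<le> (\<bar>\<mu>\<bar> * b) * \<bar>v0 y - k * u0 y\<bar>" .
      qed (use \<open>l > 0\<close> su sv w00 x in \<open>auto simp: k_def\<close>)
      then show ?thesis by simp
    qed
    have vpos: "v0 x > 0" if "x \<in> {0<..l}" for x using eq[of x] pos'[OF that] k that by auto
    have vc: "continuous_on {0..l} v0" "continuous_on {0..l} z0" using solves_continuous[OF lim'(3)] by auto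
    \<comment> \<open>Near 0 the functions themselves have no positive lower bound, so positivity is
      obtained there from the slopes and only on \<open>{e..l}\<close> from the values.\<close>
    have "\<exists>d>0. \<forall>x\<in>{0..l}. dist x 0 < d \<longrightarrow> dist (z0 x) (z0 0) < z0 0"
      using vc(2) z00 \<open>l > 0\<close> unfolding continuous_on_iff by (metis atLeastAtMost_iff less_eq_real_def order_refl)
    then obtain d where d: "d > 0" "\<And>x. x \<in> {0..l} \<Longrightarrow> dist x 0 < d \<Longrightarrow> dist (z0 x) (z0 0) < z0 0" by blast
    define e where "e = min (d / 2) l"
    have e: "0 < e" "e < d" "e \<le> l" using d(1) \<open>l > 0\<close> by (auto simp: e_def)
    have zpos: "z0 x > 0" if "x \<in> {0..e}" for x
      using d(2)[of x] that e by (auto simp: dist_real_def)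
    have "\<forall>\<^sub>F j in sequentially. \<forall>x\<in>{0..e}. c' j * z (\<rho>' j) x > 0"
      by (rule uniform_limit_pos[OF uniform_limit_on_subset[OF lim'(6)]])
        (use e zpos continuous_on_subset[OF vc(2)] in auto)
    moreover have "\<forall>\<^sub>F j in sequentially. \<forall>x\<in>{e..l}. c' j * v (\<rho>' j) x > 0"
      by (rule uniform_limit_pos[OF uniform_limit_on_subset[OF lim'(5)]])
        (use e vpos continuous_on_subset[OF vc(1)] in auto)
    ultimately have "\<forall>\<^sub>F j in sequentially. (\<forall>x\<in>{0..e}. c' j * z (\<rho>' j) x > 0) \<and> (\<forall>x\<in>{e..l}. c' j * v (\<rho>' j) x > 0)"
      by (rule eventually_conj)
    then obtain j where j: "\<And>x. x \<in> {0..e} \<Longrightarrow> c' j * z (\<rho>' j) x > 0" "\<And>x. x \<in> {e..l} \<Longrightarrow> c' j * v (\<rho>' j) x > 0"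
      using eventually_happens by fastforce
    obtain x where x: "x \<in> {0<..l}" "\<not> v (\<rho>' j) x > 0" using vn by blast
    have "\<not> e \<le> x" using j(2)[of x] x lim'(2)[of j] by (auto simp: zero_less_mult_iff)
    then have "x < e" by simp
    obtain \<xi> where \<xi>: "0 < \<xi>" "\<xi> < x" "v (\<rho>' j) x - v (\<rho>' j) 0 = z (\<rho>' j) \<xi> * (x - 0)"
      using within_MVT[of l "v (\<rho>' j)" "z (\<rho>' j)" 0 x, OF solves_deriv[OF v(1)]] x by auto
    have "z (\<rho>' j) \<xi> > 0" using j(1)[of \<xi>] \<xi> \<open>x < e\<close> lim'(2)[of j] by (auto simp: zero_less_mult_iff)
    then have "v (\<rho>' j) x > 0" using \<xi> x v(1)[of "\<rho>' j"] by (auto simp: solves_def)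
    then show False using x by blast
  qed
  then show ?thesis using that[OF lim(3) _ w00 pos] by blast
qed

section \<open>The curves in terms of initial slope and number of zeros\<close>

definition nodal_curve :: "real \<Rightarrow> nat \<Rightarrow> (real \<Rightarrow> real) \<Rightarrow> (real \<Rightarrow> real) \<Rightarrow> real \<Rightarrow> real \<Rightarrow> bool" where
  "nodal_curve l k m n \<alpha> \<beta> \<longleftrightarrow> (\<exists>u w. solves l m n \<alpha> \<beta> u w \<and> u l = 0 \<and> exactly_zeros l k u \<and> w 0 > 0)"

lemma right_slope_unique:
  assumes "solves l m n \<alpha> \<beta> u w" "l > 0" "(u has_real_derivative d) (at 0 within {0..l})"
  shows "d = w 0"
  by (rule deriv_within_Icc_unique[OF assms(2) _ assms(3) solves_deriv[OF assms(1)]]) (use assms(2) in auto)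

lemma nodal_curve_0_pos:
  assumes "l > 0" and s: "solves l m n \<alpha> \<beta> u w" and "exactly_zeros l 0 u" "w 0 > 0" and x: "x \<in> {0<..<l}"
  shows "u x > 0"
proof (rule ccontr)
  assume n: "\<not> u x > 0"
  have nz: "u y \<noteq> 0" if "y \<in> {0<..<l}" for y using assms(3) that by (fastforce simp: exactly_zeros_def)
  obtain d where d: "d > 0" "\<And>h. h > 0 \<Longrightarrow> 0 + h \<in> {0..l} \<Longrightarrow> h < d \<Longrightarrow> u 0 < u (0 + h)"
    using has_real_derivative_pos_inc_right[OF solves_deriv[OF s, of 0]] assms by auto
  define h where "h = min (d / 2) (x / 2)"
  have h: "h > 0" "h < d" "h < x" using d(1) x by (auto simp: h_def min_def)
  then have "u h > 0" using d(2)[of h] x s by (auto simp: solves_def)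
  moreover have "continuous_on {h..x} u" using h x by (intro continuous_on_subset[OF solves_continuous(1)[OF s]]) auto
  ultimately obtain y where "h \<le> y" "y \<le> x" "u y = 0"
    using IVT2'[of u x 0 h] n h by auto
  then show False using nz[of y] h x by auto
qed

text \<open>A solution without interior zeros and with positive slope at 0 is positive, and a
  positive eigenfunction belongs to the least eigenvalue; conversely shooting provides one. This
  puts k = 0 into the same form as k > 0.\<close>

lemma first_eigenvalue_iff:
  assumes "l > 0" and r: "weight a b l r" "0 < a"
  shows "\<alpha> = first_eigenvalue l r \<longleftrightarrow> nodal_curve l 0 r r \<alpha> \<alpha>"
proof
  have ab: "a \<le> b" using weight_bounds[OF r(1), of 0] \<open>l > 0\<close> by auto
  assume "\<alpha> = first_eigenvalue l r"
  moreover obtain \<mu> u w where u: "solves l r r \<mu> \<mu> u w" "u l = 0" "w 0 > 0" "\<And>x. x \<in> {0<..<l} \<Longrightarrow> u x > 0"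
    using first_eigenfunction_exists[OF assms] by blast
  moreover have "first_eigenvalue l r = \<mu>"
    by (rule first_eigenvalue_eqI[OF \<open>l > 0\<close> r ab u(1,2) u(4)])
  moreover have "exactly_zeros l 0 u"
  proof -
    have "{x \<in> {0<..<l}. u x = 0} = {}" using u(4) by fastforce
    then show ?thesis unfolding exactly_zeros_def by (metis card.empty finite.emptyI)
  qed
  ultimately show "nodal_curve l 0 r r \<alpha> \<alpha>" by (auto simp: nodal_curve_def)
next
  have ab: "a \<le> b" using weight_bounds[OF r(1), of 0] \<open>l > 0\<close> by auto
  assume "nodal_curve l 0 r r \<alpha> \<alpha>"
  then obtain u w where u: "solves l r r \<alpha> \<alpha> u w" "u l = 0" "exactly_zeros l 0 u" "w 0 > 0"
    by (auto simp: nodal_curve_def)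
  show "\<alpha> = first_eigenvalue l r"
    by (rule first_eigenvalue_eqI[symmetric, OF \<open>l > 0\<close> r ab u(1,2) nodal_curve_0_pos[OF \<open>l > 0\<close> u(1,3,4)]])
qed

text \<open>For k = 0 the coordinate \<beta> is free, so the condition is one on the linear problem
  with weight m and parameter \<alpha> alone.\<close>

lemma C_plus_iff:
  assumes "l > 0" "weight a b l m" "weight a b l n" "0 < a"
  shows "(\<alpha>, \<beta>) \<in> C_plus l k m n \<longleftrightarrow> (if k = 0 then nodal_curve l 0 m m \<alpha> \<alpha> else nodal_curve l k m n \<alpha> \<beta>)"
proof (cases "k = 0")
  case True
  then show ?thesis using first_eigenvalue_iff[OF assms(1,2,4), of \<alpha>] by (simp add: C_plus_def)
next
  case False
  have ab: "a \<le> b" using weight_bounds[OF assms(2), of 0] \<open>l > 0\<close> by auto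
  note iff = eigenfunction_iff[OF assms(1-4) ab]
  have "(\<exists>u d. eigenfunction l m n \<alpha> \<beta> u \<and> exactly_zeros l k u \<and> (u has_real_derivative d) (at 0 within {0..l}) \<and> d > 0)
    \<longleftrightarrow> nodal_curve l k m n \<alpha> \<beta>"
  proof
    assume "\<exists>u d. eigenfunction l m n \<alpha> \<beta> u \<and> exactly_zeros l k u \<and> (u has_real_derivative d) (at 0 within {0..l}) \<and> d > 0"
    then obtain u d w where "solves l m n \<alpha> \<beta> u w" "u l = 0" "exactly_zeros l k u"
      "(u has_real_derivative d) (at 0 within {0..l})" "d > 0" unfolding iff by blast
    then show "nodal_curve l k m n \<alpha> \<beta>"
      using right_slope_unique[OF _ \<open>l > 0\<close>] unfolding nodal_curve_def by blast
  next
    assume "nodal_curve l k m n \<alpha> \<beta>"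
    then obtain u w where u: "solves l m n \<alpha> \<beta> u w" "u l = 0" "exactly_zeros l k u" "w 0 > 0"
      by (auto simp: nodal_curve_def)
    have "\<exists>x\<in>{0..l}. u x \<noteq> 0"
      using solves_nontrivial_iff(1)[OF assms(2-4) \<open>l > 0\<close> u(1)] u(4) by simp
    moreover have "(u has_real_derivative w 0) (at 0 within {0..l})"
      using solves_deriv[OF u(1), of 0] \<open>l > 0\<close> by simp
    ultimately show "\<exists>u d. eigenfunction l m n \<alpha> \<beta> u \<and> exactly_zeros l k u \<and> (u has_real_derivative d) (at 0 within {0..l}) \<and> d > 0"
      unfolding iff using u by blast
  qed
  then show ?thesis using False by (simp add: C_plus_def)
qed

lemma eigenfunction_uminus:
  assumes "l > 0" "weight a b l m" "weight a b l n" "0 < a" "eigenfunction l m n \<alpha> \<beta> u"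
  shows "eigenfunction l n m \<beta> \<alpha> (\<lambda>x. - u x)"
proof -
  have ab: "a \<le> b" using weight_bounds[OF assms(2), of 0] \<open>l > 0\<close> by auto
  show ?thesis
    using assms(5) unfolding eigenfunction_iff[OF assms(1,2,3,4) ab] eigenfunction_iff[OF assms(1,3,2,4) ab]
    by (auto dest: solves_uminus)
qed

text \<open>For k > 0 by u -> -u, which keeps the zeros and reverses the slope; for k = 0 the two
  lines are exchanged by definition.\<close>

lemma C_minus_iff:
  assumes "l > 0" "weight a b l m" "weight a b l n" "0 < a"
  shows "(\<alpha>, \<beta>) \<in> C_minus l k m n \<longleftrightarrow> (\<beta>, \<alpha>) \<in> C_plus l k n m"
proof (cases "k = 0")
  case False
  have z: "exactly_zeros l k (\<lambda>x. - u x) \<longleftrightarrow> exactly_zeros l k u" for u by (simp add: exactly_zeros_def)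
  have *: "\<exists>v d. eigenfunction l n m \<beta> \<alpha> v \<and> exactly_zeros l k v \<and> (v has_real_derivative d) (at 0 within {0..l}) \<and> Q d"
    if "eigenfunction l m n \<alpha> \<beta> u" "exactly_zeros l k u" "(u has_real_derivative d) (at 0 within {0..l})" "Q (- d)"
      and "weight a b l m" "weight a b l n" for u d Q \<alpha> \<beta> m n
    using that eigenfunction_uminus[OF \<open>l > 0\<close> that(5,6) \<open>0 < a\<close> that(1)] DERIV_minus[OF that(3)] z
    by (intro exI[of _ "\<lambda>x. - u x"] exI[of _ "- d"]) auto
  show ?thesis
    using False *[of m n \<alpha> \<beta> _ _ "\<lambda>d. d > 0"] *[of n m \<beta> \<alpha> _ _ "\<lambda>d. d < 0"] assms
    by (auto simp: C_plus_def C_minus_def)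
qed (auto simp: C_plus_def C_minus_def)

lemma nodal_curve_closed:
  assumes wt: "\<And>j. weight a b l (m j)" "\<And>j. weight a b l (n j)" "weight a b l m0" "weight a b l n0" "0 < a" "l > 0"
    and ws: "weak_star_Linfty l m m0 sequentially" "weak_star_Linfty l n n0 sequentially"
    and \<alpha>: "\<alpha> \<longlonglongrightarrow> \<alpha>0" and \<beta>: "\<beta> \<longlonglongrightarrow> \<beta>0"
    and c: "\<And>j. nodal_curve l k (m j) (n j) (\<alpha> j) (\<beta> j)"
  shows "nodal_curve l k m0 n0 \<alpha>0 \<beta>0"
proof -
  obtain u w where u: "\<And>j. solves l (m j) (n j) (\<alpha> j) (\<beta> j) (u j) (w j)" "\<And>j. u j l = 0"
    "\<And>j. exactly_zeros l k (u j)" "\<And>j. w j 0 > 0"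
    using c unfolding nodal_curve_def by metis
  obtain r c u0 w0 where lim: "strict_mono (r :: nat \<Rightarrow> nat)" "\<And>j. c j > 0" "solves l m0 n0 \<alpha>0 \<beta>0 u0 w0" "w0 0 \<noteq> 0"
    "uniform_limit {0..l} (\<lambda>j x. c j * u (r j) x) u0 sequentially"
    "uniform_limit {0..l} (\<lambda>j x. c j * w (r j) x) w0 sequentially"
  proof (rule solves_normalized_limit[OF wt ws \<alpha> \<beta> u(1)])
    show "w j 0 \<noteq> 0" for j using u(4)[of j] by simp
  qed blast
  have w00: "w0 0 > 0" by (rule limit_slope_pos[OF lim(6) \<open>l > 0\<close> lim(4) lim(2) u(4)])
  have sc: "solves l (m (r j)) (n (r j)) (\<alpha> (r j)) (\<beta> (r j)) (\<lambda>x. c j * u (r j) x) (\<lambda>x. c j * w (r j) x)" for j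
    by (rule solves_scale[OF u(1) lim(2)])
  have simple: "w0 x \<noteq> 0" if "x \<in> {0..l}" "u0 x = 0" for x
    using solves_double_zero[OF wt(3-5) lim(3) that, of 0] lim(4) \<open>l > 0\<close> by auto
  have bc: "c j * u (r j) 0 = 0" "c j * u (r j) l = 0" for j
    using u(2)[of "r j"] u(1)[of "r j"] by (auto simp: solves_def)
  note st = zeros_stable[OF \<open>l > 0\<close> solves_deriv[OF sc] solves_deriv[OF lim(3)] solves_continuous(2)[OF lim(3)]
      lim(5,6) simple bc]
  have "exactly_zeros l k (\<lambda>x. c j * u (r j) x)" for j
    using u(3)[of "r j"] lim(2)[of j] by (simp add: exactly_zeros_def)
  then have ck: "card {x \<in> {0..l}. c j * u (r j) x = 0} = k + 2" for j
    using exactly_zeros_iff[of l "\<lambda>x. c j * u (r j) x" k, OF \<open>l > 0\<close> bc[of j]] by blast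
  \<comment> \<open>Every approximating solution has k + 2 zeros in the closed interval, so one late
    index determines the count for the limit.\<close>
  obtain j where "card {x \<in> {0..l}. c j * u (r j) x = 0} = card {x \<in> {0..l}. u0 x = 0}"
    using eventually_happens'[OF sequentially_bot st(2)] by blast
  then have "card {x \<in> {0..l}. u0 x = 0} = k + 2"
    unfolding ck by (rule sym)
  moreover have ul: "u0 l = 0"
    using LIMSEQ_unique[OF tendsto_uniform_limitI[OF lim(5), of l]] bc \<open>l > 0\<close> by auto
  moreover have "u0 0 = 0" using lim(3) by (simp add: solves_def)
  ultimately have "exactly_zeros l k u0"
    using exactly_zeros_iff[OF \<open>l > 0\<close>, of u0 k] st(1) by blast
  then show ?thesis using lim(3) ul w00 by (auto simp: nodal_curve_def)
qed

text \<open>With both parameters 0 the slope is constant, so u l = l * w 0 > 0, against the boundary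
  condition. This keeps limits away from the vertex of the cone.\<close>

lemma nodal_curve_nonzero:
  assumes "l > 0" "nodal_curve l k m n \<alpha> \<beta>"
  shows "\<alpha> \<noteq> 0 \<or> \<beta> \<noteq> 0"
proof (rule ccontr)
  assume "\<not> ?thesis"
  then obtain u w where u: "solves l m n 0 0 u w" "u l = 0" "w 0 > 0"
    using assms by (auto simp: nodal_curve_def)
  have pu: "primitive_on l u w" and pw: "primitive_on l w (\<lambda>x. 0)" and u0: "u 0 = 0"
    using u(1) unfolding solves_def fucik_rhs_def by simp_all
  have "w x = w 0" if "x \<in> {0..l}" for x using primitive_diff_eq[OF pw, of 0 x] that by simp
  then have "integral {0..l} w = integral {0..l} (\<lambda>_. w 0)"
    by (rule HK_integral_cong)
  moreover have "integral {0..l} w = u l - u 0" using primitive_diff_eq[OF pu, of 0 l] \<open>l > 0\<close> by simp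
  ultimately show False using u(2,3) u0 \<open>l > 0\<close> by simp
qed

text \<open>Pigeonhole: at most k points cannot meet all k + 1 half-open cells of length l / (k +
  1).\<close>

lemma gap_of_few_points:
  fixes Z :: "real set"
  assumes "finite Z" "card Z \<le> k" "l > 0" "Z \<subseteq> {0<..<l}"
  obtains i where "i \<le> k" "\<And>x. x \<in> Z \<Longrightarrow> x \<notin> {real i * l / real (k + 1)..<real (Suc i) * l / real (k + 1)}"
proof -
  \<comment> \<open>f x is the index of the cell containing x.\<close>
  define f where "f = (\<lambda>x. nat \<lfloor>x * real (k + 1) / l\<rfloor>)"
  have "card (f ` Z) < card {..k}"
    using card_image_le[OF assms(1), of f] assms(2) by simp
  then obtain i where i: "i \<in> {..k}" "i \<notin> f ` Z"
    by (metis card_mono assms(1) finite_imageI not_less subsetI)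
  show ?thesis
  proof (rule that[of i])
    fix x assume x: "x \<in> Z"
    show "x \<notin> {real i * l / real (k + 1)..<real (Suc i) * l / real (k + 1)}"
    proof
      assume "x \<in> {real i * l / real (k + 1)..<real (Suc i) * l / real (k + 1)}"
      then have "real i \<le> x * real (k + 1) / l" "x * real (k + 1) / l < real i + 1"
        using \<open>l > 0\<close> by (auto simp: field_simps)
      then have "\<lfloor>x * real (k + 1) / l\<rfloor> = int i" by (simp add: floor_eq_iff)
      then have "f x = i" by (simp add: f_def)
      then show False using i x by auto
    qed
  qed (use i in auto)
qed

text \<open>The k zeros leave a gap of length l / (k + 1) on which u has one sign;
  \<open>pos_interval_bound\<close> there limits \<alpha> if u is positive and, applied to -u,
  \<beta> if it is negative.\<close>

lemma nodal_curve_bound: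
  assumes wt: "weight a b l m" "weight a b l n" "0 < a" "l > 0" and c: "nodal_curve l k m n \<alpha> \<beta>"
  shows "\<alpha> * a \<le> (pi * real (k + 1) / l)\<^sup>2 \<or> \<beta> * a \<le> (pi * real (k + 1) / l)\<^sup>2"
proof -
  obtain u w where u: "solves l m n \<alpha> \<beta> u w" "exactly_zeros l k u"
    using c by (auto simp: nodal_curve_def)
  obtain i where i: "i \<le> k" "\<And>x. x \<in> {x \<in> {0<..<l}. u x = 0} \<Longrightarrow>
      x \<notin> {real i * l / real (k + 1)..<real (Suc i) * l / real (k + 1)}"
  proof (rule gap_of_few_points[of "{x \<in> {0<..<l}. u x = 0}" k l])
    show "finite {x \<in> {0<..<l}. u x = 0}" "card {x \<in> {0<..<l}. u x = 0} \<le> k"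
      using u(2) unfolding exactly_zeros_def by auto
  qed (use \<open>l > 0\<close> in auto)
  define p q where "p = real i * l / real (k + 1)" and "q = real (Suc i) * l / real (k + 1)"
  have qp: "q - p = l / real (k + 1)" by (simp add: p_def q_def diff_divide_distrib[symmetric] algebra_simps)
  have "real (Suc i) * l \<le> real (k + 1) * l" using i(1) \<open>l > 0\<close> by (intro mult_right_mono) auto
  then have ql: "q \<le> l" by (simp add: q_def pos_divide_le_eq mult.commute)
  have p0: "0 \<le> p" using \<open>l > 0\<close> by (simp add: p_def)
  have pq: "p < q" using qp \<open>l > 0\<close> by (smt (verit) divide_pos_pos of_nat_0_less_iff add_gr_0 zero_less_one)
  have nz: "u x \<noteq> 0" if x: "x \<in> {p<..<q}" for x
    using i(2)[of x, folded p_def q_def] x p0 ql by auto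
  have uc: "continuous_on {0..l} u" using solves_continuous[OF u(1)] by blast
  define y where "y = (p + q) / 2"
  have y: "y \<in> {p<..<q}" using pq by (auto simp: y_def)
  have same: "u y * u x > 0" if x: "x \<in> {p<..<q}" for x
  proof (rule ccontr)
    assume n: "\<not> u y * u x > 0"
    have "connected (u ` {p<..<q})"
      using p0 ql by (intro connected_continuous_image continuous_on_subset[OF uc]) auto
    moreover have "u x \<in> u ` {p<..<q}" "u y \<in> u ` {p<..<q}" using x y by auto
    moreover have "(u y \<le> 0 \<and> 0 \<le> u x) \<or> (u x \<le> 0 \<and> 0 \<le> u y)"
      using n by (auto simp: not_less mult_le_0_iff)
    ultimately have "0 \<in> u ` {p<..<q}" by (auto simp: connected_iff_interval)
    then show False using nz by force
  qed
  have eq: "pi / (q - p) = pi * real (k + 1) / l" unfolding qp by simp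
  show ?thesis
  proof (cases "u y > 0")
    case True
    have "\<alpha> * a \<le> (pi / (q - p))\<^sup>2"
      by (rule pos_interval_bound[OF wt(1-3) u(1) p0 pq ql])
        (use same True in \<open>auto simp: zero_less_mult_iff\<close>)
    then show ?thesis unfolding eq by simp
  next
    case False
    have "\<beta> * a \<le> (pi / (q - p))\<^sup>2"
    proof (rule pos_interval_bound[OF wt(2,1,3) solves_uminus[OF u(1)] p0 pq ql])
      fix x assume "x \<in> {p<..<q}"
      then show "- u x > 0" using same[of x] False by (auto simp: zero_less_mult_iff)
    qed
    then show ?thesis unfolding eq by simp
  qed
qed

section \<open>Bounds and closedness inside the cone\<close>

lemma K_cone_swap: "0 < t \<Longrightarrow> (\<alpha>, \<beta>) \<in> K_cone t \<longleftrightarrow> (\<beta>, \<alpha>) \<in> K_cone t"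
  by (auto simp: K_cone_def field_simps)

lemma C_plus_bound:
  assumes "l > 0" "weight a b l m" "weight a b l n" "0 < a" "0 < t" "t < 1"
    and "(\<alpha>, \<beta>) \<in> C_plus l k m n \<inter> K_cone t"
  shows "\<alpha> \<in> {0..(pi * real (k + 1) / l)\<^sup>2 / a / t} \<and> \<beta> \<in> {0..(pi * real (k + 1) / l)\<^sup>2 / a / t}"
proof -
  \<comment> \<open>Bounds one of the parameters; the cone, where each is at least t times the
    other, then bounds both by P / t.\<close>
  define P where "P = (pi * real (k + 1) / l)\<^sup>2 / a"
  have K: "\<alpha> > 0" "\<beta> > 0" "t * \<alpha> \<le> \<beta>" "t * \<beta> \<le> \<alpha>"
    using assms(5,7) by (auto simp: K_cone_def field_simps)
  have "\<alpha> * a \<le> (pi * real (k + 1) / l)\<^sup>2 \<or> \<beta> * a \<le> (pi * real (k + 1) / l)\<^sup>2"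
  proof (cases "k = 0")
    case True
    then have "nodal_curve l 0 m m \<alpha> \<alpha>" using assms(7) C_plus_iff[OF assms(1-4)] by auto
    from nodal_curve_bound[OF assms(2,2,4,1) this] show ?thesis using True by simp
  next
    case False
    then have "nodal_curve l k m n \<alpha> \<beta>" using assms(7) C_plus_iff[OF assms(1-4)] by auto
    from nodal_curve_bound[OF assms(2,3,4,1) this] show ?thesis .
  qed
  then have "\<alpha> \<le> P \<or> \<beta> \<le> P" using \<open>0 < a\<close> by (simp add: P_def pos_le_divide_eq)
  moreover have "t * \<alpha> \<le> \<alpha>" "t * \<beta> \<le> \<beta>" using K assms(5,6) by (auto simp: mult_left_le_one_le)
  ultimately have "t * \<alpha> \<le> P" "t * \<beta> \<le> P" using K by linarith+
  then have "\<alpha> \<le> P / t" "\<beta> \<le> P / t" using assms(5) by (simp_all add: pos_le_divide_eq mult.commute)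
  then show ?thesis using K unfolding P_def by auto
qed

lemma C_plus_eigenfunction:
  assumes "l > 0" "weight a b l m" "weight a b l n" "0 < a" "(\<alpha>, \<beta>) \<in> C_plus l k m n"
  shows "\<exists>u. eigenfunction l m n \<alpha> \<beta> u"
proof (cases "k = 0")
  case True
  then obtain u w where u: "solves l m m \<alpha> \<alpha> u w" "u l = 0" "exactly_zeros l 0 u" "w 0 > 0"
    using assms(5) C_plus_iff[OF assms(1-4)] by (auto simp: nodal_curve_def)
  have ab: "a \<le> b" using weight_bounds[OF assms(2), of 0] \<open>l > 0\<close> by auto
  have pos: "u x > 0" if "x \<in> {0<..<l}" for x using nodal_curve_0_pos[OF \<open>l > 0\<close> u(1,3,4) that] .
  have "u x \<ge> 0" if "x \<in> {0..l}" for x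
    using nonneg_at_closure[OF solves_continuous(1)[OF u(1)] \<open>l > 0\<close> pos that] .
  then have "solves l m n \<alpha> \<beta> u w" by (rule solves_nonneg[OF u(1)])
  moreover have "\<exists>x\<in>{0..l}. u x \<noteq> 0" using pos[of "l/2"] \<open>l > 0\<close> by (intro bexI[of _ "l/2"]) auto
  ultimately show ?thesis unfolding eigenfunction_iff[OF assms(1-4) ab] using u(2) by blast
next
  case False
  then show ?thesis using assms(5) by (auto simp: C_plus_def)
qed

text \<open>The cone is closed apart from its missing vertex, so its nonstrict inequalities pass to
  the limit and only (0, 0) has to be ruled out.\<close>

lemma C_plus_closed:
  assumes wt: "\<And>j. weight a b l (m j)" "\<And>j. weight a b l (n j)" "weight a b l m0" "weight a b l n0" "0 < a" "l > 0"
    and ws: "weak_star_Linfty l m m0 sequentially" "weak_star_Linfty l n n0 sequentially"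
    and \<alpha>: "\<alpha> \<longlonglongrightarrow> \<alpha>0" and \<beta>: "\<beta> \<longlonglongrightarrow> \<beta>0" and "0 < t"
    and c: "\<And>j. (\<alpha> j, \<beta> j) \<in> C_plus l k (m j) (n j) \<inter> K_cone t"
  shows "(\<alpha>0, \<beta>0) \<in> C_plus l k m0 n0 \<inter> K_cone t"
proof -
  have K: "\<alpha> j \<ge> 0" "\<beta> j \<ge> 0" "t * \<alpha> j \<le> \<beta> j" "\<beta> j \<le> inverse t * \<alpha> j" for j
    using c[of j] by (auto simp: K_cone_def)
  have K0: "\<alpha>0 \<ge> 0" "\<beta>0 \<ge> 0" "t * \<alpha>0 \<le> \<beta>0" "\<beta>0 \<le> inverse t * \<alpha>0"
    using K by (auto intro!: LIMSEQ_le_const[OF \<alpha>] LIMSEQ_le_const[OF \<beta>]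
        LIMSEQ_le[OF tendsto_mult_left[OF \<alpha>] \<beta>] LIMSEQ_le[OF \<beta> tendsto_mult_left[OF \<alpha>]])
  have C: "(\<alpha>0, \<beta>0) \<in> C_plus l k m0 n0 \<and> (\<alpha>0 \<noteq> 0 \<or> \<beta>0 \<noteq> 0)"
  proof (cases "k = 0")
    case True
    have "nodal_curve l 0 (m j) (m j) (\<alpha> j) (\<alpha> j)" for j
      using c[of j] True C_plus_iff[OF \<open>l > 0\<close> wt(1,2,5)] by simp
    from nodal_curve_closed[OF wt(1,1,3,3,5,6) ws(1,1) \<alpha> \<alpha> this]
    have "nodal_curve l 0 m0 m0 \<alpha>0 \<alpha>0" .
    then show ?thesis
      using True C_plus_iff[OF \<open>l > 0\<close> wt(3-5)] nodal_curve_nonzero[OF \<open>l > 0\<close>, of 0 m0 m0 \<alpha>0 \<alpha>0] by simp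
  next
    case False
    have "nodal_curve l k (m j) (n j) (\<alpha> j) (\<beta> j)" for j
      using c[of j] False C_plus_iff[OF \<open>l > 0\<close> wt(1,2,5)] by simp
    from nodal_curve_closed[OF wt ws \<alpha> \<beta> this]
    have "nodal_curve l k m0 n0 \<alpha>0 \<beta>0" .
    then show ?thesis
      using False C_plus_iff[OF \<open>l > 0\<close> wt(3-5)] nodal_curve_nonzero[OF \<open>l > 0\<close>, of k m0 n0 \<alpha>0 \<beta>0] by simp
  qed
  \<comment> \<open>In the closed cone the vanishing of one coordinate forces that of the
    other.\<close>
  have "\<alpha>0 \<noteq> 0"
  proof
    assume "\<alpha>0 = 0"
    then have "\<beta>0 = 0" using K0 by simp
    then show False using C \<open>\<alpha>0 = 0\<close> by simp
  qed
  then have "\<alpha>0 > 0" using K0 by simp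
  moreover have "\<beta>0 > 0" using mult_pos_pos[OF \<open>0 < t\<close> \<open>\<alpha>0 > 0\<close>] K0 by linarith
  ultimately show ?thesis using C K0 by (simp add: K_cone_def)
qed

text \<open>Uniform convergence of u and of its slope is even strong convergence in H1, which every
  bounded functional respects.\<close>

lemma weak_conv_of_C1_conv:
  assumes "l > 0" and p: "\<And>j. primitive_on l (u j) (w j)" "\<And>j. continuous_on {0..l} (w j)" "\<And>j. u j 0 = 0" "\<And>j. u j l = 0"
    and p0: "primitive_on l u0 w0" "continuous_on {0..l} w0" "u0 0 = 0" "u0 l = 0"
    and ul: "uniform_limit {0..l} u u0 sequentially" and wl: "uniform_limit {0..l} w w0 sequentially"
  shows "weak_conv_H10 l u u0"
  unfolding weak_conv_H10_def
proof
  fix T assume T: "T \<in> H10_dual l"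
  then obtain K where K: "\<And>v. v \<in> H10 l \<Longrightarrow> \<bar>T v\<bar> \<le> K * H1_norm l v"
    unfolding H10_dual_def by blast
  have uH: "u j \<in> H10 l" for j by (rule C1_in_H10[OF \<open>l > 0\<close> p(1,2,3,4)])
  have u0H: "u0 \<in> H10 l" by (rule C1_in_H10[OF \<open>l > 0\<close> p0])
  have m0: "primitive_on l (\<lambda>x. -1 * u0 x) (\<lambda>x. -1 * w0 x)" by (rule primitive_cmult[OF p0(1)])
  have m0H: "(\<lambda>x. -1 * u0 x) \<in> H10 l"
    by (rule C1_in_H10[OF \<open>l > 0\<close> m0]) (use p0 in \<open>auto intro!: continuous_intros\<close>)
  have d: "primitive_on l (\<lambda>x. u j x - u0 x) (\<lambda>x. w j x - w0 x)" for j
    by (rule primitive_diff[OF p(1) p0(1)])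
  have dc: "continuous_on {0..l} (\<lambda>x. w j x - w0 x)" for j by (intro continuous_intros p p0)
  have dH: "(\<lambda>x. u j x - u0 x) \<in> H10 l" for j
    by (rule C1_in_H10[OF \<open>l > 0\<close> d dc]) (use p p0 in auto)
  have Td: "T (u j) - T u0 = T (\<lambda>x. u j x - u0 x)" for j
  proof -
    have add: "\<And>v v'. v \<in> H10 l \<Longrightarrow> v' \<in> H10 l \<Longrightarrow> T (\<lambda>x. v x + v' x) = T v + T v'"
      using T unfolding H10_dual_def by blast
    have "T (\<lambda>x. u j x + -1 * u0 x) = T (u j) + T (\<lambda>x. -1 * u0 x)"
      by (rule add[OF uH m0H])
    moreover have "T (\<lambda>x. -1 * u0 x) = -1 * T u0" using T u0H unfolding H10_dual_def by blast
    ultimately show ?thesis by simp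
  qed
  have "(\<lambda>j. T (u j) - T u0) \<longlonglongrightarrow> 0"
  proof (rule LIMSEQ_I)
    fix e :: real assume "e > 0"
    \<comment> \<open>Makes (\<bar>K\<bar> + 1) sqrt (2 l) \<delta> = e / 2, where sqrt (2 l)
      \<delta> bounds the H1 distance; \<bar>K\<bar> + 1 is positive whatever K is.\<close>
    define \<delta> where "\<delta> = e / ((\<bar>K\<bar> + 1) * sqrt (2 * l) * 2)"
    have \<delta>: "\<delta> > 0" using \<open>e > 0\<close> \<open>l > 0\<close> by (simp add: \<delta>_def)
    obtain N where N: "\<And>j. j \<ge> N \<Longrightarrow> \<forall>x\<in>{0..l}. dist (u j x) (u0 x) < \<delta> \<and> dist (w j x) (w0 x) < \<delta>"
      using eventually_conj[OF uniform_limitD[OF ul \<delta>] uniform_limitD[OF wl \<delta>]]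
      unfolding eventually_sequentially by blast
    show "\<exists>N. \<forall>j\<ge>N. norm (T (u j) - T u0 - 0) < e"
    proof (intro exI[of _ N] allI impI)
      fix j assume j: "j \<ge> N"
      have sq: "integral {0..l} (\<lambda>x. (f x)\<^sup>2) \<le> l * \<delta>\<^sup>2"
        if "continuous_on {0..l} f" "\<And>x. x \<in> {0..l} \<Longrightarrow> \<bar>f x\<bar> < \<delta>" for f :: "real \<Rightarrow> real"
      proof -
        have "integral {0..l} (\<lambda>x. (f x)\<^sup>2) \<le> integral {0..l} (\<lambda>x. \<delta>\<^sup>2)"
        proof (rule integral_le)
          show "(\<lambda>x. (f x)\<^sup>2) integrable_on {0..l}" using that by (intro integrable_continuous_real continuous_on_power)
          show "(f x)\<^sup>2 \<le> \<delta>\<^sup>2" if x: "x \<in> {0..l}" for x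
            using \<open>x \<in> {0..l} \<Longrightarrow> \<bar>f x\<bar> < \<delta>\<close>[OF x] \<delta> by (subst abs_le_square_iff[symmetric]) auto
        qed auto
        then show ?thesis using \<open>l > 0\<close> by simp
      qed
      have 1: "\<bar>u j x - u0 x\<bar> < \<delta>" "\<bar>w j x - w0 x\<bar> < \<delta>" if "x \<in> {0..l}" for x
        using N[OF j] that by (auto simp: dist_real_def)
      have "(H1_norm l (\<lambda>x. u j x - u0 x))\<^sup>2 \<le> l * \<delta>\<^sup>2 + l * \<delta>\<^sup>2"
        unfolding H1_norm_primitive(2)[OF \<open>l > 0\<close> d L2_continuous[OF dc]]
        using sq[OF primitive_continuous[OF d] 1(1)] sq[OF dc 1(2)] by (rule add_mono)
      also have "\<dots> = (sqrt (2 * l) * \<delta>)\<^sup>2" using \<open>l > 0\<close> by (simp add: power_mult_distrib)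
      finally have H: "H1_norm l (\<lambda>x. u j x - u0 x) \<le> sqrt (2 * l) * \<delta>"
        by (rule power2_le_imp_le) (use \<delta> \<open>l > 0\<close> in auto)
      have "\<bar>T (u j) - T u0\<bar> \<le> K * H1_norm l (\<lambda>x. u j x - u0 x)" unfolding Td by (rule K[OF dH])
      also have "\<dots> \<le> (\<bar>K\<bar> + 1) * H1_norm l (\<lambda>x. u j x - u0 x)"
        using H1_norm_nonneg by (intro mult_right_mono) auto
      also have "\<dots> \<le> (\<bar>K\<bar> + 1) * (sqrt (2 * l) * \<delta>)" using H by (intro mult_left_mono) auto
      also have "\<dots> = e / 2"
      proof -
        have "s * (q * (e / (s * q * 2))) = e / 2" if "s \<noteq> 0" "q \<noteq> 0" for s q :: real using that by simp
        from this[of "\<bar>K\<bar> + 1" "sqrt (2 * l)"] show ?thesis using \<open>l > 0\<close> by (simp add: \<delta>_def)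
      qed
      also have "\<dots> < e" using \<open>e > 0\<close> by simp
      finally show "norm (T (u j) - T u0 - 0) < e" by simp
    qed
  qed
  then show "(\<lambda>j. T (u j)) \<longlonglongrightarrow> T u0" by (rule LIM_zero_cancel)
qed

text \<open>Normalising by \<open>max \<bar>u'\<bar>\<close> gives compactness; the \<open>L\<^sup>2\<close>-norm of the limit then recovers the
  scaling factors.\<close>

lemma eigenfunctions_subconverge:
  assumes wt: "\<And>j. weight a b l (m j)" "\<And>j. weight a b l (n j)" "weight a b l m0" "weight a b l n0" "0 < a" "l > 0"
    and ws: "weak_star_Linfty l m m0 sequentially" "weak_star_Linfty l n n0 sequentially"
    and \<alpha>: "\<alpha> \<longlonglongrightarrow> \<alpha>0" and \<beta>: "\<beta> \<longlonglongrightarrow> \<beta>0"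
    and e: "\<And>j. eigenfunction l (m j) (n j) (\<alpha> j) (\<beta> j) (u j)" and norm: "\<And>j. L2_norm l (u j) = 1"
  obtains r u0 where "strict_mono (r :: nat \<Rightarrow> nat)" "weak_conv_H10 l (\<lambda>j. u (r j)) u0" "eigenfunction l m0 n0 \<alpha>0 \<beta>0 u0"
proof -
  have ab: "a \<le> b" using weight_bounds[OF wt(3), of 0] \<open>l > 0\<close> by auto
  obtain w where u: "\<And>j. solves l (m j) (n j) (\<alpha> j) (\<beta> j) (u j) (w j)" "\<And>j. u j l = 0" "\<And>j. \<exists>x\<in>{0..l}. u j x \<noteq> 0"
    using e unfolding eigenfunction_iff[OF \<open>l > 0\<close> wt(1,2,5) ab] by metis
  obtain r c v0 z0 where lim: "strict_mono (r :: nat \<Rightarrow> nat)" "\<And>j. c j > 0" "solves l m0 n0 \<alpha>0 \<beta>0 v0 z0" "z0 0 \<noteq> 0"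
    "uniform_limit {0..l} (\<lambda>j x. c j * u (r j) x) v0 sequentially"
    "uniform_limit {0..l} (\<lambda>j x. c j * w (r j) x) z0 sequentially"
  proof (rule solves_normalized_limit[OF wt ws \<alpha> \<beta> u(1)])
    show "w j 0 \<noteq> 0" for j using solves_nontrivial_iff(1)[OF wt(1,2,5,6) u(1)] u(3) by blast
  qed blast
  have vc: "continuous_on {0..l} v0" "continuous_on {0..l} z0" using solves_continuous[OF lim(3)] by auto
  have uc: "continuous_on {0..l} (u j)" "continuous_on {0..l} (w j)" for j using solves_continuous[OF u(1)] by auto
  define N where "N = integral {0..l} (\<lambda>x. (v0 x)\<^sup>2)"
  \<comment> \<open>By the unit L2 norm of the eigenfunctions these integrals equal (c j)^2, so the
    scaling factors converge to sqrt N.\<close>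
  have "(\<lambda>j. integral {0..l} (\<lambda>x. (c j * u (r j) x)\<^sup>2)) \<longlonglongrightarrow> N"
  proof -
    have "uniform_limit {0..l} (\<lambda>j x. (c j * u (r j) x) * (c j * u (r j) x)) (\<lambda>x. v0 x * v0 x) sequentially"
      by (rule uniform_lim_mult[OF lim(5) lim(5)]) (use vc bounded_image_Icc in auto)
    then obtain I J where I: "\<And>j. ((\<lambda>x. (c j * u (r j) x) * (c j * u (r j) x)) has_integral I j) {0..l}"
      "((\<lambda>x. v0 x * v0 x) has_integral J) {0..l}" "I \<longlonglongrightarrow> J"
      by (rule uniform_limit_integral) (use uc in \<open>auto intro!: continuous_intros\<close>)
    show ?thesis
      unfolding N_def power2_eq_square integral_unique[OF I(1)] integral_unique[OF I(2)] by (rule I(3))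
  qed
  moreover have "integral {0..l} (\<lambda>x. (c j * u (r j) x)\<^sup>2) = (c j)\<^sup>2" for j
    using L2_norm_sq[OF L2_continuous[OF uc(1)], of "r j"] norm[of "r j"] by (simp add: power_mult_distrib)
  ultimately have "(\<lambda>j. (c j)\<^sup>2) \<longlonglongrightarrow> N" by simp
  then have "(\<lambda>j. sqrt ((c j)\<^sup>2)) \<longlonglongrightarrow> sqrt N" by (rule tendsto_real_sqrt)
  then have cl: "c \<longlonglongrightarrow> sqrt N" using lim(2) by (simp add: less_imp_le)
  have vnz: "\<exists>x\<in>{0..l}. v0 x \<noteq> 0" using solves_nontrivial_iff(1)[OF wt(3-6) lim(3)] lim(4) by blast
  have "N \<ge> 0" unfolding N_def
    using vc by (intro HK_integral_nonneg integrable_continuous_real continuous_on_power) auto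
  \<comment> \<open>Needed to divide by the factors in the limit; it is the nontriviality of
    v0.\<close>
  moreover have "N \<noteq> 0"
    unfolding N_def using HK_integral_eq_0_iff[of 0 l "\<lambda>x. (v0 x)\<^sup>2"] vnz vc \<open>l > 0\<close>
    by (auto intro: continuous_on_power)
  ultimately have s: "sqrt N > 0" by simp
  define s where "s = 1 / sqrt N"
  have s0: "s > 0" using s by (simp add: s_def)
  have cs: "(\<lambda>j. 1 / c j) \<longlonglongrightarrow> s"
    unfolding s_def using cl s by (intro tendsto_intros) auto
  have cu: "uniform_limit {0..l} (\<lambda>j x. 1 / c j) (\<lambda>x. s) sequentially"
    using cs by (auto simp: uniform_limit_iff tendsto_iff)
  \<comment> \<open>Undoing the scaling preserves uniform convergence, for functions and slopes
    alike.\<close>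
  have rescale: "uniform_limit {0..l} (\<lambda>j. f (r j)) (\<lambda>x. s * g x) sequentially"
    if "uniform_limit {0..l} (\<lambda>j x. c j * f (r j) x) g sequentially" "continuous_on {0..l} g" for f and g :: "real \<Rightarrow> real"
  proof -
    have "uniform_limit {0..l} (\<lambda>j x. 1 / c j * (c j * f (r j) x)) (\<lambda>x. s * g x) sequentially"
      by (rule uniform_lim_mult[OF cu that(1)]) (use that(2) bounded_image_Icc in auto)
    moreover have "1 / c j * (c j * f (r j) x) = f (r j) x" for j x using lim(2)[of j] by simp
    ultimately show ?thesis by simp
  qed
  have sv: "solves l m0 n0 \<alpha>0 \<beta>0 (\<lambda>x. s * v0 x) (\<lambda>x. s * z0 x)" by (rule solves_scale[OF lim(3) s0])
  have v0l: "v0 l = 0"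
    using LIMSEQ_unique[OF tendsto_uniform_limitI[OF lim(5), of l]] u(2) \<open>l > 0\<close> by auto
  have "weak_conv_H10 l (\<lambda>j. u (r j)) (\<lambda>x. s * v0 x)"
    by (rule weak_conv_of_C1_conv[OF \<open>l > 0\<close> _ uc(2) _ u(2) _ _ _ _ rescale[OF lim(5) vc(1)] rescale[OF lim(6) vc(2)]])
      (use u(1) sv v0l vc in \<open>auto simp: solves_def intro!: continuous_intros\<close>)
  moreover have "eigenfunction l m0 n0 \<alpha>0 \<beta>0 (\<lambda>x. s * v0 x)"
    unfolding eigenfunction_iff[OF \<open>l > 0\<close> wt(3-5) ab] using sv v0l vnz s0 by auto
  ultimately show ?thesis using that[OF lim(1)] by blast
qed

section \<open>Almost everywhere bounds for the weights and their weak* limit\<close>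

lemma Linfty_integrable_indicator:
  assumes "f \<in> Linfty l" "S \<in> sets (Om l)"
  shows "integrable (Om l) (\<lambda>x. f x * indicator S x)"
proof -
  interpret finite_measure "Om l" by (rule finite_measure_lebesgue_on) auto
  obtain C where C: "AE x in Om l. \<bar>f x\<bar> \<le> C" and f: "f \<in> borel_measurable (Om l)"
    using assms(1) by (auto simp: Linfty_def)
  show ?thesis
  proof (rule integrable_const_bound[where B="\<bar>C\<bar>"])
    show "AE x in Om l. norm (f x * indicator S x) \<le> \<bar>C\<bar>"
      using C by eventually_elim (auto simp: indicator_def)
    show "(\<lambda>x. f x * indicator S x) \<in> borel_measurable (Om l)"
      using f assms(2) by measurable
  qed
qed

text \<open>Test the convergence against the indicator of the set where g < a: the lower bound
  survives in the limit of the integrals, so this set is null. The theorem assumes bounds only for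
  positive \<epsilon>; those of the limit weight are obtained here.\<close>

lemma weak_star_lower_bound:
  assumes ws: "weak_star_Linfty l f g F" and F: "F \<noteq> bot" and g: "g \<in> Linfty l"
    and f: "\<forall>\<^sub>F i in F. f i \<in> Linfty l \<and> (AE x in Om l. a \<le> f i x)"
  shows "AE x in Om l. a \<le> g x"
proof -
  have [measurable]: "g \<in> borel_measurable (Om l)" using g by (simp add: Linfty_def)
  define S where "S = {x \<in> space (Om l). g x < a}"
  have S[measurable]: "S \<in> sets (Om l)" unfolding S_def by measurable
  interpret finite_measure "Om l" by (rule finite_measure_lebesgue_on) auto
  have i: "integrable (Om l) (\<lambda>x. indicator S x :: real)"
    by (rule integrable_const_bound[where B=1]) (auto simp: indicator_def)
  have ai: "integrable (Om l) (\<lambda>x. a * indicator S x)" using i by simp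
  note gi = Linfty_integrable_indicator[OF g S]
  have "((\<lambda>i. \<integral>x. f i x * indicator S x \<partial>(Om l)) \<longlongrightarrow> (\<integral>x. g x * indicator S x \<partial>(Om l))) F"
    using ws i unfolding weak_star_Linfty_def by blast
  moreover have "\<forall>\<^sub>F i in F. (\<integral>x. a * indicator S x \<partial>(Om l)) \<le> (\<integral>x. f i x * indicator S x \<partial>(Om l))"
    using f
  proof eventually_elim
    case (elim i)
    show ?case
    proof (rule integral_mono_AE[OF ai Linfty_integrable_indicator[OF _ S]])
      show "AE x in Om l. a * indicator S x \<le> f i x * indicator S x"
        using elim[THEN conjunct2] by eventually_elim (auto simp: indicator_def)
    qed (use elim in blast)
  qed
  ultimately have le: "(\<integral>x. a * indicator S x \<partial>(Om l)) \<le> (\<integral>x. g x * indicator S x \<partial>(Om l))"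
    by (rule tendsto_lowerbound[OF _ _ F])
  have nn: "a * indicator S x - g x * indicator S x \<ge> 0" for x by (auto simp: S_def indicator_def)
  have di: "integrable (Om l) (\<lambda>x. a * indicator S x - g x * indicator S x)" using ai gi by (rule Bochner_Integration.integrable_diff)
  have "(\<integral>x. a * indicator S x - g x * indicator S x \<partial>(Om l)) \<le> 0"
    using le by (subst Bochner_Integration.integral_diff[OF ai gi]) simp
  moreover have "(\<integral>x. a * indicator S x - g x * indicator S x \<partial>(Om l)) \<ge> 0"
    using nn by (intro Bochner_Integration.integral_nonneg) auto
  ultimately have "AE x in Om l. a * indicator S x - g x * indicator S x = 0"
    using integral_nonneg_eq_0_iff_AE[OF di] nn by auto
  then show ?thesis
    using AE_space by eventually_elim (auto simp: S_def indicator_def split: if_splits)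
qed

lemma weak_star_bounds:
  assumes ws: "weak_star_Linfty l f g F" and F: "F \<noteq> bot" and g: "g \<in> Linfty l"
    and f: "\<forall>\<^sub>F i in F. f i \<in> Linfty l \<and> (AE x in Om l. a \<le> f i x \<and> f i x \<le> b)"
  shows "AE x in Om l. a \<le> g x \<and> g x \<le> b"
proof -
  have neg: "(\<lambda>x. - h x) \<in> Linfty l" if "h \<in> Linfty l" for h
    using that by (auto simp: Linfty_def)
  have "AE x in Om l. a \<le> g x"
    by (rule weak_star_lower_bound[OF ws F g]) (use f in eventually_elim, auto)
  moreover have "AE x in Om l. - b \<le> - g x"
  proof (rule weak_star_lower_bound[OF _ F neg[OF g]])
    show "weak_star_Linfty l (\<lambda>i x. - f i x) (\<lambda>x. - g x) F"
      using ws unfolding weak_star_Linfty_def by (auto intro!: tendsto_minus)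
    show "\<forall>\<^sub>F i in F. (\<lambda>x. - f i x) \<in> Linfty l \<and> (AE x in Om l. - b \<le> - f i x)"
      using f by eventually_elim (auto intro: neg)
  qed
  ultimately show ?thesis by eventually_elim auto
qed

text \<open>The bounds on the weights hold almost everywhere only; clamping makes them hold pointwise without
  changing any integral.\<close>

definition clamp_weight :: "real \<Rightarrow> real \<Rightarrow> (real \<Rightarrow> real) \<Rightarrow> real \<Rightarrow> real" where
  "clamp_weight a b m x = min b (max a (m x))"

lemma clamp_weight:
  assumes "m \<in> Linfty l" "AE x in Om l. a \<le> m x \<and> m x \<le> b" "a \<le> b"
  shows "weight a b l (clamp_weight a b m)" "AE x in Om l. m x = clamp_weight a b m x"
    "m \<in> borel_measurable (Om l)" "clamp_weight a b m \<in> borel_measurable (Om l)"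
proof -
  show m: "m \<in> borel_measurable (Om l)" using assms(1) by (simp add: Linfty_def)
  then show c: "clamp_weight a b m \<in> borel_measurable (Om l)"
    unfolding clamp_weight_def[abs_def] by measurable
  show "weight a b l (clamp_weight a b m)"
    unfolding weight_def using c assms(3) by (auto simp: clamp_weight_def)
  show "AE x in Om l. m x = clamp_weight a b m x"
    using assms(2) by eventually_elim (auto simp: clamp_weight_def)
qed

lemma weak_star_clamp:
  assumes ws: "weak_star_Linfty l f (f z) F" and e: "filterlim e F G"
    and z: "f z \<in> Linfty l" "AE x in Om l. a \<le> f z x \<and> f z x \<le> b" "a \<le> b"
    and f: "\<And>j. f (e j) \<in> Linfty l" "\<And>j. AE x in Om l. a \<le> f (e j) x \<and> f (e j) x \<le> b"
  shows "weak_star_Linfty l (\<lambda>j. clamp_weight a b (f (e j))) (clamp_weight a b (f z)) G"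
  unfolding weak_star_Linfty_def
proof (intro allI impI)
  fix \<phi> :: "real \<Rightarrow> real" assume \<phi>: "integrable (Om l) \<phi>"
  have [measurable]: "\<phi> \<in> borel_measurable (Om l)" using \<phi> by (rule borel_measurable_integrable)
  have eq: "(\<integral>x. clamp_weight a b h x * \<phi> x \<partial>(Om l)) = (\<integral>x. h x * \<phi> x \<partial>(Om l))"
    if h: "h \<in> Linfty l" "AE x in Om l. a \<le> h x \<and> h x \<le> b" for h
  proof -
    note c = clamp_weight[OF h z(3)]
    note c(3,4)[measurable]
    show ?thesis
      by (rule Bochner_Integration.integral_cong_AE) (use c(2) in auto)
  qed
  show "((\<lambda>j. \<integral>x. clamp_weight a b (f (e j)) x * \<phi> x \<partial>(Om l)) \<longlongrightarrow>
      (\<integral>x. clamp_weight a b (f z) x * \<phi> x \<partial>(Om l))) G"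
    unfolding eq[OF f] eq[OF z(1,2)]
    using filterlim_compose[OF _ e] ws \<phi> unfolding weak_star_Linfty_def by blast
qed

text \<open>Dependent choice takes each index below the preceding one, so that the sequence
  decreases strictly to 0; strict decrease of e is written as \<open>strict_mono\<close> of its
  negative.\<close>

lemma accumulation_point_sequence:
  assumes "accumulation_point p z"
  obtains e :: "nat \<Rightarrow> real" where "\<And>j. e j > 0" "strict_mono (\<lambda>j. - e j)" "e \<longlonglongrightarrow> 0" "(\<lambda>j. p (e j)) \<longlonglongrightarrow> z"
proof -
  have ex: "\<exists>x. 0 < x \<and> x < d \<and> dist (p x) z < \<eta>" if "d > 0" "\<eta> > 0" for d \<eta>
    using assms that unfolding accumulation_point_def frequently_def eventually_at_right_field by blast
  have "\<exists>e. \<forall>j. (0 < e j \<and> e j < inverse (real (Suc j)) \<and> dist (p (e j)) z < inverse (real (Suc j))) \<and> e (Suc j) < e j"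
  proof (rule dependent_nat_choice)
    show "\<exists>x. 0 < x \<and> x < inverse (real (Suc 0)) \<and> dist (p x) z < inverse (real (Suc 0))"
      by (rule ex) auto
    fix x :: real and j
    assume x: "0 < x \<and> x < inverse (real (Suc j)) \<and> dist (p x) z < inverse (real (Suc j))"
    obtain y where "0 < y" "y < min x (inverse (real (Suc (Suc j))))" "dist (p y) z < inverse (real (Suc (Suc j)))"
      using ex[of "min x (inverse (real (Suc (Suc j))))" "inverse (real (Suc (Suc j)))"] x by auto
    then show "\<exists>y. (0 < y \<and> y < inverse (real (Suc (Suc j))) \<and> dist (p y) z < inverse (real (Suc (Suc j)))) \<and> y < x"
      by auto
  qed
  then obtain e where e: "\<And>j. 0 < e j" "\<And>j. e j < inverse (real (Suc j))" "\<And>j. dist (p (e j)) z < inverse (real (Suc j))"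
    "\<And>j. e (Suc j) < e j" by blast
  show ?thesis
  proof (rule that[of e])
    show "strict_mono (\<lambda>j. - e j)" by (rule strict_mono_Suc_iff[THEN iffD2]) (simp add: e(4))
    show "e \<longlonglongrightarrow> 0"
      by (rule tendsto_sandwich[OF _ _ tendsto_const LIMSEQ_inverse_real_of_nat])
        (use e(1-3) in \<open>auto intro!: always_eventually less_imp_le simp del: of_nat_Suc\<close>)
    have "(\<lambda>j. dist (p (e j)) z) \<longlonglongrightarrow> 0"
      by (rule tendsto_sandwich[OF _ _ tendsto_const LIMSEQ_inverse_real_of_nat])
        (use e(1-3) in \<open>auto intro!: always_eventually less_imp_le simp del: of_nat_Suc\<close>)
    then show "(\<lambda>j. p (e j)) \<longlonglongrightarrow> z" by (rule tendsto_dist_iff[THEN iffD2])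
  qed (use e in auto)
qed

text \<open>Points of \<open>C_curve\<close> may switch between the plus and the minus branch as
  \<epsilon> varies; at least one branch occurs infinitely often.\<close>

lemma alternating_subsequence:
  fixes P Q :: "nat \<Rightarrow> bool"
  assumes "\<And>j. P j \<or> Q j"
  obtains r where "strict_mono (r :: nat \<Rightarrow> nat)" "\<forall>j. P (r j)" | r where "strict_mono (r :: nat \<Rightarrow> nat)" "\<forall>j. Q (r j)"
proof -
  have "infinite ({j. P j} \<union> {j. Q j})" using assms by (metis (mono_tags) UNIV_eq_I Un_iff infinite_UNIV_nat mem_Collect_eq)
  then consider "infinite {j. P j}" | "infinite {j. Q j}" by auto
  then show ?thesis using infinite_enumerate that by cases (metis mem_Collect_eq)+
qed

theorem theorem1p1:
  fixes l a b t :: real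
    and m n :: "real \<Rightarrow> real \<Rightarrow> real"
    and k :: nat
    and \<alpha> \<beta> :: "real \<Rightarrow> real"
  assumes "l > 0" and "0 < a" and "a \<le> b"
    and "\<And>\<epsilon>. \<epsilon> \<ge> 0 \<Longrightarrow> m \<epsilon> \<in> Linfty l"
    and "\<And>\<epsilon>. \<epsilon> \<ge> 0 \<Longrightarrow> n \<epsilon> \<in> Linfty l"
    and "\<And>\<epsilon>. \<epsilon> > 0 \<Longrightarrow> AE x in Om l. a \<le> m \<epsilon> x \<and> m \<epsilon> x \<le> b"
    and "\<And>\<epsilon>. \<epsilon> > 0 \<Longrightarrow> AE x in Om l. a \<le> n \<epsilon> x \<and> n \<epsilon> x \<le> b"
    and "weak_star_Linfty l m (m 0) (at_right 0)"
    and "weak_star_Linfty l n (n 0) (at_right 0)"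
    and "0 < t" and "t < 1"
    and "\<And>\<epsilon>. \<epsilon> > 0 \<Longrightarrow> (\<alpha> \<epsilon>, \<beta> \<epsilon>) \<in> C_curve l k (m \<epsilon>) (n \<epsilon>) \<inter> K_cone t"
  shows
    "bounded ((\<lambda>\<epsilon>. (\<alpha> \<epsilon>, \<beta> \<epsilon>)) ` {0<..}) \<and>
     C_curve l k (m 0) (n 0) \<inter> K_cone t \<subseteq> Fucik_spectrum l (m 0) (n 0) \<and>
     (\<forall>\<alpha>0 \<beta>0. accumulation_point (\<lambda>\<epsilon>. (\<alpha> \<epsilon>, \<beta> \<epsilon>)) (\<alpha>0, \<beta>0) \<longrightarrow>
        (\<alpha>0, \<beta>0) \<in> C_curve l k (m 0) (n 0) \<inter> K_cone t \<and>
        ((\<forall>\<epsilon>>0. (\<alpha> \<epsilon>, \<beta> \<epsilon>) \<in> C_plus l k (m \<epsilon>) (n \<epsilon>) \<inter> K_cone t) \<longrightarrow>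
           (\<alpha>0, \<beta>0) \<in> C_plus l k (m 0) (n 0)) \<and>
        ((\<forall>\<epsilon>>0. (\<alpha> \<epsilon>, \<beta> \<epsilon>) \<in> C_minus l k (m \<epsilon>) (n \<epsilon>) \<inter> K_cone t) \<longrightarrow>
           (\<alpha>0, \<beta>0) \<in> C_minus l k (m 0) (n 0)) \<and>
        (\<forall>u. (\<forall>\<epsilon>>0. eigenfunction l (m \<epsilon>) (n \<epsilon>) (\<alpha> \<epsilon>) (\<beta> \<epsilon>) (u \<epsilon>) \<and> L2_norm l (u \<epsilon>) = 1) \<longrightarrow>
           (\<exists>u0 \<in> H10 l. \<exists>\<epsilon>j :: nat \<Rightarrow> real.
              (\<forall>j. \<epsilon>j j > 0) \<and> decseq \<epsilon>j \<and> \<epsilon>j \<longlonglongrightarrow> 0 \<and>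
              weak_conv_H10 l (\<lambda>j. u (\<epsilon>j j)) u0 \<and>
              eigenfunction l (m 0) (n 0) \<alpha>0 \<beta>0 u0)))"
proof -
  note l = assms(1) and a = assms(2) and ab = assms(3) and t = assms(10,11)
  \<comment> \<open>Clamping changes the weights on null sets only, hence neither the curves nor the
    eigenfunctions.\<close>
  define M where "M = (\<lambda>\<epsilon>. clamp_weight a b (m \<epsilon>))"
  define N where "N = (\<lambda>\<epsilon>. clamp_weight a b (n \<epsilon>))"
  have F: "at_right (0::real) \<noteq> bot" by simp
  have pos: "\<forall>\<^sub>F \<epsilon> in at_right (0::real). \<epsilon> > 0" by (rule eventually_at_right_less)
  \<comment> \<open>For \<epsilon> = 0 the bounds come from the weak* limit, not from the
    assumptions.\<close>
  have mb: "AE x in Om l. a \<le> m \<epsilon> x \<and> m \<epsilon> x \<le> b" if "\<epsilon> \<ge> 0" for \<epsilon>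
  proof (cases "\<epsilon> = 0")
    case True
    have "AE x in Om l. a \<le> m 0 x \<and> m 0 x \<le> b"
      by (rule weak_star_bounds[OF assms(8) F assms(4)], simp, rule eventually_mono[OF pos]) (use assms(4,6) in auto)
    then show ?thesis using True by simp
  qed (use that assms(6) in simp)
  have nb: "AE x in Om l. a \<le> n \<epsilon> x \<and> n \<epsilon> x \<le> b" if "\<epsilon> \<ge> 0" for \<epsilon>
  proof (cases "\<epsilon> = 0")
    case True
    have "AE x in Om l. a \<le> n 0 x \<and> n 0 x \<le> b"
      by (rule weak_star_bounds[OF assms(9) F assms(5)], simp, rule eventually_mono[OF pos]) (use assms(5,7) in auto)
    then show ?thesis using True by simp
  qed (use that assms(7) in simp)
  have W: "weight a b l (M \<epsilon>)" "weight a b l (N \<epsilon>)" if "\<epsilon> \<ge> 0" for \<epsilon>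
    unfolding M_def N_def
    using clamp_weight(1)[OF assms(4) mb ab] clamp_weight(1)[OF assms(5) nb ab] that by auto
  have cong: "eigenfunction l (m \<epsilon>) (n \<epsilon>) = eigenfunction l (M \<epsilon>) (N \<epsilon>)"
    "C_plus l k (m \<epsilon>) (n \<epsilon>) = C_plus l k (M \<epsilon>) (N \<epsilon>)" "C_minus l k (m \<epsilon>) (n \<epsilon>) = C_minus l k (M \<epsilon>) (N \<epsilon>)"
    if e: "\<epsilon> \<ge> 0" for \<epsilon>
    unfolding M_def N_def
    by (rule weak_curves_cong_AE[OF clamp_weight(3,4)[OF assms(4)[OF e] mb[OF e] ab]
          clamp_weight(3,4)[OF assms(5)[OF e] nb[OF e] ab]
          clamp_weight(2)[OF assms(4)[OF e] mb[OF e] ab] clamp_weight(2)[OF assms(5)[OF e] nb[OF e] ab]])+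
  \<comment> \<open>The cone is symmetric under exchanging the coordinates, so membership in the
    minus branch reduces to the plus branch with the weights swapped.\<close>
  have minus: "(x, y) \<in> C_minus l k (M \<epsilon>) (N \<epsilon>) \<inter> K_cone t \<longleftrightarrow> (y, x) \<in> C_plus l k (N \<epsilon>) (M \<epsilon>) \<inter> K_cone t"
    if e: "\<epsilon> \<ge> 0" for x y \<epsilon>
    using C_minus_iff[OF l W[OF e] a] K_cone_swap[OF t(1), of x y] by simp
  define R where "R = (pi * real (k + 1) / l)\<^sup>2 / a / t"
  have "(\<lambda>\<epsilon>. (\<alpha> \<epsilon>, \<beta> \<epsilon>)) ` {0<..} \<subseteq> {0..R} \<times> {0..R}"
  proof (rule image_subsetI)
    fix \<epsilon> :: real assume "\<epsilon> \<in> {0<..}"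
    then have e: "\<epsilon> > 0" "\<epsilon> \<ge> 0" by auto
    from assms(12)[OF e(1)] consider "(\<alpha> \<epsilon>, \<beta> \<epsilon>) \<in> C_plus l k (M \<epsilon>) (N \<epsilon>) \<inter> K_cone t"
      | "(\<beta> \<epsilon>, \<alpha> \<epsilon>) \<in> C_plus l k (N \<epsilon>) (M \<epsilon>) \<inter> K_cone t"
      unfolding C_curve_def cong[OF e(2)] minus[OF e(2), symmetric] by blast
    then show "(\<alpha> \<epsilon>, \<beta> \<epsilon>) \<in> {0..R} \<times> {0..R}"
      by cases (use C_plus_bound[OF l W[OF e(2)] a t] C_plus_bound[OF l W(2)[OF e(2)] W(1)[OF e(2)] a t] in \<open>auto simp: R_def\<close>)
  qed
  then have bdd: "bounded ((\<lambda>\<epsilon>. (\<alpha> \<epsilon>, \<beta> \<epsilon>)) ` {0<..})"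
    by (rule bounded_subset[OF bounded_Times[OF bounded_closed_interval bounded_closed_interval]])
  have sub: "C_curve l k (m 0) (n 0) \<inter> K_cone t \<subseteq> Fucik_spectrum l (m 0) (n 0)"
  proof (rule subsetI)
    fix z assume z: "z \<in> C_curve l k (m 0) (n 0) \<inter> K_cone t"
    obtain x y where xy: "z = (x, y)" by (cases z)
    from z consider "(x, y) \<in> C_plus l k (M 0) (N 0)" | "(y, x) \<in> C_plus l k (N 0) (M 0) \<inter> K_cone t"
      unfolding C_curve_def cong[OF order_refl] minus[OF order_refl, symmetric] xy by blast
    then have "\<exists>u. eigenfunction l (M 0) (N 0) x y u"
    proof cases
      case 1
      then show ?thesis by (rule C_plus_eigenfunction[OF l W[OF order_refl] a])
    next
      case 2
      then obtain u where "eigenfunction l (N 0) (M 0) y x u"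
        using C_plus_eigenfunction[OF l W(2)[OF order_refl] W(1)[OF order_refl] a] by blast
      then show ?thesis using eigenfunction_uminus[OF l W(2)[OF order_refl] W(1)[OF order_refl] a] by blast
    qed
    then show "z \<in> Fucik_spectrum l (m 0) (n 0)"
      unfolding Fucik_spectrum_def cong[OF order_refl] xy by simp
  qed
  have ws: "weak_star_Linfty l (\<lambda>j. M (e j)) (M 0) sequentially" "weak_star_Linfty l (\<lambda>j. N (e j)) (N 0) sequentially"
    if e: "\<And>j. e j > 0" "e \<longlonglongrightarrow> 0" for e :: "nat \<Rightarrow> real"
  proof -
    have er: "filterlim e (at_right 0) sequentially"
      using e(2) e(1)[THEN less_imp_neq, THEN not_sym] e(1) by (simp add: filterlim_at)
    show "weak_star_Linfty l (\<lambda>j. M (e j)) (M 0) sequentially"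
      unfolding M_def
      by (rule weak_star_clamp[OF assms(8) er assms(4)[OF order_refl] mb[OF order_refl] ab
            assms(4)[OF less_imp_le[OF e(1)]] mb[OF less_imp_le[OF e(1)]]])
    show "weak_star_Linfty l (\<lambda>j. N (e j)) (N 0) sequentially"
      unfolding N_def
      by (rule weak_star_clamp[OF assms(9) er assms(5)[OF order_refl] nb[OF order_refl] ab
            assms(5)[OF less_imp_le[OF e(1)]] nb[OF less_imp_le[OF e(1)]]])
  qed
  have plus_lim: "(x0, y0) \<in> C_plus l k (M 0) (N 0) \<inter> K_cone t"
    if e: "\<And>j. e j > 0" "e \<longlonglongrightarrow> 0" "(\<lambda>j. \<alpha> (e j)) \<longlonglongrightarrow> x0" "(\<lambda>j. \<beta> (e j)) \<longlonglongrightarrow> y0"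
      and c: "\<And>j. (\<alpha> (e j), \<beta> (e j)) \<in> C_plus l k (M (e j)) (N (e j)) \<inter> K_cone t" for e :: "nat \<Rightarrow> real" and x0 y0
    by (rule C_plus_closed[OF W(1) W(2) W(1) W(2) a l ws(1)[OF e(1,2)] ws(2)[OF e(1,2)] e(3,4) t(1) c])
      (use e(1) less_imp_le in auto)
  have minus_lim: "(x0, y0) \<in> C_minus l k (M 0) (N 0) \<inter> K_cone t"
    if e: "\<And>j. e j > 0" "e \<longlonglongrightarrow> 0" "(\<lambda>j. \<alpha> (e j)) \<longlonglongrightarrow> x0" "(\<lambda>j. \<beta> (e j)) \<longlonglongrightarrow> y0"
      and c: "\<And>j. (\<alpha> (e j), \<beta> (e j)) \<in> C_minus l k (M (e j)) (N (e j)) \<inter> K_cone t" for e :: "nat \<Rightarrow> real" and x0 y0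
    unfolding minus[OF order_refl]
    by (rule C_plus_closed[OF W(2) W(1) W(2) W(1) a l ws(2)[OF e(1,2)] ws(1)[OF e(1,2)] e(4,3) t(1)
          c[unfolded minus[OF less_imp_le[OF e(1)]]]])
      (use e(1) less_imp_le in auto)
  show ?thesis
  proof (intro conjI bdd sub allI impI)
    fix \<alpha>0 \<beta>0 assume "accumulation_point (\<lambda>\<epsilon>. (\<alpha> \<epsilon>, \<beta> \<epsilon>)) (\<alpha>0, \<beta>0)"
    then obtain e :: "nat \<Rightarrow> real" where e: "\<And>j. e j > 0" "strict_mono (\<lambda>j. - e j)" "e \<longlonglongrightarrow> 0"
      and ab_lim: "(\<lambda>j. (\<alpha> (e j), \<beta> (e j))) \<longlonglongrightarrow> (\<alpha>0, \<beta>0)"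
      by (rule accumulation_point_sequence) blast
    have \<alpha>l: "(\<lambda>j. \<alpha> (e j)) \<longlonglongrightarrow> \<alpha>0" and \<beta>l: "(\<lambda>j. \<beta> (e j)) \<longlonglongrightarrow> \<beta>0"
      using tendsto_fst[OF ab_lim] tendsto_snd[OF ab_lim] by simp_all
    note sq = LIMSEQ_subseq_LIMSEQ[unfolded o_def]
    have e0: "e j \<ge> 0" for j using e(1)[of j] by simp
    have PQ: "(\<alpha> (e j), \<beta> (e j)) \<in> C_plus l k (M (e j)) (N (e j)) \<inter> K_cone t \<or>
        (\<alpha> (e j), \<beta> (e j)) \<in> C_minus l k (M (e j)) (N (e j)) \<inter> K_cone t" for j
      using assms(12)[OF e(1)[of j]] unfolding C_curve_def cong[OF e0] by blast
    \<comment> \<open>One branch is visited along a subsequence, which has the same limit.\<close>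
    have "(\<alpha>0, \<beta>0) \<in> (C_plus l k (M 0) (N 0) \<union> C_minus l k (M 0) (N 0)) \<inter> K_cone t"
    proof (rule alternating_subsequence[OF PQ])
      fix r :: "nat \<Rightarrow> nat" assume r: "strict_mono r" "\<forall>j. (\<alpha> (e (r j)), \<beta> (e (r j))) \<in> C_plus l k (M (e (r j))) (N (e (r j))) \<inter> K_cone t"
      show ?thesis
        using plus_lim[of "\<lambda>j. e (r j)", OF e(1) sq[OF e(3) r(1)] sq[OF \<alpha>l r(1)] sq[OF \<beta>l r(1)]] r(2) by blast
    next
      fix r :: "nat \<Rightarrow> nat" assume r: "strict_mono r" "\<forall>j. (\<alpha> (e (r j)), \<beta> (e (r j))) \<in> C_minus l k (M (e (r j))) (N (e (r j))) \<inter> K_cone t"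
      show ?thesis
        using minus_lim[of "\<lambda>j. e (r j)", OF e(1) sq[OF e(3) r(1)] sq[OF \<alpha>l r(1)] sq[OF \<beta>l r(1)]] r(2) by blast
    qed
    then show "(\<alpha>0, \<beta>0) \<in> C_curve l k (m 0) (n 0) \<inter> K_cone t"
      unfolding C_curve_def cong[OF order_refl] .
    show "(\<alpha>0, \<beta>0) \<in> C_plus l k (m 0) (n 0)"
      if c: "\<forall>\<epsilon>>0. (\<alpha> \<epsilon>, \<beta> \<epsilon>) \<in> C_plus l k (m \<epsilon>) (n \<epsilon>) \<inter> K_cone t"
    proof -
      have "(\<alpha> (e j), \<beta> (e j)) \<in> C_plus l k (M (e j)) (N (e j)) \<inter> K_cone t" for j
        using c[rule_format, OF e(1)[of j]] unfolding cong[OF e0] .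
      from plus_lim[OF e(1,3) \<alpha>l \<beta>l this] show ?thesis unfolding cong[OF order_refl] by blast
    qed
    show "(\<alpha>0, \<beta>0) \<in> C_minus l k (m 0) (n 0)"
      if c: "\<forall>\<epsilon>>0. (\<alpha> \<epsilon>, \<beta> \<epsilon>) \<in> C_minus l k (m \<epsilon>) (n \<epsilon>) \<inter> K_cone t"
    proof -
      have "(\<alpha> (e j), \<beta> (e j)) \<in> C_minus l k (M (e j)) (N (e j)) \<inter> K_cone t" for j
        using c[rule_format, OF e(1)[of j]] unfolding cong[OF e0] .
      from minus_lim[OF e(1,3) \<alpha>l \<beta>l this] show ?thesis unfolding cong[OF order_refl] by blast
    qed
    fix u assume u: "\<forall>\<epsilon>>0. eigenfunction l (m \<epsilon>) (n \<epsilon>) (\<alpha> \<epsilon>) (\<beta> \<epsilon>) (u \<epsilon>) \<and> L2_norm l (u \<epsilon>) = 1"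
    have ue: "eigenfunction l (M (e j)) (N (e j)) (\<alpha> (e j)) (\<beta> (e j)) (u (e j))" "L2_norm l (u (e j)) = 1" for j
      using u e(1)[of j] unfolding cong(1)[OF e0, symmetric] by auto
    obtain r u0 where r: "strict_mono (r :: nat \<Rightarrow> nat)" "weak_conv_H10 l (\<lambda>j. u (e (r j))) u0"
      "eigenfunction l (M 0) (N 0) \<alpha>0 \<beta>0 u0"
      by (rule eigenfunctions_subconverge[OF W(1)[OF e0] W(2)[OF e0] W(1)[OF order_refl] W(2)[OF order_refl] a l
          ws(1)[OF e(1,3)] ws(2)[OF e(1,3)] \<alpha>l \<beta>l ue]) blast
    show "\<exists>u0\<in>H10 l. \<exists>\<epsilon>j :: nat \<Rightarrow> real. (\<forall>j. \<epsilon>j j > 0) \<and> decseq \<epsilon>j \<and> \<epsilon>j \<longlonglongrightarrow> 0 \<and>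
        weak_conv_H10 l (\<lambda>j. u (\<epsilon>j j)) u0 \<and> eigenfunction l (m 0) (n 0) \<alpha>0 \<beta>0 u0"
    proof (intro bexI[of _ u0] exI[of _ "\<lambda>j. e (r j)"] conjI allI e(1) r(2) sq[OF e(3) r(1)])
      \<comment> \<open>The sequence was chosen decreasing beforehand so that every subsequence
        extracted by compactness still decreases.\<close>
      show "decseq (\<lambda>j. e (r j))"
        using strict_mono_less_eq[OF e(2)] strict_mono_less_eq[OF r(1)] by (auto simp: decseq_def)
      show "eigenfunction l (m 0) (n 0) \<alpha>0 \<beta>0 u0" using r(3) unfolding cong(1)[OF order_refl] .
      show "u0 \<in> H10 l" using r(3) by (simp add: eigenfunction_def weak_solution_def)
    qed
  qed
qed

end
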